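(* Let $\Bbbk$ be a field of characteristic $0$, let $\mathcal{J}$ be the super Jordan plane over $\Bbbk$, $s=xy+yx$, and $\mathcal{J}_s$ the localization of $\mathcal{J}$ at the powers of $s$. Then: (1) The centers of $\mathcal{J}_s$ and $\mathcal{J}$ are trivial: $Z(\mathcal{J}_s)=Z(\mathcal{J})=\Bbbk$. (2) The algebra $\mathcal{J}_s$ is simple, and hence prime. (3) The classical quotient ring of $\mathcal{J}$ is $Q(\mathcal{J})\cong M_2(D_1(\Bbbk))$, a central simple algebra over the Weyl skewfield $D_1(\Bbbk)$.
   Context: The super Jordan plane $\mathcal{J}$ over a field $\Bbbk$ is the unital associative $\Bbbk$-algebra generated by $x,y$ with defining relations $x^2=0$ and $y^2x-xy^2-xyx=0$. Put $s:=xy+yx$. The elements $x^is^jy^k$ ($i\in\{0,1\}$, $j,k\geq 0$) form a $\Bbbk$-basis of $\mathcal{J}$, and $\mathcal{J}$ is Noetherian. The element $s$ is normal ($s\mathcal{J}=\mathcal{J}s$; indeed $sx=xs$, $sy=(y-x)s$) and regular, so the localization $\mathcal{J}_s$ at the powers of $s$ exists and contains $\mathcal{J}$. $Z(R)$ denotes the center of a ring $R$, and $M_2(R)$ the ring of $2\times 2$ matrices over $R$. The first Weyl algebra $A_1$ is the $\Bbbk$-algebra generated by $\partial,t$ with relation $\partial t-t\partial=1$; for $\mathrm{char}\,\Bbbk=0$ it is a simple Noetherian domain, and its skewfield of fractions $D_1(\Bbbk):=\mathrm{Frac}(A_1)$ is called the Weyl skewfield. For a ring $R$ whose set $\mathcal{C}_R$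 of regular elements (non-zero-divisors on both sides) is a left and right Ore set, the classical quotient ring is $Q(R)=\mathcal{C}_R^{-1}R=R\,\mathcal{C}_R^{-1}$. *)

theory Defs
  imports
    "HOL-Algebra.Algebra"
    "HOL-Algebra.Algebraic_Closure_Type"
    "HOL-Library.Poly_Mapping"
begin

section \<open>Algebras given by generators and relations\<close>

text \<open>Words in the letters \<open>'g\<close>, i.e. the free monoid, written additively because
  \<^type>\<open>poly_mapping\<close> multiplies by convolution over an additive monoid. Hence
  \<open>'g word \<Rightarrow>\<^sub>0 'k\<close> is the free associative unital \<open>'k\<close>-algebra on \<open>'g\<close>.\<close>

datatype 'g word = Word (letters: "'g list")

instantiation word :: (type) monoid_add
begin

definition zero_word :: "'a word" where
  "zero_word = Word []"

definition plus_word :: "'a word \<Rightarrow> 'a word \<Rightarrow> 'a word" where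
  "plus_word u v = Word (letters u @ letters v)"

instance
  by standard (simp_all add: zero_word_def plus_word_def)

end

definition free_gen :: "'g \<Rightarrow> 'g word \<Rightarrow>\<^sub>0 'k::field" where
  "free_gen g = Poly_Mapping.single (Word [g]) 1"

definition free_const :: "'k \<Rightarrow> 'g word \<Rightarrow>\<^sub>0 'k::field" where
  "free_const c = Poly_Mapping.single 0 c"

definition presented_algebra ::
    "('g word \<Rightarrow>\<^sub>0 'k::field) set \<Rightarrow> ('g word \<Rightarrow>\<^sub>0 'k) set ring" where
  "presented_algebra E = ring_of_type_algebra Quot (Idl\<^bsub>ring_of_type_algebra\<^esub> E)"

definition presented_class ::
    "('g word \<Rightarrow>\<^sub>0 'k::field) set \<Rightarrow> ('g word \<Rightarrow>\<^sub>0 'k) \<Rightarrow> ('g word \<Rightarrow>\<^sub>0 'k) set" where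
  "presented_class E a =
     (Idl\<^bsub>ring_of_type_algebra\<^esub> E) +>\<^bsub>ring_of_type_algebra\<^esub> a"


section \<open>The super Jordan plane and the first Weyl algebra\<close>

datatype jordan_gen = Jordan_X | Jordan_Y

type_synonym 'k jordan_elt = "(jordan_gen word \<Rightarrow>\<^sub>0 'k) set"

definition jordan_relations :: "(jordan_gen word \<Rightarrow>\<^sub>0 'k::field) set" where
  "jordan_relations =
     (let x = free_gen Jordan_X; y = free_gen Jordan_Y
      in {x * x, y * y * x - x * y * y - x * y * x})"

definition super_jordan :: "'k::field jordan_elt ring" where
  "super_jordan = presented_algebra jordan_relations"

definition jordan_const :: "'k::field \<Rightarrow> 'k jordan_elt" where
  "jordan_const c = presented_class jordan_relations (free_const c)"

definition jordan_x :: "'k::field jordan_elt" where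
  "jordan_x = presented_class jordan_relations (free_gen Jordan_X)"

definition jordan_y :: "'k::field jordan_elt" where
  "jordan_y = presented_class jordan_relations (free_gen Jordan_Y)"

definition jordan_s :: "'k::field jordan_elt" where
  "jordan_s = jordan_x \<otimes>\<^bsub>super_jordan\<^esub> jordan_y \<oplus>\<^bsub>super_jordan\<^esub> jordan_y \<otimes>\<^bsub>super_jordan\<^esub> jordan_x"

definition jordan_s_powers :: "'k::field jordan_elt set" where
  "jordan_s_powers = range (\<lambda>n::nat. jordan_s [^]\<^bsub>super_jordan\<^esub> n)"

datatype weyl_gen = Weyl_D | Weyl_T

type_synonym 'k weyl_elt = "(weyl_gen word \<Rightarrow>\<^sub>0 'k) set"

definition weyl_relations :: "(weyl_gen word \<Rightarrow>\<^sub>0 'k::field) set" where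
  "weyl_relations =
     (let d = free_gen Weyl_D; t = free_gen Weyl_T in {d * t - t * d - 1})"

definition weyl_algebra :: "'k::field weyl_elt ring" where
  "weyl_algebra = presented_algebra weyl_relations"

definition weyl_const :: "'k::field \<Rightarrow> 'k weyl_elt" where
  "weyl_const c = presented_class weyl_relations (free_const c)"


section \<open>Noncommutative ring theory\<close>

definition ring_center :: "('a, 'm) ring_scheme \<Rightarrow> 'a set" where
  "ring_center R = {z \<in> carrier R. \<forall>r \<in> carrier R. z \<otimes>\<^bsub>R\<^esub> r = r \<otimes>\<^bsub>R\<^esub> z}"

definition simple_ring :: "('a, 'm) ring_scheme \<Rightarrow> bool" where
  "simple_ring R \<longleftrightarrow> ring R \<and> \<one>\<^bsub>R\<^esub> \<noteq> \<zero>\<^bsub>R\<^esub> \<and>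
     (\<forall>I. ideal I R \<longrightarrow> I = {\<zero>\<^bsub>R\<^esub>} \<or> I = carrier R)"

definition prime_ring :: "('a, 'm) ring_scheme \<Rightarrow> bool" where
  "prime_ring R \<longleftrightarrow> ring R \<and> \<one>\<^bsub>R\<^esub> \<noteq> \<zero>\<^bsub>R\<^esub> \<and>
     (\<forall>I J. ideal I R \<and> ideal J R \<and> (\<forall>a \<in> I. \<forall>b \<in> J. a \<otimes>\<^bsub>R\<^esub> b = \<zero>\<^bsub>R\<^esub>) \<longrightarrow>
        I = {\<zero>\<^bsub>R\<^esub>} \<or> J = {\<zero>\<^bsub>R\<^esub>})"

definition skewfield :: "('a, 'm) ring_scheme \<Rightarrow> bool" where
  "skewfield D \<longleftrightarrow> ring D \<and> \<one>\<^bsub>D\<^esub> \<noteq> \<zero>\<^bsub>D\<^esub> \<and> Units D = carrier D - {\<zero>\<^bsub>D\<^esub>}"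

definition regular_elements :: "('a, 'm) ring_scheme \<Rightarrow> 'a set" where
  "regular_elements R = {c \<in> carrier R. \<forall>r \<in> carrier R.
     (c \<otimes>\<^bsub>R\<^esub> r = \<zero>\<^bsub>R\<^esub> \<longrightarrow> r = \<zero>\<^bsub>R\<^esub>) \<and> (r \<otimes>\<^bsub>R\<^esub> c = \<zero>\<^bsub>R\<^esub> \<longrightarrow> r = \<zero>\<^bsub>R\<^esub>)}"

definition right_ore_set :: "('a, 'm) ring_scheme \<Rightarrow> 'a set \<Rightarrow> bool" where
  "right_ore_set R S \<longleftrightarrow>
     (\<forall>r \<in> carrier R. \<forall>s \<in> S. \<exists>r' \<in> carrier R. \<exists>s' \<in> S. r \<otimes>\<^bsub>R\<^esub> s' = s \<otimes>\<^bsub>R\<^esub> r')"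

definition left_ore_set :: "('a, 'm) ring_scheme \<Rightarrow> 'a set \<Rightarrow> bool" where
  "left_ore_set R S \<longleftrightarrow>
     (\<forall>r \<in> carrier R. \<forall>s \<in> S. \<exists>r' \<in> carrier R. \<exists>s' \<in> S. s' \<otimes>\<^bsub>R\<^esub> r = r' \<otimes>\<^bsub>R\<^esub> s)"

text \<open>\<open>Q\<close> together with \<open>\<phi>: R \<rightarrow> Q\<close> is a (two-sided) ring of fractions
  \<open>S\<^sup>-\<^sup>1 R = R S\<^sup>-\<^sup>1\<close>. Such a pair is unique up to a unique isomorphism under \<open>R\<close>.\<close>

definition ring_of_fractions ::
    "('a, 'm) ring_scheme \<Rightarrow> 'a set \<Rightarrow> ('b, 'n) ring_scheme \<Rightarrow> ('a \<Rightarrow> 'b) \<Rightarrow> bool" where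
  "ring_of_fractions R S Q \<phi> \<longleftrightarrow>
     ring Q \<and> \<phi> \<in> ring_hom R Q \<and> \<phi> ` S \<subseteq> Units Q \<and>
     carrier Q = {\<phi> r \<otimes>\<^bsub>Q\<^esub> inv\<^bsub>Q\<^esub> (\<phi> s) | r s. r \<in> carrier R \<and> s \<in> S} \<and>
     carrier Q = {inv\<^bsub>Q\<^esub> (\<phi> s) \<otimes>\<^bsub>Q\<^esub> \<phi> r | r s. r \<in> carrier R \<and> s \<in> S} \<and>
     a_kernel R Q \<phi> = {r \<in> carrier R. \<exists>s \<in> S. r \<otimes>\<^bsub>R\<^esub> s = \<zero>\<^bsub>R\<^esub>} \<and>
     a_kernel R Q \<phi> = {r \<in> carrier R. \<exists>s \<in> S. s \<otimes>\<^bsub>R\<^esub> r = \<zero>\<^bsub>R\<^esub>}"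

definition classical_quotient_ring ::
    "('a, 'm) ring_scheme \<Rightarrow> ('b, 'n) ring_scheme \<Rightarrow> ('a \<Rightarrow> 'b) \<Rightarrow> bool" where
  "classical_quotient_ring R Q \<phi> \<longleftrightarrow>
     left_ore_set R (regular_elements R) \<and> right_ore_set R (regular_elements R) \<and>
     ring_of_fractions R (regular_elements R) Q \<phi>"

definition skewfield_of_fractions ::
    "('a, 'm) ring_scheme \<Rightarrow> ('b, 'n) ring_scheme \<Rightarrow> ('a \<Rightarrow> 'b) \<Rightarrow> bool" where
  "skewfield_of_fractions R D \<phi> \<longleftrightarrow>
     skewfield D \<and> ring_of_fractions R (carrier R - {\<zero>\<^bsub>R\<^esub>}) D \<phi>"

text \<open>\<open>n \<times> n\<close> matrices over a not necessarily commutative ring, as functions on pairs of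
  indices \<open>i, j < n\<close> (\<^const>\<open>undefined\<close> elsewhere).\<close>

definition matrix_ring :: "nat \<Rightarrow> ('a, 'm) ring_scheme \<Rightarrow> (nat \<times> nat \<Rightarrow> 'a) ring" where
  "matrix_ring n R =
     \<lparr>carrier = ({..<n} \<times> {..<n}) \<rightarrow>\<^sub>E carrier R,
      monoid.mult = (\<lambda>A B. \<lambda>(i, j) \<in> {..<n} \<times> {..<n}.
                       \<Oplus>\<^bsub>R\<^esub>l \<in> {..<n}. A (i, l) \<otimes>\<^bsub>R\<^esub> B (l, j)),
      one = (\<lambda>(i, j) \<in> {..<n} \<times> {..<n}. if i = j then \<one>\<^bsub>R\<^esub> else \<zero>\<^bsub>R\<^esub>),
      ring.zero = (\<lambda>(i, j) \<in> {..<n} \<times> {..<n}. \<zero>\<^bsub>R\<^esub>),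
      add = (\<lambda>A B. \<lambda>(i, j) \<in> {..<n} \<times> {..<n}. A (i, j) \<oplus>\<^bsub>R\<^esub> B (i, j))\<rparr>"

definition scalar_matrix ::
    "nat \<Rightarrow> ('a, 'm) ring_scheme \<Rightarrow> 'a \<Rightarrow> nat \<times> nat \<Rightarrow> 'a" where
  "scalar_matrix n R a =
     (\<lambda>(i, j) \<in> {..<n} \<times> {..<n}. if i = j then a else \<zero>\<^bsub>R\<^esub>)"

text \<open>A central simple algebra \<open>Q\<close> over a skewfield \<open>D\<close>, with structure map \<open>\<iota>: D \<rightarrow> Q\<close>:
  \<open>Q\<close> is a simple ring, finite-dimensional over \<open>D\<close>, whose center is that of \<open>D\<close>. As \<open>D\<close> may be
  noncommutative, centrality cannot mean that the center of \<open>Q\<close> is all of \<open>\<iota> D\<close>; for a field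
  \<open>D\<close> it does, and the usual notion results.\<close>

definition central_simple_over ::
    "('d, 'm) ring_scheme \<Rightarrow> ('a, 'n) ring_scheme \<Rightarrow> ('d \<Rightarrow> 'a) \<Rightarrow> bool" where
  "central_simple_over D Q \<iota> \<longleftrightarrow>
     skewfield D \<and> simple_ring Q \<and> \<iota> \<in> ring_hom D Q \<and>
     ring_center Q = \<iota> ` ring_center D \<and>
     (\<exists>B \<subseteq> carrier Q. finite B \<and>
        (\<forall>q \<in> carrier Q. \<exists>c \<in> B \<rightarrow> carrier D. q = (\<Oplus>\<^bsub>Q\<^esub>b \<in> B. \<iota> (c b) \<otimes>\<^bsub>Q\<^esub> b)))"

end

theory Submission
  imports Defs
begin

text \<open>Let \<open>A\<close> be the Weyl algebra and \<open>D\<close> its skew field of fractions. The matrices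
  \<open>x = e\<^sub>1\<^sub>2\<close> and \<open>y = t\<partial> e\<^sub>1\<^sub>2 + t e\<^sub>2\<^sub>1\<close> over \<open>A\<close> satisfy the relations of the super Jordan plane,
  \<open>s\<close> becomes the scalar matrix \<open>t\<close>, and comparing degrees in \<open>\<partial>\<close> shows that the resulting map
  \<open>J \<rightarrow> M\<^sub>2(A)\<close> is injective. The image contains \<open>t e\<^sub>1\<^sub>1\<close>, \<open>t\<^sup>2 e\<^sub>2\<^sub>1\<close> and \<open>t\<^sup>2\<partial>t\<^sup>2 e\<^sub>1\<^sub>1\<close>, so every matrix
  over \<open>A\<close> is a fraction of the image with denominator \<open>t\<^sup>n\<close>, on either side. Hence \<open>M\<^sub>2(D)\<close> is the
  classical quotient ring of \<open>J\<close>, and \<open>J\<^sub>s\<close> sits in it as \<open>M\<^sub>2(A[t\<^sup>-\<^sup>1])\<close>. An element commuting with \<open>x\<close>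
  and \<open>y\<close> is a scalar matrix whose entry commutes with \<open>t\<close> and \<open>\<partial>\<close>, hence a constant. A nonzero
  ideal of \<open>J\<^sub>s\<close> contains some \<open>a e\<^sub>1\<^sub>1\<close> with \<open>0 \<noteq> a \<in> A\<close>; commutators with \<open>t\<close> and \<open>t\<^sup>2\<partial>t\<^sup>2\<close> reduce \<open>a\<close> to a
  power of \<open>t\<close>.\<close>

section \<open>A normal form model of the Weyl algebra\<close>

definition weyl_deriv :: "'a::idom poly poly \<Rightarrow> 'a poly poly" where
  "weyl_deriv P = pCons 0 P + map_poly pderiv P"

definition weyl_mult :: "'a::idom poly poly \<Rightarrow> 'a poly poly \<Rightarrow> 'a poly poly" where
  "weyl_mult P Q = fold_coeffs (\<lambda>p F Q. smult p Q + F (weyl_deriv Q)) P (\<lambda>_. 0) Q"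

lemma coeff_weyl_deriv:
  "coeff (weyl_deriv P) n = (if n = 0 then 0 else coeff P (n - 1)) + pderiv (coeff P n)"
  by (simp add: weyl_deriv_def coeff_map_poly coeff_pCons split: nat.split)

lemma weyl_deriv_0 [simp]: "weyl_deriv 0 = 0"
  by (simp add: weyl_deriv_def)

lemma weyl_deriv_add: "weyl_deriv (P + Q) = weyl_deriv P + weyl_deriv Q"
  by (simp add: poly_eq_iff coeff_weyl_deriv pderiv_add)

lemma weyl_deriv_smult: "weyl_deriv (smult p P) = smult p (weyl_deriv P) + smult (pderiv p) P"
  by (simp add: poly_eq_iff coeff_weyl_deriv pderiv_mult algebra_simps)

lemma weyl_deriv_pCons: "weyl_deriv (pCons p P) = pCons (pderiv p) (pCons p 0 + weyl_deriv P)"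
  by (rule poly_eqI) (auto simp: coeff_weyl_deriv coeff_pCons pderiv_add split: nat.split)

lemma weyl_mult_0_left [simp]: "weyl_mult 0 Q = 0"
  by (simp add: weyl_mult_def)

lemma weyl_mult_pCons_left:
  "weyl_mult (pCons p P) Q = smult p Q + weyl_mult P (weyl_deriv Q)"
  by (cases "p = 0 \<and> P = 0") (auto simp: weyl_mult_def)

lemma weyl_mult_add_right: "weyl_mult P (Q + R) = weyl_mult P Q + weyl_mult P R"
  by (induction P arbitrary: Q R)
     (simp_all add: weyl_mult_pCons_left weyl_deriv_add smult_add_right)

lemma weyl_mult_add_left: "weyl_mult (P + P') Q = weyl_mult P Q + weyl_mult P' Q"
proof (induction P P' arbitrary: Q rule: poly_induct2)
  case 0
  then show ?case by simp
next
  case (pCons a p b q)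
  then show ?case
    by (simp add: weyl_mult_pCons_left smult_add_left)
qed

lemma weyl_mult_smult_left: "weyl_mult (smult p P) Q = smult p (weyl_mult P Q)"
  by (induction P arbitrary: Q) (simp_all add: weyl_mult_pCons_left smult_add_right)

lemma weyl_mult_0_right [simp]: "weyl_mult P 0 = 0"
  by (induction P) (simp_all add: weyl_mult_pCons_left)

lemma weyl_mult_deriv_left: "weyl_mult (weyl_deriv P) Q = weyl_deriv (weyl_mult P Q)"
proof (induction P arbitrary: Q)
  case 0
  then show ?case by simp
next
  case (pCons p P)
  then show ?case
    by (simp add: weyl_deriv_pCons weyl_mult_pCons_left weyl_mult_add_left weyl_deriv_add
        weyl_deriv_smult)
qed

lemma weyl_mult_assoc: "weyl_mult (weyl_mult P Q) R = weyl_mult P (weyl_mult Q R)"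
  by (induction P arbitrary: Q)
     (simp_all add: weyl_mult_pCons_left weyl_mult_add_left weyl_mult_smult_left
       weyl_mult_deriv_left)

lemma weyl_mult_1_left: "weyl_mult 1 Q = Q"
  using weyl_mult_pCons_left [of 1 0 Q] by (simp add: pCons_one)

lemma weyl_mult_1_right: "weyl_mult P 1 = P"
proof -
  have "weyl_mult P (monom 1 n) = P * monom 1 n" for n
  proof (induction P arbitrary: n)
    case 0
    then show ?case by simp
  next
    case (pCons p P)
    have "weyl_deriv (monom 1 n) = monom (1 :: 'a poly) (Suc n)"
      by (rule poly_eqI) (auto simp: coeff_weyl_deriv)
    then show ?case
      using pCons.IH [of "Suc n"]
      by (simp add: weyl_mult_pCons_left monom_Suc)
  qed
  from this [of 0] show ?thesis by (simp add: monom_eq_1)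
qed

lemma degree_weyl_deriv:
  assumes "P \<noteq> 0"
  shows "degree (weyl_deriv P) = Suc (degree P)"
    and "lead_coeff (weyl_deriv P) = lead_coeff P"
proof -
  have *: "coeff (weyl_deriv P) (Suc (degree P)) = lead_coeff P"
    by (simp add: coeff_weyl_deriv coeff_eq_0)
  have "degree (weyl_deriv P) \<le> Suc (degree P)"
    by (rule degree_le) (auto simp: coeff_weyl_deriv coeff_eq_0)
  moreover have "Suc (degree P) \<le> degree (weyl_deriv P)"
    by (rule le_degree) (use assms * in simp)
  ultimately show "degree (weyl_deriv P) = Suc (degree P)" by simp
  then show "lead_coeff (weyl_deriv P) = lead_coeff P" using * by simp
qed

lemma degree_weyl_mult_le: "degree (weyl_mult P Q) \<le> degree P + degree Q"
proof (induction P arbitrary: Q)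
  case 0
  then show ?case by simp
next
  case (pCons p P)
  have "degree (weyl_mult P (weyl_deriv Q)) \<le> degree (pCons p P) + degree Q"
  proof (cases "P = 0 \<or> Q = 0")
    case False
    then show ?thesis
      using pCons.IH [of "weyl_deriv Q"] degree_weyl_deriv [of Q] by simp
  qed auto
  then show ?case
    unfolding weyl_mult_pCons_left
    by (intro degree_add_le order.trans [OF degree_smult_le]) auto
qed

lemma coeff_weyl_mult_top:
  "coeff (weyl_mult P Q) (degree P + degree Q) = lead_coeff P * lead_coeff Q"
proof (induction P arbitrary: Q)
  case 0
  then show ?case by simp
next
  case (pCons p P)
  show ?case
  proof (cases "P = 0 \<or> Q = 0")
    case True
    then show ?thesis by (auto simp: weyl_mult_pCons_left)
  next
    case False
    then show ?thesis
      using pCons.IH [of "weyl_deriv Q"] degree_weyl_deriv [of Q]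
      by (simp add: weyl_mult_pCons_left coeff_eq_0)
  qed
qed

lemma weyl_mult_eq_0: "weyl_mult P Q = 0 \<Longrightarrow> P = 0 \<or> Q = 0"
  using coeff_weyl_mult_top [of P Q] by auto

definition coeff_degree_le :: "nat \<Rightarrow> 'a::idom poly poly \<Rightarrow> bool" where
  "coeff_degree_le n P \<longleftrightarrow> (\<forall>i. degree (coeff P i) \<le> n)"

lemma degree_pderiv_le: "degree (pderiv p) \<le> degree p"
  by (rule degree_le) (auto simp: coeff_pderiv coeff_eq_0)

lemma coeff_degree_le_deriv: "coeff_degree_le n P \<Longrightarrow> coeff_degree_le n (weyl_deriv P)"
  unfolding coeff_degree_le_def
  by (auto simp: coeff_weyl_deriv intro!: degree_add_le order.trans [OF degree_pderiv_le])

lemma coeff_degree_le_mult: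
  "coeff_degree_le m P \<Longrightarrow> coeff_degree_le n Q \<Longrightarrow> coeff_degree_le (m + n) (weyl_mult P Q)"
proof (induction P arbitrary: Q)
  case 0
  then show ?case by (simp add: coeff_degree_le_def)
next
  case (pCons p P)
  from pCons.prems(1) have "degree p \<le> m" and "coeff_degree_le m P"
    unfolding coeff_degree_le_def by (metis coeff_pCons_0, metis coeff_pCons_Suc)
  then show ?case
    using pCons.IH [OF _ coeff_degree_le_deriv [OF pCons.prems(2)]] pCons.prems(2)
    unfolding coeff_degree_le_def
    by (auto simp: weyl_mult_pCons_left intro!: degree_add_le order.trans [OF degree_mult_le]
        add_mono)
qed

typedef (overloaded) 'a weyl = "UNIV :: 'a::idom poly poly set"
  morphisms weyl_poly Weyl ..

declare weyl_poly_inverse [simp]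

lemma weyl_poly_Weyl [simp]: "weyl_poly (Weyl P) = P"
  by (simp add: Weyl_inverse)

lemma Weyl_eq_iff [simp]: "Weyl P = Weyl Q \<longleftrightarrow> P = Q"
  by (simp add: Weyl_inject)

instantiation weyl :: (idom) "{ring_1_no_zero_divisors}"
begin

definition "0 = Weyl 0"
definition "1 = Weyl 1"
definition "u + v = Weyl (weyl_poly u + weyl_poly v)"
definition "u - v = Weyl (weyl_poly u - weyl_poly v)"
definition "- u = Weyl (- weyl_poly u)"
definition "u * v = Weyl (weyl_mult (weyl_poly u) (weyl_poly v))"

instance
proof
  fix a b c :: "'a weyl"
  show "a * b * c = a * (b * c)" by (simp add: times_weyl_def weyl_mult_assoc)
  show "1 * a = a" by (simp add: times_weyl_def one_weyl_def weyl_mult_1_left)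
  show "a * 1 = a" by (simp add: times_weyl_def one_weyl_def weyl_mult_1_right)
  show "(a + b) * c = a * c + b * c"
    by (simp add: times_weyl_def plus_weyl_def weyl_mult_add_left)
  show "a * (b + c) = a * b + a * c"
    by (simp add: times_weyl_def plus_weyl_def weyl_mult_add_right)
  show "a \<noteq> 0 \<Longrightarrow> b \<noteq> 0 \<Longrightarrow> a * b \<noteq> 0"
    using weyl_mult_eq_0 by (cases a; cases b) (auto simp: times_weyl_def zero_weyl_def)
qed (simp_all add: zero_weyl_def one_weyl_def plus_weyl_def minus_weyl_def uminus_weyl_def
       times_weyl_def algebra_simps)

end

lemma weyl_poly_simps [simp]:
  "weyl_poly 0 = 0" "weyl_poly 1 = 1"
  "weyl_poly (u + v) = weyl_poly u + weyl_poly v"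
  "weyl_poly (u - v) = weyl_poly u - weyl_poly v"
  "weyl_poly (- u) = - weyl_poly u"
  "weyl_poly (u * v) = weyl_mult (weyl_poly u) (weyl_poly v)"
  by (simp_all add: zero_weyl_def one_weyl_def plus_weyl_def minus_weyl_def uminus_weyl_def
      times_weyl_def)

lemma weyl_poly_eq_0_iff [simp]: "weyl_poly u = 0 \<longleftrightarrow> u = 0"
  by (metis weyl_poly_inject weyl_poly_simps(1))

definition weyl_p :: "'a::idom poly \<Rightarrow> 'a weyl" where
  "weyl_p p = Weyl [:p:]"

definition weyl_d :: "'a::idom weyl" where
  "weyl_d = Weyl [:0, 1:]"

abbreviation weyl_c :: "'a::idom \<Rightarrow> 'a weyl" where
  "weyl_c c \<equiv> weyl_p [:c:]"

abbreviation weyl_t :: "'a::idom weyl" where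
  "weyl_t \<equiv> weyl_p [:0, 1:]"

lemma weyl_p_add: "weyl_p (p + q) = weyl_p p + weyl_p q"
  by (simp add: weyl_p_def plus_weyl_def)

lemma weyl_p_0 [simp]: "weyl_p 0 = 0"
  by (simp add: weyl_p_def zero_weyl_def)

lemma weyl_p_1 [simp]: "weyl_p 1 = 1"
  by (simp add: weyl_p_def one_weyl_def one_pCons)

lemma weyl_p_mult: "weyl_p (p * q) = weyl_p p * weyl_p q"
  by (simp add: weyl_p_def times_weyl_def weyl_mult_pCons_left)

lemma weyl_p_uminus: "weyl_p (- p) = - weyl_p p"
  by (simp add: weyl_p_def uminus_weyl_def)

lemma weyl_p_eq_iff [simp]: "weyl_p p = weyl_p q \<longleftrightarrow> p = q"
  by (simp add: weyl_p_def)

lemma weyl_p_eq_0_iff [simp]: "weyl_p p = 0 \<longleftrightarrow> p = 0"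
  by (metis weyl_p_0 weyl_p_eq_iff)

lemma weyl_p_power: "weyl_p (p ^ n) = weyl_p p ^ n"
  by (induction n) (simp_all add: weyl_p_mult)

lemma weyl_p_commute: "weyl_p p * weyl_p q = weyl_p q * weyl_p p"
  by (simp flip: weyl_p_mult add: mult.commute)

lemma weyl_d_p: "weyl_d * weyl_p p = weyl_p p * weyl_d + weyl_p (pderiv p)"
  by (simp add: weyl_p_def weyl_d_def times_weyl_def weyl_mult_pCons_left weyl_deriv_pCons
      plus_weyl_def)

lemma weyl_p_poly_mult: "weyl_p p * u = Weyl (smult p (weyl_poly u))"
  by (simp add: weyl_p_def times_weyl_def weyl_mult_pCons_left)

lemma Weyl_pCons: "Weyl (pCons p P) = weyl_p p + Weyl P * weyl_d"
proof -
  have "weyl_mult P [:0, 1:] = pCons 0 P"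
  proof -
    have "weyl_deriv 1 = ([:0, 1:] :: 'a poly poly)"
      by (rule poly_eqI) (auto simp: coeff_weyl_deriv coeff_pCons split: nat.split)
    moreover have "weyl_mult P (weyl_deriv 1) = weyl_mult (pCons 0 P) 1"
      by (simp add: weyl_mult_pCons_left)
    ultimately show ?thesis by (simp add: weyl_mult_1_right)
  qed
  then show ?thesis by (simp add: weyl_p_def weyl_d_def plus_weyl_def times_weyl_def)
qed

lemma weyl_c_central: "weyl_c c * u = u * weyl_c c"
proof -
  have "weyl_c c * Weyl P = Weyl P * weyl_c c" for P
  proof (induction P)
    case 0
    then show ?case by (simp flip: zero_weyl_def)
  next
    case (pCons p P)
    have "weyl_c c * weyl_d = weyl_d * weyl_c c"
      by (simp add: weyl_d_p pderiv_pCons)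
    then show ?case
      using pCons.IH
      by (simp add: Weyl_pCons distrib_left distrib_right weyl_p_commute)
         (metis mult.assoc)
  qed
  then show ?thesis by (metis weyl_poly_inverse)
qed

lemma weyl_induct_left [consumes 1, case_names add const t d]:
  assumes 1: "P u" and add: "\<And>u v. P u \<Longrightarrow> P v \<Longrightarrow> P (u + v)"
    and c: "\<And>c u. P u \<Longrightarrow> P (weyl_c c * u)"
    and t: "\<And>u. P u \<Longrightarrow> P (weyl_t * u)" and d: "\<And>u. P u \<Longrightarrow> P (weyl_d * u)"
  shows "P (v * u)"
proof -
  have 0: "P 0" using c [OF 1, of 0] by simp
  have p: "P (weyl_p p * u)" if "P u" for p u
  proof (induction p)
    case 0
    then show ?case by (simp add: \<open>P 0\<close>)
  next
    case (pCons a p)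
    have "weyl_p (pCons a p) * u = weyl_c a * u + weyl_t * (weyl_p p * u)"
      by (simp flip: weyl_p_mult weyl_p_add distrib_right mult.assoc)
    then show ?case using add [OF c [OF that] t [OF pCons.IH]] by simp
  qed
  have "P (Weyl Q * u)" for Q
    using 1
  proof (induction Q arbitrary: u)
    case 0
    then show ?case using \<open>P 0\<close> by (simp flip: zero_weyl_def)
  next
    case (pCons q Q)
    have "Weyl (pCons q Q) * u = weyl_p q * u + Weyl Q * (weyl_d * u)"
      by (simp add: Weyl_pCons distrib_right mult.assoc)
    then show ?case using add [OF p pCons.IH] d pCons.prems by simp
  qed
  from this [of "weyl_poly v"] show ?thesis by simp
qed

lemma weyl_induct_right [consumes 1, case_names add const t d]:
  assumes 1: "P u" and add: "\<And>u v. P u \<Longrightarrow> P v \<Longrightarrow> P (u + v)"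
    and c: "\<And>c u. P u \<Longrightarrow> P (u * weyl_c c)"
    and t: "\<And>u. P u \<Longrightarrow> P (u * weyl_t)" and d: "\<And>u. P u \<Longrightarrow> P (u * weyl_d)"
  shows "P (u * v)"
proof -
  have 0: "P 0" using c [OF 1, of 0] by simp
  have p: "P (u * weyl_p p)" for p
  proof (induction p)
    case 0
    then show ?case by (simp add: \<open>P 0\<close>)
  next
    case (pCons a p)
    have "u * weyl_p (pCons a p) = u * weyl_c a + u * weyl_p p * weyl_t"
      by (simp flip: weyl_p_mult weyl_p_add distrib_left add: mult.assoc)
    then show ?case using add [OF c [OF 1] t [OF pCons.IH]] by simp
  qed
  have "P (u * Weyl Q)" for Q
  proof (induction Q)
    case 0
    then show ?case using \<open>P 0\<close> by (simp flip: zero_weyl_def)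
  next
    case (pCons q Q)
    have "u * Weyl (pCons q Q) = u * weyl_p q + (u * Weyl Q) * weyl_d"
      by (simp add: Weyl_pCons distrib_left mult.assoc)
    then show ?case using add [OF p d [OF pCons.IH]] by simp
  qed
  from this [of "weyl_poly v"] show ?thesis by simp
qed

section \<open>The Ore condition\<close>

lemma underdetermined_system:
  fixes c :: "'j \<Rightarrow> 'i \<Rightarrow> 'a::field"
  assumes "finite J" "finite I" "card J < card I"
  shows "\<exists>x. (\<exists>i\<in>I. x i \<noteq> 0) \<and> (\<forall>j\<in>J. (\<Sum>i\<in>I. c j i * x i) = 0)"
  using assms
proof (induction J arbitrary: I c rule: finite_induct)
  case empty
  then obtain i where "i \<in> I" by fastforce
  then show ?case by (auto intro!: exI [of _ "\<lambda>_. 1"])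
next
  case (insert j J)
  show ?case
  proof (cases "\<exists>p\<in>I. c j p \<noteq> 0")
    case False
    from insert.prems insert.hyps have "card J < card I" by simp
    from insert.IH [OF insert.prems(1) this, of c]
    obtain x where "\<exists>i\<in>I. x i \<noteq> 0" "\<forall>j\<in>J. (\<Sum>i\<in>I. c j i * x i) = 0" by blast
    with False show ?thesis by (intro exI [of _ x]) auto
  next
    case True
    then obtain p where p: "p \<in> I" "c j p \<noteq> 0" by blast
    define I' where "I' = I - {p}"
    have fin: "finite I'" using insert.prems by (simp add: I'_def)
    have sum_I: "(\<Sum>i\<in>I. f i) = f p + (\<Sum>i\<in>I'. f i)" for f :: "'i \<Rightarrow> 'a"
      using p insert.prems by (simp add: I'_def sum.remove)
    have "card J < card I'"
      using insert p by (simp add: I'_def card_Diff_singleton)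
    from insert.IH [OF fin this, of "\<lambda>k i. c k i - c k p * c j i / c j p"]
    obtain x where x: "\<exists>i\<in>I'. x i \<noteq> 0"
      and sol: "\<And>k. k \<in> J \<Longrightarrow> (\<Sum>i\<in>I'. (c k i - c k p * c j i / c j p) * x i) = 0" by blast
    define y where "y = x(p := - (\<Sum>i\<in>I'. c j i * x i) / c j p)"
    have y: "(\<Sum>i\<in>I. c k i * y i) = (\<Sum>i\<in>I'. c k i * x i) - c k p * (\<Sum>i\<in>I'. c j i * x i) / c j p"
      for k
    proof -
      have "(\<Sum>i\<in>I'. c k i * y i) = (\<Sum>i\<in>I'. c k i * x i)"
        by (rule sum.cong) (auto simp: y_def I'_def)
      then show ?thesis by (simp add: sum_I y_def)
    qed
    have "(\<Sum>i\<in>I. c k i * y i) = 0" if "k \<in> insert j J" for k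
    proof (cases "k = j")
      case True
      then show ?thesis using p by (simp add: y)
    next
      case False
      have "(\<Sum>i\<in>I'. (c k i - c k p * c j i / c j p) * x i)
          = (\<Sum>i\<in>I'. c k i * x i - c k p / c j p * (c j i * x i))"
        by (rule sum.cong) (simp_all add: algebra_simps)
      then show ?thesis
        using sol [of k] that False by (simp add: y sum_subtractf sum_distrib_left sum_divide_distrib)
    qed
    moreover have "\<exists>i\<in>I. y i \<noteq> 0" using x by (auto simp: y_def I'_def)
    ultimately show ?thesis by blast
  qed
qed

lemma weyl_kernel_exists:
  fixes \<phi> \<psi> :: "'a::field poly poly \<Rightarrow> 'a poly poly"
  assumes add: "\<And>P Q. \<phi> (P + Q) = \<phi> P + \<phi> Q" "\<And>P Q. \<psi> (P + Q) = \<psi> P + \<psi> Q"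
    and smult: "\<And>c P. \<phi> (smult [:c:] P) = smult [:c:] (\<phi> P)"
      "\<And>c P. \<psi> (smult [:c:] P) = smult [:c:] (\<psi> P)"
    and deg: "\<And>n P. degree P \<le> n \<Longrightarrow> degree (\<phi> P) \<le> n + d"
      "\<And>n P. degree P \<le> n \<Longrightarrow> degree (\<psi> P) \<le> n + d"
    and cdeg: "\<And>n P. coeff_degree_le n P \<Longrightarrow> coeff_degree_le (n + d) (\<phi> P)"
      "\<And>n P. coeff_degree_le n P \<Longrightarrow> coeff_degree_le (n + d) (\<psi> P)"
  shows "\<exists>U V. (U \<noteq> 0 \<or> V \<noteq> 0) \<and> \<phi> U + \<psi> V = 0"
proof -
  define n where "n = 3 * d"
  define B where "B = {..n} \<times> {..n}"
  define J where "J = {..n + d} \<times> {..n + d}"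
  define m where "m = (\<lambda>(i, j). monom (monom (1::'a) i) j)"
  define e where "e = (\<lambda>(b, \<iota>). if b then \<phi> (m \<iota>) else \<psi> (m \<iota>))"
  define I where "I = (UNIV :: bool set) \<times> B"
  have fin: "finite B" "finite J" "finite I" by (auto simp: B_def J_def I_def)
  have "card J < card I"
    by (simp add: J_def I_def B_def n_def card_cartesian_product power2_eq_square algebra_simps)
  from underdetermined_system [OF fin(2,3) this, of "\<lambda>(k, l) \<iota>. coeff (coeff (e \<iota>) k) l"]
  obtain x where x: "\<exists>\<iota>\<in>I. x \<iota> \<noteq> 0"
    and sol: "\<And>k l. (k, l) \<in> J \<Longrightarrow> (\<Sum>\<iota>\<in>I. coeff (coeff (e \<iota>) k) l * x \<iota>) = 0"
    by (force simp only: case_prod_conv)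
  define U where "U b = (\<Sum>\<iota>\<in>B. smult [:x (b, \<iota>):] (m \<iota>))" for b
  have 0: "\<phi> 0 = 0" "\<psi> 0 = 0" using smult [of 0 0] by simp_all
  have sum: "\<phi> (sum f A) = (\<Sum>a\<in>A. \<phi> (f a))" "\<psi> (sum f A) = (\<Sum>a\<in>A. \<psi> (f a))"
    for f and A :: "(nat \<times> nat) set"
    by (induction A rule: infinite_finite_induct) (simp_all add: 0 add)
  have coeff_U: "coeff (coeff (U b) j) i = x (b, (i, j))" if "(i, j) \<in> B" for b i j
  proof -
    have "coeff (coeff (U b) j) i = (\<Sum>\<iota>\<in>B. if \<iota> = (i, j) then x (b, \<iota>) else 0)"
      unfolding U_def coeff_sum by (rule sum.cong) (auto simp: m_def split: prod.splits)
    then show ?thesis using that fin by simp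
  qed
  have "\<phi> (U True) + \<psi> (U False) = 0"
  proof (intro poly_eqI)
    fix k l
    have I: "(\<Sum>\<iota>\<in>I. f \<iota>) = (\<Sum>\<iota>\<in>B. f (True, \<iota>)) + (\<Sum>\<iota>\<in>B. f (False, \<iota>))" for f :: "_ \<Rightarrow> 'a"
      unfolding I_def by (simp add: sum.cartesian_product' UNIV_bool)
    have eq: "coeff (coeff (\<phi> (U True) + \<psi> (U False)) k) l = (\<Sum>\<iota>\<in>I. coeff (coeff (e \<iota>) k) l * x \<iota>)"
      by (simp add: I U_def sum smult coeff_sum e_def mult.commute)
    have B: "degree (U b) \<le> n \<and> coeff_degree_le n (U b)" for b
      unfolding U_def coeff_degree_le_def coeff_sum
      by (auto intro!: degree_sum_le order.trans [OF degree_smult_le] order.trans [OF degree_monom_le]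
          simp: fin m_def B_def) 
    show "coeff (coeff (\<phi> (U True) + \<psi> (U False)) k) l = coeff (coeff 0 k) l"
    proof (cases "(k, l) \<in> J")
      case True
      then show ?thesis using eq sol by simp
    next
      case False
      then have "k > n + d \<or> l > n + d" by (auto simp: J_def)
      then show ?thesis
      proof
        assume "k > n + d"
        then show ?thesis
          using deg(1) [of "U True" n] deg(2) [of "U False" n] B by (simp add: coeff_eq_0)
      next
        assume "l > n + d"
        moreover have "degree (coeff (\<phi> (U True)) k) \<le> n + d" "degree (coeff (\<psi> (U False)) k) \<le> n + d"
          using cdeg(1) [of n "U True"] cdeg(2) [of n "U False"] B by (auto simp: coeff_degree_le_def)
        ultimately show ?thesis by (simp add: coeff_eq_0)
      qed
    qed
  qed
  moreover have "U True \<noteq> 0 \<or> U False \<noteq> 0"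
  proof -
    from x obtain b i j where "(i, j) \<in> B" "x (b, (i, j)) \<noteq> 0" by (auto simp: I_def)
    then have "U b \<noteq> 0" using coeff_U by (metis coeff_0)
    then show ?thesis by (cases b) auto
  qed
  ultimately show ?thesis by blast
qed

lemma weyl_ore_aux:
  fixes a b :: "'a::field weyl"
  shows "\<exists>u v. (u \<noteq> 0 \<or> v \<noteq> 0) \<and> a * u + b * v = 0"
    and "\<exists>u v. (u \<noteq> 0 \<or> v \<noteq> 0) \<and> u * a + v * b = 0"
proof -
  define A B where "A = weyl_poly a" and "B = weyl_poly b"
  have coeff_bound: "\<exists>n. coeff_degree_le n P" for P :: "'a poly poly"
  proof -
    have "degree (coeff P i) \<le> Max ((\<lambda>i. degree (coeff P i)) ` {..degree P})" for i
      by (cases "i \<le> degree P") (auto intro!: Max_ge simp: coeff_eq_0)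
    then show ?thesis by (auto simp: coeff_degree_le_def)
  qed
  obtain m n where mn: "coeff_degree_le m A" "coeff_degree_le n B"
    using coeff_bound by metis
  define d where "d = degree A + degree B + m + n"
  have d: "coeff_degree_le d A" "coeff_degree_le d B" "degree A \<le> d" "degree B \<le> d"
    using mn by (auto simp: d_def coeff_degree_le_def intro: order.trans)
  have const: "weyl_mult P (smult [:c:] Q) = smult [:c:] (weyl_mult P Q)" for P Q :: "'a poly poly" and c
  proof -
    have "Weyl P * (weyl_c c * Weyl Q) = weyl_c c * (Weyl P * Weyl Q)"
      by (metis mult.assoc weyl_c_central)
    then show ?thesis unfolding weyl_p_poly_mult by (simp add: times_weyl_def)
  qed
  have "\<exists>U V. (U \<noteq> 0 \<or> V \<noteq> 0) \<and> weyl_mult A U + weyl_mult B V = 0"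
  proof (rule weyl_kernel_exists [where d = d])
    fix P :: "'a poly poly" and k assume P: "degree P \<le> k"
    show "degree (weyl_mult A P) \<le> k + d" "degree (weyl_mult B P) \<le> k + d"
      using P d degree_weyl_mult_le [of A P] degree_weyl_mult_le [of B P] by linarith+
  qed (use d in \<open>simp_all add: weyl_mult_add_right const coeff_degree_le_mult add.commute [of _ d]\<close>)
  then obtain U V where "U \<noteq> 0 \<or> V \<noteq> 0" "weyl_mult A U + weyl_mult B V = 0" by blast
  then show "\<exists>u v. (u \<noteq> 0 \<or> v \<noteq> 0) \<and> a * u + b * v = 0"
    by (intro exI [of _ "Weyl U"] exI [of _ "Weyl V"])
       (auto simp: A_def B_def times_weyl_def plus_weyl_def zero_weyl_def)
  have "\<exists>U V. (U \<noteq> 0 \<or> V \<noteq> 0) \<and> weyl_mult U A + weyl_mult V B = 0"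
  proof (rule weyl_kernel_exists [where d = d])
    fix P :: "'a poly poly" and k assume P: "degree P \<le> k"
    show "degree (weyl_mult P A) \<le> k + d" "degree (weyl_mult P B) \<le> k + d"
      using P d degree_weyl_mult_le [of P A] degree_weyl_mult_le [of P B] by linarith+
  qed (use d in \<open>simp_all add: weyl_mult_add_left weyl_mult_smult_left coeff_degree_le_mult\<close>)
  then obtain U V where "U \<noteq> 0 \<or> V \<noteq> 0" "weyl_mult U A + weyl_mult V B = 0" by blast
  then show "\<exists>u v. (u \<noteq> 0 \<or> v \<noteq> 0) \<and> u * a + v * b = 0"
    by (intro exI [of _ "Weyl U"] exI [of _ "Weyl V"])
       (auto simp: A_def B_def times_weyl_def plus_weyl_def zero_weyl_def)
qed

class ore_domain = ring_1_no_zero_divisors +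
  assumes right_ore: "b \<noteq> 0 \<Longrightarrow> \<exists>u v. v \<noteq> 0 \<and> a * v = b * u"
    and left_ore: "b \<noteq> 0 \<Longrightarrow> \<exists>u v. v \<noteq> 0 \<and> v * a = u * b"

instance weyl :: (field) ore_domain
proof
  fix a b :: "'a weyl" assume b: "b \<noteq> 0"
  from weyl_ore_aux(1) [of a b] obtain u v where "u \<noteq> 0 \<or> v \<noteq> 0" "a * u + b * v = 0" by blast
  then show "\<exists>u v. v \<noteq> 0 \<and> a * v = b * u"
    using b by (intro exI [of _ "- v"] exI [of _ u]) (auto simp: eq_neg_iff_add_eq_0)
  from weyl_ore_aux(2) [of a b] obtain u v where "u \<noteq> 0 \<or> v \<noteq> 0" "u * a + v * b = 0" by blast
  then show "\<exists>u v. v \<noteq> 0 \<and> v * a = u * b"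
    using b by (intro exI [of _ "- v"] exI [of _ u]) (auto simp: eq_neg_iff_add_eq_0)
qed

section \<open>The skew field of fractions of an Ore domain\<close>

text \<open>A fraction \<open>q\<close> is represented by the graph \<open>{(a, b). q a = b}\<close> of its partial action on the
  domain by left multiplication.\<close>

definition fraction_graph :: "('a::ore_domain \<times> 'a) set \<Rightarrow> bool" where
  "fraction_graph G \<longleftrightarrow>
     (\<exists>s b. s \<noteq> 0 \<and> (s, b) \<in> G) \<and>
     (\<forall>a b c. (a, b) \<in> G \<longrightarrow> (a * c, b * c) \<in> G) \<and>
     (\<forall>a b c. c \<noteq> 0 \<longrightarrow> (a * c, b * c) \<in> G \<longrightarrow> (a, b) \<in> G) \<and>
     (\<forall>a b b'. (a, b) \<in> G \<longrightarrow> (a, b') \<in> G \<longrightarrow> b = b')"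

lemma fraction_graph_exists:
  fixes s b :: "'a::ore_domain"
  assumes s: "s \<noteq> 0"
  shows "\<exists>G. fraction_graph G \<and> (s, b) \<in> G"
proof (intro exI conjI)
  let ?G = "{(x, y). \<exists>t c. t \<noteq> 0 \<and> x * t = s * c \<and> y * t = b * c}"
  show sb: "(s, b) \<in> ?G" by (auto intro!: exI [of _ 1])
  show "fraction_graph ?G"
    unfolding fraction_graph_def
  proof (intro conjI allI impI)
    show "\<exists>s b. s \<noteq> 0 \<and> (s, b) \<in> ?G" using s sb by blast
  next
    fix x y c assume "(x, y) \<in> ?G"
    then obtain t d where t: "t \<noteq> 0" "x * t = s * d" "y * t = b * d" by blast
    obtain u v where "v \<noteq> 0" "c * v = t * u" using right_ore [OF t(1)] by blast
    then have "x * c * v = s * (d * u)" "y * c * v = b * (d * u)"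
      using t by (metis mult.assoc)+
    then show "(x * c, y * c) \<in> ?G" using \<open>v \<noteq> 0\<close> by blast
  next
    fix x y c :: 'a assume c: "c \<noteq> 0" and "(x * c, y * c) \<in> ?G"
    then obtain t d where t: "t \<noteq> 0" "x * c * t = s * d" "y * c * t = b * d" by blast
    then have "c * t \<noteq> 0" "x * (c * t) = s * d" "y * (c * t) = b * d"
      using c by (simp_all add: mult.assoc)
    then show "(x, y) \<in> ?G" by blast
  next
    fix x y y' assume "(x, y) \<in> ?G" "(x, y') \<in> ?G"
    then obtain t d t' d' where t: "t \<noteq> 0" "x * t = s * d" "y * t = b * d"
      and t': "t' \<noteq> 0" "x * t' = s * d'" "y' * t' = b * d'" by blast
    obtain u v where v: "v \<noteq> 0" "t * v = t' * u" using right_ore [OF t'(1)] by blast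
    have "s * (d * v) = s * (d' * u)" using t(2) t'(2) v(2) by (metis mult.assoc)
    then have "d * v = d' * u" using s by simp
    then have "y * (t * v) = y' * (t * v)" using t(3) t'(3) v(2) by (metis mult.assoc)
    then show "y = y'" using t(1) v(1) by simp
  qed
qed

typedef (overloaded) 'a fraction = "{G :: ('a::ore_domain \<times> 'a) set. fraction_graph G}"
  morphisms graph Fraction
  using fraction_graph_exists [of 1 0] by auto

definition maps :: "'a::ore_domain fraction \<Rightarrow> 'a \<Rightarrow> 'a \<Rightarrow> bool" where
  "maps q a b \<longleftrightarrow> (a, b) \<in> graph q"

lemma fraction_graph_graph: "fraction_graph (graph q)"
  using graph [of q] by simp

lemma maps_denominator: "\<exists>s b. s \<noteq> 0 \<and> maps q s b"
  and maps_mult: "maps q a b \<Longrightarrow> maps q (a * c) (b * c)"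
  and maps_cancel: "maps q (a * c) (b * c) \<Longrightarrow> c \<noteq> 0 \<Longrightarrow> maps q a b"
  and maps_unique: "maps q a b \<Longrightarrow> maps q a b' \<Longrightarrow> b = b'"
  using fraction_graph_graph [of q] unfolding fraction_graph_def maps_def by blast+

lemma maps_exists: "s \<noteq> 0 \<Longrightarrow> \<exists>q. maps q s b"
  unfolding maps_def using fraction_graph_exists [of s b] by (metis Fraction_inverse mem_Collect_eq)

lemma maps_domain: "\<exists>t b. t \<noteq> 0 \<and> maps q (a * t) b"
proof -
  obtain s b where s: "s \<noteq> 0" "maps q s b" using maps_denominator by blast
  obtain c t where t: "t \<noteq> 0" "a * t = s * c" using right_ore [OF s(1)] by blast
  then show ?thesis using maps_mult [OF s(2), of c] by metis
qed

lemma maps_proportional: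
  assumes s: "s \<noteq> 0" and a: "\<And>c t. t \<noteq> 0 \<Longrightarrow> a * t = s * c \<Longrightarrow> maps q (a * t) (b * t)"
  shows "maps q a b"
proof -
  obtain c t where "t \<noteq> 0" "a * t = s * c" using right_ore [OF s] by blast
  then show ?thesis using a maps_cancel by blast
qed

lemma fraction_eqI:
  assumes "s \<noteq> 0" "maps q s b" "maps r s b"
  shows "q = r"
proof -
  have *: "maps r a y" if "maps q a y" "maps q s b" "maps r s b" for q r a y
  proof (rule maps_proportional [OF assms(1)])
    fix c t assume "a * t = s * c"
    then have "y * t = b * c"
      using maps_unique [OF maps_mult [OF that(1)]] maps_mult [OF that(2), of c] by simp
    then show "maps r (a * t) (y * t)"
      using \<open>a * t = s * c\<close> maps_mult [OF that(3), of c] by simp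
  qed
  then have "maps q x y \<longleftrightarrow> maps r x y" for x y using assms by blast
  then have "graph q = graph r" unfolding maps_def by auto
  then show ?thesis by (simp add: graph_inject)
qed

lemma maps_add:
  assumes "maps q a b" "maps q a' b'"
  shows "maps q (a + a') (b + b')"
proof -
  obtain s y where s: "s \<noteq> 0" "maps q s y" using maps_denominator by blast
  obtain c t where t: "t \<noteq> 0" "a * t = s * c" using right_ore [OF s(1)] by blast
  obtain c' t' where t': "t' \<noteq> 0" "a' * t * t' = s * c'" using right_ore [OF s(1)] by blast
  have b: "b * (t * t') = y * (c * t')"
    using maps_mult [OF assms(1), of "t * t'"] maps_mult [OF s(2), of "c * t'"] t(2) maps_unique
    by (metis mult.assoc)
  have b': "b' * (t * t') = y * c'"
    using maps_mult [OF assms(2), of "t * t'"] maps_mult [OF s(2), of c'] t'(2) maps_unique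
    by (metis mult.assoc)
  have "s * (c * t' + c') = (a + a') * (t * t')" using t(2) t'(2)
    by (simp add: distrib_left distrib_right flip: mult.assoc)
  moreover have "y * (c * t' + c') = (b + b') * (t * t')" using b b'
    by (simp add: distrib_left distrib_right)
  ultimately show ?thesis
    using maps_mult [OF s(2), of "c * t' + c'"] maps_cancel [of q _ "t * t'"] t(1) t'(1) by simp
qed

instantiation fraction :: (ore_domain) division_ring
begin

definition "0 = (SOME q. maps q 1 0)"
definition "1 = (SOME q. maps q 1 1)"
definition "p + q = (SOME r. \<forall>a b c. maps p a b \<longrightarrow> maps q a c \<longrightarrow> maps r a (b + c))"
definition "- q = (SOME r. \<forall>a b. maps q a b \<longrightarrow> maps r a (- b))"
definition "p - q = p + - (q :: 'a fraction)"
definition "p * q = (SOME r. \<forall>a b c. maps q a b \<longrightarrow> maps p b c \<longrightarrow> maps r a c)"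
definition "inverse q = (if q = 0 then 0 else SOME r. \<forall>a b. maps q a b \<longrightarrow> maps r b a)"
definition "p div q = p * inverse (q :: 'a fraction)"

lemma maps_0: "maps 0 a 0"
  using someI_ex [OF maps_exists [of 1 0]] maps_mult [of 0 1 0 a] by (simp add: zero_fraction_def)

lemma maps_1: "maps 1 a a"
  using someI_ex [OF maps_exists [of 1 1]] maps_mult [of 1 1 1 a] by (simp add: one_fraction_def)

lemma maps_plus:
  assumes "maps p a b" "maps q a c"
  shows "maps (p + q) a (b + c)"
proof -
  obtain s x where s: "s \<noteq> 0" "maps p s x" using maps_denominator by blast
  obtain t y where t: "t \<noteq> 0" "maps q (s * t) y" using maps_domain by blast
  obtain r where r: "maps r (s * t) (x * t + y)"
    using maps_exists [of "s * t" "x * t + y"] s(1) t(1) by auto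
  have "maps r a (b + c)" if that: "maps p a b" "maps q a c" for a b c
  proof (rule maps_proportional [of "s * t"])
    fix u v assume *: "a * v = s * t * u"
    have "b * v = x * t * u"
      using maps_unique [OF maps_mult [OF that(1), of v]] maps_mult [OF s(2), of "t * u"] *
      by (simp add: mult.assoc)
    moreover have "c * v = y * u"
      using maps_unique [OF maps_mult [OF that(2), of v]] maps_mult [OF t(2), of u] * by simp
    ultimately show "maps r (a * v) ((b + c) * v)"
      using maps_mult [OF r, of u] * by (simp add: distrib_right)
  qed (use s t in simp)
  then have "\<exists>r. \<forall>a b c. maps p a b \<longrightarrow> maps q a c \<longrightarrow> maps r a (b + c)" by blast
  from someI_ex [OF this] show ?thesis using assms unfolding plus_fraction_def by blast
qed

lemma maps_uminus:
  assumes "maps q a b"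
  shows "maps (- q) a (- b)"
proof -
  obtain s x where s: "s \<noteq> 0" "maps q s x" using maps_denominator by blast
  obtain r where r: "maps r s (- x)" using maps_exists [OF s(1)] by blast
  have "maps r a (- b)" if that: "maps q a b" for a b
  proof (rule maps_proportional [OF s(1)])
    fix u v assume *: "a * v = s * u"
    have "b * v = x * u"
      using maps_unique [OF maps_mult [OF that, of v]] maps_mult [OF s(2), of u] * by simp
    then show "maps r (a * v) (- b * v)" using maps_mult [OF r, of u] * by simp
  qed
  then have "\<exists>r. \<forall>a b. maps q a b \<longrightarrow> maps r a (- b)" by blast
  from someI_ex [OF this] show ?thesis using assms unfolding uminus_fraction_def by blast
qed

lemma maps_times:
  assumes "maps q a b" "maps p b c"
  shows "maps (p * q) a c"
proof -
  obtain s x where s: "s \<noteq> 0" "maps q s x" using maps_denominator by blast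
  obtain t y where t: "t \<noteq> 0" "maps p (x * t) y" using maps_domain by blast
  obtain r where r: "maps r (s * t) y"
    using maps_exists [of "s * t" y] s(1) t(1) by auto
  have "maps r a c" if that: "maps q a b" "maps p b c" for a b c
  proof (rule maps_proportional [of "s * t"])
    fix u v assume *: "a * v = s * t * u"
    have "b * v = x * t * u"
      using maps_unique [OF maps_mult [OF that(1), of v]] maps_mult [OF s(2), of "t * u"] *
      by (simp add: mult.assoc)
    then have "c * v = y * u"
      using maps_unique [OF maps_mult [OF that(2), of v]] maps_mult [OF t(2), of u] by simp
    then show "maps r (a * v) (c * v)"
      using maps_mult [OF r, of u] * by simp
  qed (use s t in simp)
  then have "\<exists>r. \<forall>a b c. maps q a b \<longrightarrow> maps p b c \<longrightarrow> maps r a c" by blast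
  from someI_ex [OF this] show ?thesis using assms unfolding times_fraction_def by blast
qed

lemma maps_numerator_nonzero: "q \<noteq> 0 \<Longrightarrow> s \<noteq> 0 \<Longrightarrow> maps q s b \<Longrightarrow> b \<noteq> 0"
  using fraction_eqI maps_0 by blast

lemma maps_inverse:
  assumes "maps q a b" "q \<noteq> 0"
  shows "maps (inverse q) b a"
proof -
  obtain s x where s: "s \<noteq> 0" "maps q s x" using maps_denominator by blast
  then have x: "x \<noteq> 0" using assms(2) maps_numerator_nonzero by blast
  then obtain r where r: "maps r x s" using maps_exists by blast
  have "maps r b a" if that: "maps q a b" for a b
  proof -
    obtain u v where v: "v \<noteq> 0" "a * v = s * u" using right_ore [OF s(1)] by blast
    then have "b * v = x * u"
      using maps_unique [OF maps_mult [OF that, of v]] maps_mult [OF s(2), of u] by simp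
    then show ?thesis using maps_mult [OF r, of u] maps_cancel [OF _ v(1)] v by simp
  qed
  then have "\<exists>r. \<forall>a b. maps q a b \<longrightarrow> maps r b a" by blast
  from someI_ex [OF this] show ?thesis using assms unfolding inverse_fraction_def by simp
qed

instance
proof
  fix p q r :: "'a fraction"
  show "p * q * r = p * (q * r)"
  proof -
    obtain s a where s: "s \<noteq> 0" "maps r s a" using maps_denominator by blast
    obtain t b where t: "t \<noteq> 0" "maps q (a * t) b" using maps_domain by blast
    obtain u c where u: "u \<noteq> 0" "maps p (b * u) c" using maps_domain by blast
    have r: "maps r (s * (t * u)) (a * t * u)" using maps_mult [OF s(2), of "t * u"]
      by (simp add: mult.assoc)
    have q: "maps q (a * t * u) (b * u)" using maps_mult [OF t(2)] .
    show ?thesis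
    proof (rule fraction_eqI)
      show "s * (t * u) \<noteq> 0" using s t u by simp
    qed (use r q u(2) maps_times in blast)+
  qed
  obtain s a where s: "s \<noteq> 0" "maps q s a" using maps_denominator by blast
  show "1 * q = q" by (rule fraction_eqI [OF s(1) maps_times [OF s(2) maps_1] s(2)])
  show "q * 1 = q" by (rule fraction_eqI [OF s(1) maps_times [OF maps_1 s(2)] s(2)])
  show "0 + q = q" using fraction_eqI [OF s(1) maps_plus [OF maps_0 s(2)]] s(2) by simp
  show "- q + q = 0"
    using fraction_eqI [OF s(1) maps_plus [OF maps_uminus [OF s(2)] s(2)]] maps_0 by simp
  show "inverse q * q = 1" if "q \<noteq> 0"
    by (rule fraction_eqI [OF s(1) maps_times [OF s(2) maps_inverse [OF s(2) that]] maps_1])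
  show "q * inverse q = 1" if "q \<noteq> 0"
    by (rule fraction_eqI [OF maps_numerator_nonzero [OF that s]
          maps_times [OF maps_inverse [OF s(2) that] s(2)] maps_1])
  show "p + q = q + p"
  proof -
    obtain s a where s: "s \<noteq> 0" "maps p s a" using maps_denominator by blast
    obtain t b where t: "t \<noteq> 0" "maps q (s * t) b" using maps_domain by blast
    show ?thesis
    proof (rule fraction_eqI)
      show "s * t \<noteq> 0" using s t by simp
      show "maps (p + q) (s * t) (a * t + b)"
        by (intro maps_plus maps_mult s t)
      show "maps (q + p) (s * t) (a * t + b)"
        unfolding add.commute [of "a * t"] by (intro maps_plus maps_mult s t)
    qed
  qed
  show "p + q + r = p + (q + r)"
  proof -
    obtain s a where s: "s \<noteq> 0" "maps p s a" using maps_denominator by blast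
    obtain t b where t: "t \<noteq> 0" "maps q (s * t) b" using maps_domain by blast
    obtain u c where u: "u \<noteq> 0" "maps r (s * t * u) c" using maps_domain by blast
    show ?thesis
    proof (rule fraction_eqI)
      show "s * t * u \<noteq> 0" using s t u by simp
      show "maps (p + q + r) (s * t * u) (a * t * u + b * u + c)"
        by (intro maps_plus maps_mult s t u)
      show "maps (p + (q + r)) (s * t * u) (a * t * u + b * u + c)"
        unfolding add.assoc by (intro maps_plus maps_mult s t u)
    qed
  qed
  show "(p + q) * r = p * r + q * r"
  proof -
    obtain s a where s: "s \<noteq> 0" "maps r s a" using maps_denominator by blast
    obtain t b where t: "t \<noteq> 0" "maps p (a * t) b" using maps_domain by blast
    obtain u c where u: "u \<noteq> 0" "maps q (a * t * u) c" using maps_domain by blast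
    have r: "maps r (s * t * u) (a * t * u)" by (intro maps_mult s)
    have p: "maps p (a * t * u) (b * u)" by (intro maps_mult t)
    show ?thesis
    proof (rule fraction_eqI)
      show "s * t * u \<noteq> 0" using s t u by simp
      show "maps ((p + q) * r) (s * t * u) (b * u + c)"
        by (rule maps_times [OF r maps_plus [OF p u(2)]])
      show "maps (p * r + q * r) (s * t * u) (b * u + c)"
        by (rule maps_plus [OF maps_times [OF r p] maps_times [OF r u(2)]])
    qed
  qed
  show "p * (q + r) = p * q + p * r"
  proof -
    obtain s a where s: "s \<noteq> 0" "maps q s a" using maps_denominator by blast
    obtain t b where t: "t \<noteq> 0" "maps r (s * t) b" using maps_domain by blast
    obtain u c where u: "u \<noteq> 0" "maps p (a * t * u) c" using maps_domain by blast
    obtain v d where v: "v \<noteq> 0" "maps p (b * u * v) d" using maps_domain by blast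
    have q: "maps q (s * t * u * v) (a * t * u * v)" by (intro maps_mult s)
    have r: "maps r (s * t * u * v) (b * u * v)" by (intro maps_mult t)
    have p: "maps p (a * t * u * v) (c * v)" by (intro maps_mult u)
    show ?thesis
    proof (rule fraction_eqI)
      show "s * t * u * v \<noteq> 0" using s t u v by simp
      show "maps (p * (q + r)) (s * t * u * v) (c * v + d)"
        by (rule maps_times [OF maps_plus [OF q r] maps_add [OF p v(2)]])
      show "maps (p * q + p * r) (s * t * u * v) (c * v + d)"
        by (rule maps_plus [OF maps_times [OF q p] maps_times [OF r v(2)]])
    qed
  qed
  show "(0 :: 'a fraction) \<noteq> 1"
    using maps_0 [of "1 :: 'a"] maps_1 [of "1 :: 'a"] maps_unique by fastforce
qed (simp_all add: minus_fraction_def divide_fraction_def inverse_fraction_def)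

end

definition frac :: "'a::ore_domain \<Rightarrow> 'a fraction" where
  "frac a = (SOME q. maps q 1 a)"

lemma maps_frac: "maps (frac a) b (a * b)"
  using someI_ex [OF maps_exists [of 1 a]] maps_mult [of "frac a" 1 a b] by (simp add: frac_def)

lemma frac_eq_iff [simp]: "frac a = frac b \<longleftrightarrow> a = b"
  using maps_frac [of a 1] maps_frac [of b 1] maps_unique by fastforce

lemma frac_0 [simp]: "frac 0 = 0"
  using maps_frac [of 0 1] maps_0 [of 1] fraction_eqI [of 1] by simp

lemma frac_1 [simp]: "frac 1 = 1"
  using maps_frac [of 1 1] maps_1 [of 1] fraction_eqI [of 1] by simp

lemma frac_add: "frac (a + b) = frac a + frac b"
  using maps_frac [of "a + b" 1] maps_plus [OF maps_frac [of a 1] maps_frac [of b 1]]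
    fraction_eqI [of 1] by simp

lemma frac_mult: "frac (a * b) = frac a * frac b"
  using maps_frac [of "a * b" 1] maps_times [OF maps_frac [of b 1] maps_frac [of a]]
    fraction_eqI [of 1] by simp

lemma frac_uminus: "frac (- a) = - frac a"
  using frac_add [of "- a" a] by (simp add: eq_neg_iff_add_eq_0)

lemma frac_diff: "frac (a - b) = frac a - frac b"
  using frac_add [of a "- b"] by (simp add: frac_uminus)

lemma frac_eq_0_iff [simp]: "frac a = 0 \<longleftrightarrow> a = 0"
  by (metis frac_0 frac_eq_iff)

lemma frac_power: "frac (a ^ n) = frac a ^ n"
  by (induction n) (simp_all add: frac_mult)

lemma fraction_mult_denominator: "\<exists>a b. b \<noteq> 0 \<and> q * frac b = frac a"
proof -
  obtain s b where s: "s \<noteq> 0" "maps q s b" using maps_denominator by blast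
  have "maps (q * frac s) 1 b" using maps_times [OF maps_frac [of s 1]] s by simp
  then have "q * frac s = frac b" using fraction_eqI [of 1] maps_frac [of b 1] by simp
  then show ?thesis using s by blast
qed

lemma denominator_mult_fraction: "\<exists>a b. b \<noteq> 0 \<and> frac b * q = frac a"
proof -
  obtain a b where ab: "b \<noteq> 0" "q * frac b = frac a" using fraction_mult_denominator by blast
  obtain u v where uv: "v \<noteq> 0" "v * a = u * b" using left_ore [OF ab(1)] by blast
  have "frac v * q * frac b = frac u * frac b"
    using ab uv by (metis frac_mult mult.assoc)
  then have "frac v * q = frac u" using ab by simp
  then show ?thesis using uv by blast
qed

section \<open>Rings of fractions inside a type\<close>

lemma type_algebra_simps [simp]:
  "carrier ring_of_type_algebra = UNIV"
  "x \<otimes>\<^bsub>ring_of_type_algebra\<^esub> y = x * y"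
  "x \<oplus>\<^bsub>ring_of_type_algebra\<^esub> y = x + y"
  "\<one>\<^bsub>ring_of_type_algebra\<^esub> = 1"
  "\<zero>\<^bsub>ring_of_type_algebra\<^esub> = 0"
  by (simp_all add: ring_of_type_algebra_def)

lemma ring_type_algebra: "ring (ring_of_type_algebra :: 'a::ring_1 ring)"
proof -
  have "\<exists>y. x + y = 0 \<and> y + x = 0" for x :: 'a
    by (intro exI [of _ "- x"]) simp
  then show ?thesis
    by unfold_locales (auto simp: ring_of_type_algebra_def algebra_simps Units_def)
qed

lemma type_algebra_Units_iff:
  "x \<in> Units ring_of_type_algebra \<longleftrightarrow> (\<exists>y. x * y = 1 \<and> y * x = 1)"
  by (auto simp: Units_def)

lemma type_algebra_ring_hom_iff:
  "f \<in> ring_hom R ring_of_type_algebra \<longleftrightarrow>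
     (\<forall>x\<in>carrier R. \<forall>y\<in>carrier R. f (x \<otimes>\<^bsub>R\<^esub> y) = f x * f y \<and> f (x \<oplus>\<^bsub>R\<^esub> y) = f x + f y) \<and>
     f \<one>\<^bsub>R\<^esub> = 1"
  by (auto simp: ring_hom_def)

lemma ring_hom_type_algebra_0:
  assumes "ring R" "f \<in> ring_hom R ring_of_type_algebra"
  shows "f \<zero>\<^bsub>R\<^esub> = (0 :: 'b::ring_1)"
  using ring_hom_zero [OF assms(2,1) ring_type_algebra] by simp

lemma (in monoid) Units_solve_right:
  assumes "u \<in> Units G" "a \<in> carrier G" "a \<otimes> u = b"
  shows "a = b \<otimes> inv u"
  unfolding assms(3) [symmetric] using assms(1,2) Units_closed [OF assms(1)] by (simp add: m_assoc)

lemma (in monoid) Units_solve_left: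
  assumes "u \<in> Units G" "a \<in> carrier G" "u \<otimes> a = b"
  shows "a = inv u \<otimes> b"
  unfolding assms(3) [symmetric]
  using assms(1,2) Units_closed [OF assms(1)] m_assoc [of "inv u" u a] by simp

lemma regular_elements_carrier: "regular_elements R \<subseteq> carrier R"
  by (simp add: regular_elements_def)

lemma regular_elementsD:
  assumes "c \<in> regular_elements R" "r \<in> carrier R"
  shows "c \<otimes>\<^bsub>R\<^esub> r = \<zero>\<^bsub>R\<^esub> \<Longrightarrow> r = \<zero>\<^bsub>R\<^esub>" "r \<otimes>\<^bsub>R\<^esub> c = \<zero>\<^bsub>R\<^esub> \<Longrightarrow> r = \<zero>\<^bsub>R\<^esub>"
proof -
  have "(c \<otimes>\<^bsub>R\<^esub> r = \<zero>\<^bsub>R\<^esub> \<longrightarrow> r = \<zero>\<^bsub>R\<^esub>) \<and> (r \<otimes>\<^bsub>R\<^esub> c = \<zero>\<^bsub>R\<^esub> \<longrightarrow> r = \<zero>\<^bsub>R\<^esub>)"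
    using assms(1) [unfolded regular_elements_def mem_Collect_eq, THEN conjunct2] assms(2)
    by (rule bspec)
  then show "c \<otimes>\<^bsub>R\<^esub> r = \<zero>\<^bsub>R\<^esub> \<Longrightarrow> r = \<zero>\<^bsub>R\<^esub>" "r \<otimes>\<^bsub>R\<^esub> c = \<zero>\<^bsub>R\<^esub> \<Longrightarrow> r = \<zero>\<^bsub>R\<^esub>"
    by simp_all
qed

lemma ring_of_fractionsD:
  assumes "ring_of_fractions R S Q \<phi>"
  shows "ring Q" "\<phi> \<in> ring_hom R Q" "\<phi> ` S \<subseteq> Units Q"
    and "a_kernel R Q \<phi> = {r \<in> carrier R. \<exists>s\<in>S. r \<otimes>\<^bsub>R\<^esub> s = \<zero>\<^bsub>R\<^esub>}"
    and "q \<in> carrier Q \<Longrightarrow> \<exists>r\<in>carrier R. \<exists>s\<in>S. q = \<phi> r \<otimes>\<^bsub>Q\<^esub> inv\<^bsub>Q\<^esub> (\<phi> s)"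
    and "q \<in> carrier Q \<Longrightarrow> \<exists>r\<in>carrier R. \<exists>s\<in>S. q = inv\<^bsub>Q\<^esub> (\<phi> s) \<otimes>\<^bsub>Q\<^esub> \<phi> r"
proof -
  note * = assms [unfolded ring_of_fractions_def]
  show "ring Q" "\<phi> \<in> ring_hom R Q" "\<phi> ` S \<subseteq> Units Q" using * by simp_all
  note * = *[THEN conjunct2, THEN conjunct2, THEN conjunct2]
  show "a_kernel R Q \<phi> = {r \<in> carrier R. \<exists>s\<in>S. r \<otimes>\<^bsub>R\<^esub> s = \<zero>\<^bsub>R\<^esub>}"
    using *[THEN conjunct2, THEN conjunct2] by (rule conjunct1)
  assume q: "q \<in> carrier Q"
  show "\<exists>r\<in>carrier R. \<exists>s\<in>S. q = \<phi> r \<otimes>\<^bsub>Q\<^esub> inv\<^bsub>Q\<^esub> (\<phi> s)"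
    using q [unfolded *[THEN conjunct1]] by blast
  show "\<exists>r\<in>carrier R. \<exists>s\<in>S. q = inv\<^bsub>Q\<^esub> (\<phi> s) \<otimes>\<^bsub>Q\<^esub> \<phi> r"
    using q [unfolded *[THEN conjunct2, THEN conjunct1]] by blast
qed

lemma ring_of_fractionsI:
  assumes R: "ring R" and Q: "ring Q" and hom: "\<phi> \<in> ring_hom R Q" and inj: "inj_on \<phi> (carrier R)"
    and S: "S \<subseteq> carrier R" "S \<noteq> {}"
    and unit: "\<phi> ` S \<subseteq> Units Q"
    and right: "\<And>q. q \<in> carrier Q \<Longrightarrow> \<exists>r\<in>carrier R. \<exists>s\<in>S. q \<otimes>\<^bsub>Q\<^esub> \<phi> s = \<phi> r"
    and left: "\<And>q. q \<in> carrier Q \<Longrightarrow> \<exists>r\<in>carrier R. \<exists>s\<in>S. \<phi> s \<otimes>\<^bsub>Q\<^esub> q = \<phi> r"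
  shows "ring_of_fractions R S Q \<phi>"
proof -
  interpret R: ring R by fact
  interpret Q: ring Q by fact
  interpret h: ring_hom_ring R Q \<phi> by (rule ring_hom_ringI2) fact+
  have u: "\<phi> s \<in> Units Q" "\<phi> s \<in> carrier Q" if "s \<in> S" for s using unit that by blast+
  have q1: "q = \<phi> r \<otimes>\<^bsub>Q\<^esub> inv\<^bsub>Q\<^esub> (\<phi> s)"
    if "q \<in> carrier Q" "s \<in> S" "q \<otimes>\<^bsub>Q\<^esub> \<phi> s = \<phi> r" for q r s
    using Q.Units_solve_right [OF u(1) [OF that(2)] that(1,3)] .
  have 1: "carrier Q = {\<phi> r \<otimes>\<^bsub>Q\<^esub> inv\<^bsub>Q\<^esub> (\<phi> s) | r s. r \<in> carrier R \<and> s \<in> S}"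
  proof (intro equalityI subsetI)
    fix q assume q: "q \<in> carrier Q"
    then show "q \<in> {\<phi> r \<otimes>\<^bsub>Q\<^esub> inv\<^bsub>Q\<^esub> (\<phi> s) | r s. r \<in> carrier R \<and> s \<in> S}"
      using right [OF q] q1 by blast
  qed (use u S in auto)
  have q2: "q = inv\<^bsub>Q\<^esub> (\<phi> s) \<otimes>\<^bsub>Q\<^esub> \<phi> r"
    if "q \<in> carrier Q" "s \<in> S" "\<phi> s \<otimes>\<^bsub>Q\<^esub> q = \<phi> r" for q r s
    using Q.Units_solve_left [OF u(1) [OF that(2)] that(1,3)] .
  have 2: "carrier Q = {inv\<^bsub>Q\<^esub> (\<phi> s) \<otimes>\<^bsub>Q\<^esub> \<phi> r | r s. r \<in> carrier R \<and> s \<in> S}"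
  proof (intro equalityI subsetI)
    fix q assume q: "q \<in> carrier Q"
    then show "q \<in> {inv\<^bsub>Q\<^esub> (\<phi> s) \<otimes>\<^bsub>Q\<^esub> \<phi> r | r s. r \<in> carrier R \<and> s \<in> S}"
      using left [OF q] q2 by blast
  qed (use u S in auto)
  have ker: "a_kernel R Q \<phi> = {\<zero>\<^bsub>R\<^esub>}"
  proof -
    have "r = \<zero>\<^bsub>R\<^esub>" if "r \<in> carrier R" "\<phi> r = \<zero>\<^bsub>Q\<^esub>" for r
      using inj_onD [OF inj, of r "\<zero>\<^bsub>R\<^esub>"] that by simp
    then show ?thesis unfolding a_kernel_def' by auto
  qed
  have "r = \<zero>\<^bsub>R\<^esub>" if "r \<in> carrier R" "s \<in> S" "r \<otimes>\<^bsub>R\<^esub> s = \<zero>\<^bsub>R\<^esub> \<or> s \<otimes>\<^bsub>R\<^esub> r = \<zero>\<^bsub>R\<^esub>" for r s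
  proof -
    have s: "s \<in> carrier R" using that S by blast
    from that(3) have "\<phi> r \<otimes>\<^bsub>Q\<^esub> \<phi> s = \<zero>\<^bsub>Q\<^esub> \<or> \<phi> s \<otimes>\<^bsub>Q\<^esub> \<phi> r = \<zero>\<^bsub>Q\<^esub>"
      using that(1) s by (elim disjE) (simp_all flip: h.hom_mult)
    then have "\<phi> r = \<zero>\<^bsub>Q\<^esub>"
    proof
      assume "\<phi> r \<otimes>\<^bsub>Q\<^esub> \<phi> s = \<zero>\<^bsub>Q\<^esub>"
      then show ?thesis
        using Q.Units_solve_right [OF u(1) [OF that(2)] h.hom_closed [OF that(1)]]
          Q.l_null [OF Q.Units_inv_closed [OF u(1) [OF that(2)]]] by simp
    next
      assume "\<phi> s \<otimes>\<^bsub>Q\<^esub> \<phi> r = \<zero>\<^bsub>Q\<^esub>"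
      then show ?thesis
        using Q.Units_solve_left [OF u(1) [OF that(2)] h.hom_closed [OF that(1)]]
          Q.r_null [OF Q.Units_inv_closed [OF u(1) [OF that(2)]]] by simp
    qed
    then show ?thesis using inj_onD [OF inj, of r "\<zero>\<^bsub>R\<^esub>"] that(1) by simp
  qed
  note r0 = this
  obtain s where s: "s \<in> S" "s \<in> carrier R" using S by blast
  have 3: "a_kernel R Q \<phi> = {r \<in> carrier R. \<exists>s\<in>S. r \<otimes>\<^bsub>R\<^esub> s = \<zero>\<^bsub>R\<^esub>}"
    unfolding ker
  proof (intro equalityI subsetI)
    fix r assume "r \<in> {\<zero>\<^bsub>R\<^esub>}"
    with s show "r \<in> {r \<in> carrier R. \<exists>s\<in>S. r \<otimes>\<^bsub>R\<^esub> s = \<zero>\<^bsub>R\<^esub>}" by (auto intro: R.l_null)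
  qed (use r0 in blast)
  have 4: "a_kernel R Q \<phi> = {r \<in> carrier R. \<exists>s\<in>S. s \<otimes>\<^bsub>R\<^esub> r = \<zero>\<^bsub>R\<^esub>}"
    unfolding ker
  proof (intro equalityI subsetI)
    fix r assume "r \<in> {\<zero>\<^bsub>R\<^esub>}"
    with s show "r \<in> {r \<in> carrier R. \<exists>s\<in>S. s \<otimes>\<^bsub>R\<^esub> r = \<zero>\<^bsub>R\<^esub>}" by (auto intro: R.r_null)
  qed (use r0 in blast)
  show ?thesis
    unfolding ring_of_fractions_def by (intro conjI Q hom unit 1 2 3 4)
qed

lemma ring_of_fractions_inj:
  assumes "ring R" "ring_of_fractions R S Q \<phi>" "S \<subseteq> regular_elements R"
  shows "inj_on \<phi> (carrier R)"
proof -
  interpret R: ring R by fact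
  note frac = ring_of_fractionsD [OF assms(2)]
  interpret Q: ring Q by (rule frac)
  interpret h: ring_hom_ring R Q \<phi> by (intro ring_hom_ringI2 R.ring_axioms Q.ring_axioms frac)
  have "r = \<zero>\<^bsub>R\<^esub>" if "r \<in> carrier R" "s \<in> S" "r \<otimes>\<^bsub>R\<^esub> s = \<zero>\<^bsub>R\<^esub>" for r s
    using regular_elementsD(2) [OF subsetD [OF assms(3) that(2)] that(1,3)] .
  then have "a_kernel R Q \<phi> \<subseteq> {\<zero>\<^bsub>R\<^esub>}"
    unfolding frac(4) by blast
  moreover have "\<zero>\<^bsub>R\<^esub> \<in> a_kernel R Q \<phi>"
    unfolding a_kernel_def' using h.hom_zero by simp
  ultimately have "a_kernel R Q \<phi> = {\<zero>\<^bsub>R\<^esub>}" by blast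
  then show ?thesis by (rule h.trivial_ker_imp_inj)
qed

lemma ring_of_fractions_denominator:
  assumes "ring R" "ring_of_fractions R S Q \<phi>" "S \<subseteq> carrier R" "q \<in> carrier Q"
  shows "\<exists>r\<in>carrier R. \<exists>s\<in>S. q \<otimes>\<^bsub>Q\<^esub> \<phi> s = \<phi> r"
    and "\<exists>r\<in>carrier R. \<exists>s\<in>S. \<phi> s \<otimes>\<^bsub>Q\<^esub> q = \<phi> r"
proof -
  interpret R: ring R by fact
  note frac = ring_of_fractionsD [OF assms(2)]
  interpret Q: ring Q by (rule frac)
  interpret h: ring_hom_ring R Q \<phi> by (intro ring_hom_ringI2 R.ring_axioms Q.ring_axioms frac)
  have u: "\<phi> s \<in> Units Q" if "s \<in> S" for s
    using frac(3) that by blast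
  obtain r s where "r \<in> carrier R" "s \<in> S" "q = \<phi> r \<otimes>\<^bsub>Q\<^esub> inv\<^bsub>Q\<^esub> (\<phi> s)"
    using frac(5) [OF assms(4)] by blast
  then show "\<exists>r\<in>carrier R. \<exists>s\<in>S. q \<otimes>\<^bsub>Q\<^esub> \<phi> s = \<phi> r"
    using u [of s] Q.Units_closed [OF u [of s]]
    by (intro bexI [of _ r] bexI [of _ s]) (simp_all add: Q.m_assoc)
  obtain r s where "r \<in> carrier R" "s \<in> S" "q = inv\<^bsub>Q\<^esub> (\<phi> s) \<otimes>\<^bsub>Q\<^esub> \<phi> r"
    using frac(6) [OF assms(4)] by blast
  then show "\<exists>r\<in>carrier R. \<exists>s\<in>S. \<phi> s \<otimes>\<^bsub>Q\<^esub> q = \<phi> r"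
    using u [of s] Q.Units_closed [OF u [of s]]
    by (intro bexI [of _ r] bexI [of _ s]) (simp_all flip: Q.m_assoc)
qed

text \<open>The image of a fraction \<open>q\<close> is the unique \<open>\<tau>\<close> with \<open>\<tau> f(a) = f(b)\<close> whenever \<open>q a = b\<close>;
  no compatibility between different representations of \<open>q\<close> has to be checked.\<close>

lemma ring_of_fractions_universal:
  fixes f :: "'a \<Rightarrow> 't::ring_1" and R :: "('a, 'm) ring_scheme" and Q :: "('b, 'n) ring_scheme"
  assumes R: "ring R" and frac: "ring_of_fractions R S Q \<phi>" and reg: "S \<subseteq> regular_elements R"
    and f: "f \<in> ring_hom R ring_of_type_algebra" "inj_on f (carrier R)"
    and unit: "f ` S \<subseteq> Units ring_of_type_algebra"
  obtains \<Phi> where "\<Phi> \<in> ring_hom Q ring_of_type_algebra" "inj_on \<Phi> (carrier Q)"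
    "\<And>r. r \<in> carrier R \<Longrightarrow> \<Phi> (\<phi> r) = f r"
    "\<Phi> ` carrier Q = {\<tau>. \<exists>r\<in>carrier R. \<exists>s\<in>S. \<tau> * f s = f r}"
proof -
  interpret R: ring R by fact
  interpret Q: ring Q by (rule ring_of_fractionsD [OF frac])
  interpret h: ring_hom_ring R Q \<phi>
    by (intro ring_hom_ringI2 R.ring_axioms Q.ring_axioms ring_of_fractionsD [OF frac])
  have S: "S \<subseteq> carrier R" using reg regular_elements_carrier by (rule order.trans)
  then have SR [simp]: "s \<in> carrier R" if "s \<in> S" for s using that by blast
  have inj: "inj_on \<phi> (carrier R)" using ring_of_fractions_inj [OF R frac reg] .
  have fm: "f (a \<otimes>\<^bsub>R\<^esub> b) = f a * f b" "f (a \<oplus>\<^bsub>R\<^esub> b) = f a + f b"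
    if "a \<in> carrier R" "b \<in> carrier R" for a b
    using f(1) [unfolded type_algebra_ring_hom_iff] that by simp_all
  have f1: "f \<one>\<^bsub>R\<^esub> = 1" using f(1) [unfolded type_algebra_ring_hom_iff] by simp
  have u: "\<phi> s \<in> Units Q" if "s \<in> S" for s
    using ring_of_fractionsD(3) [OF frac] that by blast
  note den = ring_of_fractions_denominator [OF R frac S]
  have f_unit: "\<exists>i. f s * i = 1 \<and> i * f s = 1" if "s \<in> S" for s
    using subsetD [OF unit imageI [OF that]] by (simp add: type_algebra_Units_iff)
  have unit_cancel: "x = y" if "x * f s = y * f s" "s \<in> S" for x y s
  proof -
    from f_unit [OF that(2)] obtain i where "f s * i = 1" by blast
    moreover have "x * f s * i = y * f s * i" using that(1) by simp
    ultimately show ?thesis by (simp add: mult.assoc)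
  qed
  have cancel: "p = q" if "p \<otimes>\<^bsub>Q\<^esub> \<phi> s = q \<otimes>\<^bsub>Q\<^esub> \<phi> s" "s \<in> S" "p \<in> carrier Q" "q \<in> carrier Q" for p q s
    by (rule trans [OF Q.Units_solve_right [OF u [OF that(2)] that(3,1)]
          Q.Units_solve_right [OF u [OF that(2)] that(4) refl, symmetric]])
  have ore: "\<exists>c\<in>carrier R. \<exists>v\<in>S. a \<otimes>\<^bsub>R\<^esub> v = s \<otimes>\<^bsub>R\<^esub> c" if a: "a \<in> carrier R" and s: "s \<in> S" for a s
  proof -
    let ?i = "inv\<^bsub>Q\<^esub> (\<phi> s)"
    have i: "?i \<in> carrier Q" "\<phi> s \<otimes>\<^bsub>Q\<^esub> ?i = \<one>\<^bsub>Q\<^esub>" using u [OF s] by simp_all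
    note [simp] = h.hom_closed [OF a] h.hom_closed [OF SR [OF s]]
    have "?i \<otimes>\<^bsub>Q\<^esub> \<phi> a \<in> carrier Q" using i by simp
    then obtain c v where c: "c \<in> carrier R" "v \<in> S"
      and eq: "?i \<otimes>\<^bsub>Q\<^esub> \<phi> a \<otimes>\<^bsub>Q\<^esub> \<phi> v = \<phi> c" using den(1) by blast
    have v: "v \<in> carrier R" "\<phi> v \<in> carrier Q" using c by simp_all
    have "\<phi> (s \<otimes>\<^bsub>R\<^esub> c) = \<phi> s \<otimes>\<^bsub>Q\<^esub> (?i \<otimes>\<^bsub>Q\<^esub> \<phi> a \<otimes>\<^bsub>Q\<^esub> \<phi> v)"
      unfolding eq using s c by simp
    also have "\<dots> = (\<phi> s \<otimes>\<^bsub>Q\<^esub> ?i) \<otimes>\<^bsub>Q\<^esub> (\<phi> a \<otimes>\<^bsub>Q\<^esub> \<phi> v)"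
      using i(1) v by (simp only: Q.m_assoc Q.m_closed \<open>\<phi> a \<in> carrier Q\<close> \<open>\<phi> s \<in> carrier Q\<close>)
    also have "\<dots> = \<phi> (a \<otimes>\<^bsub>R\<^esub> v)" using i v a by simp
    finally have "a \<otimes>\<^bsub>R\<^esub> v = s \<otimes>\<^bsub>R\<^esub> c"
      using inj_onD [OF inj, of "a \<otimes>\<^bsub>R\<^esub> v" "s \<otimes>\<^bsub>R\<^esub> c"] a s c v by simp
    then show ?thesis using c by blast
  qed
  define rel where "rel q \<tau> \<longleftrightarrow> (\<forall>a\<in>carrier R. \<forall>b\<in>carrier R. q \<otimes>\<^bsub>Q\<^esub> \<phi> a = \<phi> b \<longrightarrow> \<tau> * f a = f b)"
    for q \<tau>
  have relI: "rel q \<tau>" if q: "q \<in> carrier Q" and r: "r \<in> carrier R" and s: "s \<in> S"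
    and eq: "q \<otimes>\<^bsub>Q\<^esub> \<phi> s = \<phi> r" and \<tau>: "\<tau> * f s = f r" for q \<tau> r s
    unfolding rel_def
  proof (intro ballI impI)
    fix a b assume a: "a \<in> carrier R" and b: "b \<in> carrier R" and ab: "q \<otimes>\<^bsub>Q\<^esub> \<phi> a = \<phi> b"
    obtain c v where c: "c \<in> carrier R" "v \<in> S" "a \<otimes>\<^bsub>R\<^esub> v = s \<otimes>\<^bsub>R\<^esub> c" using ore [OF a s] by blast
    have "\<phi> (b \<otimes>\<^bsub>R\<^esub> v) = q \<otimes>\<^bsub>Q\<^esub> \<phi> (a \<otimes>\<^bsub>R\<^esub> v)"
      using a b c(2) q ab by (simp add: Q.m_assoc [symmetric])
    also have "\<dots> = \<phi> (r \<otimes>\<^bsub>R\<^esub> c)"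
      unfolding c(3) using q r s c(1) eq by (simp add: Q.m_assoc [symmetric])
    finally have "b \<otimes>\<^bsub>R\<^esub> v = r \<otimes>\<^bsub>R\<^esub> c" by (rule inj_onD [OF inj]) (use b r c in simp_all)
    then have "f (b \<otimes>\<^bsub>R\<^esub> v) = f (r \<otimes>\<^bsub>R\<^esub> c)" by simp
    then have "f b * f v = f r * f c" using b r c by (simp add: fm)
    also have "\<dots> = \<tau> * (f s * f c)" by (simp add: \<tau> flip: mult.assoc)
    also have "f s * f c = f (a \<otimes>\<^bsub>R\<^esub> v)" unfolding c(3) using s c by (simp add: fm)
    also have "\<dots> = f a * f v" using a c(2) by (simp add: fm)
    finally show "\<tau> * f a = f b"
      using unit_cancel [OF _ c(2)] by (simp add: mult.assoc)
  qed
  have ex: "\<exists>\<tau>. rel q \<tau>" if q: "q \<in> carrier Q" for q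
  proof -
    obtain r s where r: "r \<in> carrier R" "s \<in> S" "q \<otimes>\<^bsub>Q\<^esub> \<phi> s = \<phi> r" using den(1) [OF q] by blast
    from f_unit [OF r(2)] obtain i where "i * f s = 1" by blast
    then have "f r * i * f s = f r" by (simp add: mult.assoc)
    then show ?thesis using relI [OF q r] by blast
  qed
  define \<Phi> where "\<Phi> q = (SOME \<tau>. rel q \<tau>)" for q
  have \<Phi>: "\<Phi> q * f a = f b"
    if "q \<in> carrier Q" "a \<in> carrier R" "b \<in> carrier R" "q \<otimes>\<^bsub>Q\<^esub> \<phi> a = \<phi> b" for q a b
    using someI_ex [OF ex [OF that(1)]] that unfolding \<Phi>_def rel_def by blast
  have common: "\<exists>a\<in>carrier R. \<exists>b\<in>carrier R. \<exists>b'\<in>carrier R. p \<otimes>\<^bsub>Q\<^esub> \<phi> a = \<phi> b \<and> q \<otimes>\<^bsub>Q\<^esub> \<phi> a = \<phi> b' \<and>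
      (\<forall>x y. x * f a = y * f a \<longrightarrow> x = y) \<and> (p \<otimes>\<^bsub>Q\<^esub> \<phi> a = q \<otimes>\<^bsub>Q\<^esub> \<phi> a \<longrightarrow> p = q)"
    if p: "p \<in> carrier Q" and q: "q \<in> carrier Q" for p q
  proof -
    obtain r s where r: "r \<in> carrier R" "s \<in> S" "p \<otimes>\<^bsub>Q\<^esub> \<phi> s = \<phi> r" using den(1) [OF p] by blast
    obtain r' s' where r': "r' \<in> carrier R" "s' \<in> S" "q \<otimes>\<^bsub>Q\<^esub> \<phi> s' = \<phi> r'" using den(1) [OF q] by blast
    obtain c v where c: "c \<in> carrier R" "v \<in> S" "s' \<otimes>\<^bsub>R\<^esub> v = s \<otimes>\<^bsub>R\<^esub> c"
      using ore [of s' s] r r' by auto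
    have 1: "p \<otimes>\<^bsub>Q\<^esub> \<phi> (s' \<otimes>\<^bsub>R\<^esub> v) = \<phi> (r \<otimes>\<^bsub>R\<^esub> c)"
      unfolding c(3) using r c(1) p by (simp add: Q.m_assoc [symmetric])
    have 2: "q \<otimes>\<^bsub>Q\<^esub> \<phi> (s' \<otimes>\<^bsub>R\<^esub> v) = \<phi> (r' \<otimes>\<^bsub>R\<^esub> v)"
      using r' c(2) q by (simp add: Q.m_assoc [symmetric])
    have 3: "x = y" if "x * f (s' \<otimes>\<^bsub>R\<^esub> v) = y * f (s' \<otimes>\<^bsub>R\<^esub> v)" for x y
    proof -
      have "x * f s' * f v = y * f s' * f v"
        using that r'(1,2) c(1,2) by (simp add: fm mult.assoc)
      then show ?thesis using unit_cancel r' c by blast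
    qed
    have 4: "p = q" if "p \<otimes>\<^bsub>Q\<^esub> \<phi> (s' \<otimes>\<^bsub>R\<^esub> v) = q \<otimes>\<^bsub>Q\<^esub> \<phi> (s' \<otimes>\<^bsub>R\<^esub> v)"
    proof -
      have "p \<otimes>\<^bsub>Q\<^esub> \<phi> s' \<otimes>\<^bsub>Q\<^esub> \<phi> v = q \<otimes>\<^bsub>Q\<^esub> \<phi> s' \<otimes>\<^bsub>Q\<^esub> \<phi> v"
        using that r'(1,2) c(1,2) p q by (simp add: Q.m_assoc)
      then have "p \<otimes>\<^bsub>Q\<^esub> \<phi> s' = q \<otimes>\<^bsub>Q\<^esub> \<phi> s'"
        by (rule cancel [OF _ c(2)]) (use p q r'(2) in simp_all)
      then show ?thesis by (rule cancel [OF _ r'(2) p q])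
    qed
    show ?thesis
      by (intro bexI conjI allI impI) (rule 1, rule 2, erule 3, erule 4, use r(1) r'(1,2) c(1,2) in simp_all)
  qed
  show thesis
  proof
    show "\<Phi> \<in> ring_hom Q ring_of_type_algebra"
      unfolding type_algebra_ring_hom_iff
    proof (intro conjI ballI)
      fix p q assume p: "p \<in> carrier Q" and q: "q \<in> carrier Q"
      obtain a b b' where ab: "a \<in> carrier R" "b \<in> carrier R" "b' \<in> carrier R"
        "p \<otimes>\<^bsub>Q\<^esub> \<phi> a = \<phi> b" "q \<otimes>\<^bsub>Q\<^esub> \<phi> a = \<phi> b'"
        and can: "\<And>x y. x * f a = y * f a \<Longrightarrow> x = y"
        using common [OF p q] by metis
      have "\<Phi> (p \<oplus>\<^bsub>Q\<^esub> q) * f a = f (b \<oplus>\<^bsub>R\<^esub> b')"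
        by (rule \<Phi>) (use p q ab in \<open>simp_all add: Q.l_distr\<close>)
      also have "\<dots> = (\<Phi> p + \<Phi> q) * f a"
        using fm(2) ab \<Phi> [OF p ab(1,2,4)] \<Phi> [OF q ab(1,3,5)] by (simp add: distrib_right)
      finally show "\<Phi> (p \<oplus>\<^bsub>Q\<^esub> q) = \<Phi> p + \<Phi> q" by (rule can)
      obtain r s where r: "r \<in> carrier R" "s \<in> S" "p \<otimes>\<^bsub>Q\<^esub> \<phi> s = \<phi> r" using den(1) [OF p] by blast
      obtain r' s' where r': "r' \<in> carrier R" "s' \<in> S" "q \<otimes>\<^bsub>Q\<^esub> \<phi> s' = \<phi> r'"
        using den(1) [OF q] by blast
      obtain c v where c: "c \<in> carrier R" "v \<in> S" "r' \<otimes>\<^bsub>R\<^esub> v = s \<otimes>\<^bsub>R\<^esub> c"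
        using ore [OF r'(1) r(2)] by auto
      have p': "p \<otimes>\<^bsub>Q\<^esub> \<phi> (r' \<otimes>\<^bsub>R\<^esub> v) = \<phi> (r \<otimes>\<^bsub>R\<^esub> c)"
        unfolding c(3) using r c(1) p by (simp add: Q.m_assoc [symmetric])
      have q': "q \<otimes>\<^bsub>Q\<^esub> \<phi> (s' \<otimes>\<^bsub>R\<^esub> v) = \<phi> (r' \<otimes>\<^bsub>R\<^esub> v)"
        using r' c(2) q by (simp add: Q.m_assoc [symmetric])
      have "\<Phi> (p \<otimes>\<^bsub>Q\<^esub> q) * f (s' \<otimes>\<^bsub>R\<^esub> v) = f (r \<otimes>\<^bsub>R\<^esub> c)"
        by (rule \<Phi>) (use p q r(1,2) r'(1,2) c(1,2) p' q' in \<open>simp_all add: Q.m_assoc\<close>)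
      also have "\<dots> = \<Phi> p * f (r' \<otimes>\<^bsub>R\<^esub> v)"
        by (rule sym, rule \<Phi>) (use p r(1,2) r'(1,2) c(1,2) p' in simp_all)
      also have "f (r' \<otimes>\<^bsub>R\<^esub> v) = \<Phi> q * f (s' \<otimes>\<^bsub>R\<^esub> v)"
        by (rule sym, rule \<Phi>) (use q r'(1,2) c(1,2) q' in simp_all)
      finally have "\<Phi> (p \<otimes>\<^bsub>Q\<^esub> q) * f s' * f v = \<Phi> p * \<Phi> q * f s' * f v"
        using fm(1) r'(1,2) c(1,2) by (simp add: mult.assoc)
      then show "\<Phi> (p \<otimes>\<^bsub>Q\<^esub> q) = \<Phi> p * \<Phi> q"
        using unit_cancel r' c by blast
    next
      show "\<Phi> \<one>\<^bsub>Q\<^esub> = 1" using \<Phi> [of "\<one>\<^bsub>Q\<^esub>" "\<one>\<^bsub>R\<^esub>" "\<one>\<^bsub>R\<^esub>"] by (simp add: f1)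
    qed
    show "inj_on \<Phi> (carrier Q)"
    proof (rule inj_onI)
      fix p q assume p: "p \<in> carrier Q" and q: "q \<in> carrier Q" and eq: "\<Phi> p = \<Phi> q"
      obtain a b b' where ab: "a \<in> carrier R" "b \<in> carrier R" "b' \<in> carrier R"
        "p \<otimes>\<^bsub>Q\<^esub> \<phi> a = \<phi> b" "q \<otimes>\<^bsub>Q\<^esub> \<phi> a = \<phi> b'"
        and can: "p \<otimes>\<^bsub>Q\<^esub> \<phi> a = q \<otimes>\<^bsub>Q\<^esub> \<phi> a \<Longrightarrow> p = q"
        using common [OF p q] by metis
      have "f b = f b'" using \<Phi> [OF p ab(1,2,4)] \<Phi> [OF q ab(1,3,5)] eq by simp
      then have "b = b'" by (rule inj_onD [OF f(2)]) (use ab in simp_all)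
      then show "p = q" using can ab by simp
    qed
    show \<Phi>_\<phi>: "\<Phi> (\<phi> r) = f r" if "r \<in> carrier R" for r
      using \<Phi> [of "\<phi> r" "\<one>\<^bsub>R\<^esub>" r] that by (simp add: f1)
    show "\<Phi> ` carrier Q = {\<tau>. \<exists>r\<in>carrier R. \<exists>s\<in>S. \<tau> * f s = f r}"
    proof (intro equalityI subsetI)
      fix \<tau> assume "\<tau> \<in> \<Phi> ` carrier Q"
      then obtain q where q: "q \<in> carrier Q" "\<tau> = \<Phi> q" by blast
      obtain r s where "r \<in> carrier R" "s \<in> S" "q \<otimes>\<^bsub>Q\<^esub> \<phi> s = \<phi> r" using den(1) [OF q(1)] by blast
      moreover from this have "\<tau> * f s = f r" using \<Phi> [OF q(1), of s r] q(2) by simp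
      ultimately show "\<tau> \<in> {\<tau>. \<exists>r\<in>carrier R. \<exists>s\<in>S. \<tau> * f s = f r}" by blast
    next
      fix \<tau> assume "\<tau> \<in> {\<tau>. \<exists>r\<in>carrier R. \<exists>s\<in>S. \<tau> * f s = f r}"
      then obtain r s where r: "r \<in> carrier R" "s \<in> S" "\<tau> * f s = f r" by blast
      define q where "q = \<phi> r \<otimes>\<^bsub>Q\<^esub> inv\<^bsub>Q\<^esub> (\<phi> s)"
      have q: "q \<in> carrier Q" "q \<otimes>\<^bsub>Q\<^esub> \<phi> s = \<phi> r"
        using u [OF r(2)] r by (auto simp: q_def Q.m_assoc)
      then have "\<Phi> q * f s = \<tau> * f s" using \<Phi> [OF q(1)] r by simp
      then have "\<tau> = \<Phi> q" using unit_cancel r by metis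
      then show "\<tau> \<in> \<Phi> ` carrier Q" using q by blast
    qed
  qed
qed

lemma ring_of_fractions_iso:
  assumes R: "ring R" and frac: "ring_of_fractions R S Q \<phi>" and S: "S \<subseteq> carrier R"
    and inj: "inj_on \<phi> (carrier R)" and Q': "ring Q'" and h: "h \<in> ring_iso Q Q'"
  shows "ring_of_fractions R S Q' (h \<circ> \<phi>)"
proof (rule ring_of_fractionsI [OF R Q'])
  interpret R: ring R by fact
  interpret Q: ring Q by (rule ring_of_fractionsD [OF frac])
  interpret Q': ring Q' by fact
  interpret h: ring_hom_ring Q Q' h
    by (rule ring_hom_ringI2) (use h in \<open>auto simp: ring_iso_def Q.ring_axioms Q'.ring_axioms\<close>)
  note \<phi> = ring_of_fractionsD [OF frac]
  have \<phi>_closed [simp]: "\<phi> r \<in> carrier Q" if "r \<in> carrier R" for r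
    using ring_hom_closed [OF \<phi>(2) that] .
  have bij: "bij_betw h (carrier Q) (carrier Q')" using h by (simp add: ring_iso_def)
  show "h \<circ> \<phi> \<in> ring_hom R Q'" using \<phi>(2) h.homh by (rule ring_hom_trans)
  show "inj_on (h \<circ> \<phi>) (carrier R)"
    using inj bij by (intro comp_inj_on) (auto simp: bij_betw_def elim: inj_on_subset)
  have 0: "\<phi> \<zero>\<^bsub>R\<^esub> \<in> carrier Q" by simp
  show "S \<noteq> {}" using ring_of_fractions_denominator(1) [OF R frac S 0] by blast
  show "(h \<circ> \<phi>) ` S \<subseteq> Units Q'"
  proof
    fix y assume "y \<in> (h \<circ> \<phi>) ` S"
    then obtain s where s: "s \<in> S" "y = h (\<phi> s)" by auto
    then have "\<phi> s \<in> Units Q" using \<phi>(3) by blast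
    then obtain i where i: "i \<in> carrier Q" "\<phi> s \<in> carrier Q"
      "\<phi> s \<otimes>\<^bsub>Q\<^esub> i = \<one>\<^bsub>Q\<^esub>" "i \<otimes>\<^bsub>Q\<^esub> \<phi> s = \<one>\<^bsub>Q\<^esub>"
      unfolding Units_def by blast
    then have "h (\<phi> s) \<otimes>\<^bsub>Q'\<^esub> h i = \<one>\<^bsub>Q'\<^esub>" "h i \<otimes>\<^bsub>Q'\<^esub> h (\<phi> s) = \<one>\<^bsub>Q'\<^esub>"
      by (metis h.hom_mult h.hom_one)+
    then show "y \<in> Units Q'"
      using h.hom_closed [OF i(1)] h.hom_closed [OF i(2)] s(2) unfolding Units_def by blast
  qed
  fix q assume "q \<in> carrier Q'"
  then obtain p where p: "p \<in> carrier Q" "q = h p" using bij by (auto simp: bij_betw_def)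
  have S': "s \<in> carrier R" if "s \<in> S" for s using S that by blast
  obtain r s where r: "r \<in> carrier R" "s \<in> S" "p \<otimes>\<^bsub>Q\<^esub> \<phi> s = \<phi> r"
    using ring_of_fractions_denominator(1) [OF R frac S p(1)] by blast
  then have "q \<otimes>\<^bsub>Q'\<^esub> (h \<circ> \<phi>) s = (h \<circ> \<phi>) r"
    using p h.hom_mult [of p "\<phi> s"] S' by simp
  then show "\<exists>r\<in>carrier R. \<exists>s\<in>S. q \<otimes>\<^bsub>Q'\<^esub> (h \<circ> \<phi>) s = (h \<circ> \<phi>) r" using r by blast
  obtain r s where r: "r \<in> carrier R" "s \<in> S" "\<phi> s \<otimes>\<^bsub>Q\<^esub> p = \<phi> r"
    using ring_of_fractions_denominator(2) [OF R frac S p(1)] by blast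
  then have "(h \<circ> \<phi>) s \<otimes>\<^bsub>Q'\<^esub> q = (h \<circ> \<phi>) r"
    using p h.hom_mult [of "\<phi> s" p] S' by simp
  then show "\<exists>r\<in>carrier R. \<exists>s\<in>S. (h \<circ> \<phi>) s \<otimes>\<^bsub>Q'\<^esub> q = (h \<circ> \<phi>) r" using r by blast
qed (rule S)

text \<open>A fraction \<open>x\<close> in the ambient ring is encoded by the pairs \<open>(a, b)\<close> with \<open>x f(a) = f(b)\<close>.\<close>

lemma ring_of_fractions_exists:
  fixes f :: "'a \<Rightarrow> 't::ring_1" and R :: "('a, 'm) ring_scheme"
  assumes R: "ring R" and f: "f \<in> ring_hom R ring_of_type_algebra" and inj: "inj_on f (carrier R)"
    and S: "S \<subseteq> carrier R" "\<one>\<^bsub>R\<^esub> \<in> S" "\<And>s t. s \<in> S \<Longrightarrow> t \<in> S \<Longrightarrow> s \<otimes>\<^bsub>R\<^esub> t \<in> S"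
    and unit: "f ` S \<subseteq> Units ring_of_type_algebra"
    and right_ore: "right_ore_set R S" and left_ore: "left_ore_set R S"
  shows "\<exists>(Q :: ('a \<times> 'a) set ring) \<phi>. ring_of_fractions R S Q \<phi>"
proof -
  interpret R: ring R by fact
  interpret T: ring "ring_of_type_algebra :: 't ring" by (rule ring_type_algebra)
  have SR [simp]: "s \<in> carrier R" if "s \<in> S" for s using S(1) that by blast
  have fm: "f (a \<otimes>\<^bsub>R\<^esub> b) = f a * f b" "f (a \<oplus>\<^bsub>R\<^esub> b) = f a + f b"
    if "a \<in> carrier R" "b \<in> carrier R" for a b
    using f [unfolded type_algebra_ring_hom_iff] that by simp_all
  have f1: "f \<one>\<^bsub>R\<^esub> = 1" using f [unfolded type_algebra_ring_hom_iff] by simp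
  have f0: "f \<zero>\<^bsub>R\<^esub> = 0" by (rule ring_hom_type_algebra_0 [OF R f])
  have fneg: "f (\<ominus>\<^bsub>R\<^esub> a) = - f a" if "a \<in> carrier R" for a
    using fm(2) [of "\<ominus>\<^bsub>R\<^esub> a" a] that by (simp add: R.l_neg f0 eq_neg_iff_add_eq_0)
  have f_unit: "\<exists>i. f s * i = 1 \<and> i * f s = 1" if "s \<in> S" for s
    using subsetD [OF unit imageI [OF that]] by (simp add: type_algebra_Units_iff)
  have unit_cancel: "x = y" if "x * f s = y * f s" "s \<in> S" for x y s
  proof -
    from f_unit [OF that(2)] obtain i where "f s * i = 1" by blast
    moreover have "x * f s * i = y * f s * i" using that(1) by simp
    ultimately show ?thesis by (simp add: mult.assoc)
  qed
  have ore: "\<exists>c\<in>carrier R. \<exists>v\<in>S. a \<otimes>\<^bsub>R\<^esub> v = s \<otimes>\<^bsub>R\<^esub> c" if "a \<in> carrier R" "s \<in> S" for a s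
    using right_ore that unfolding right_ore_set_def by blast
  define K where "K = {x. \<exists>r\<in>carrier R. \<exists>s\<in>S. x * f s = f r}"
  define RK where "RK = (ring_of_type_algebra :: 't ring)\<lparr>carrier := K\<rparr>"
  have KI: "x \<in> K" if "x * f s = f r" "r \<in> carrier R" "s \<in> S" for x r s
    unfolding K_def using that by blast
  have fK: "f r \<in> K" if "r \<in> carrier R" for r
    by (rule KI [OF _ that S(2)]) (simp add: f1)
  have neg: "\<ominus>\<^bsub>ring_of_type_algebra\<^esub> x = - x" for x :: 't
    by (rule T.minus_equality) simp_all
  have K: "subring K (ring_of_type_algebra :: 't ring)"
  proof (rule T.subringI)
    fix x assume "x \<in> K"
    then obtain r s where "r \<in> carrier R" "s \<in> S" "x * f s = f r" unfolding K_def by blast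
    then show "\<ominus>\<^bsub>ring_of_type_algebra\<^esub> x \<in> K"
      unfolding neg by (intro KI [of _ s "\<ominus>\<^bsub>R\<^esub> r"]) (simp_all add: fneg)
  next
    fix x y assume "x \<in> K" "y \<in> K"
    then obtain r s r' s' where r: "r \<in> carrier R" "s \<in> S" "x * f s = f r"
      and r': "r' \<in> carrier R" "s' \<in> S" "y * f s' = f r'" unfolding K_def by blast
    obtain c v where c: "c \<in> carrier R" "v \<in> S" "s' \<otimes>\<^bsub>R\<^esub> v = s \<otimes>\<^bsub>R\<^esub> c"
      using ore [OF SR [OF r'(2)] r(2)] by blast
    have "x * f (s' \<otimes>\<^bsub>R\<^esub> v) = f (r \<otimes>\<^bsub>R\<^esub> c)"
      unfolding c(3) using r c(1) by (simp add: fm flip: mult.assoc)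
    moreover have "y * f (s' \<otimes>\<^bsub>R\<^esub> v) = f (r' \<otimes>\<^bsub>R\<^esub> v)"
      using r' c(2) by (simp add: fm flip: mult.assoc)
    ultimately have sum: "(x + y) * f (s' \<otimes>\<^bsub>R\<^esub> v) = f (r \<otimes>\<^bsub>R\<^esub> c \<oplus>\<^bsub>R\<^esub> r' \<otimes>\<^bsub>R\<^esub> v)"
      using r(1) r'(1) c(1,2) by (simp add: fm distrib_right)
    show "x \<oplus>\<^bsub>ring_of_type_algebra\<^esub> y \<in> K"
      unfolding type_algebra_simps by (rule KI [OF sum]) (use r(1) r'(1,2) c(1,2) S(3) in simp_all)
    obtain c v where c: "c \<in> carrier R" "v \<in> S" "r' \<otimes>\<^bsub>R\<^esub> v = s \<otimes>\<^bsub>R\<^esub> c"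
      using ore [OF r'(1) r(2)] by blast
    have "x * y * f (s' \<otimes>\<^bsub>R\<^esub> v) = x * (y * f s') * f v"
      using r'(2) c(2) by (simp add: fm mult.assoc)
    also have "\<dots> = x * f (s \<otimes>\<^bsub>R\<^esub> c)"
      using r'(1,3) c(2) by (simp add: fm mult.assoc flip: c(3))
    also have "\<dots> = f (r \<otimes>\<^bsub>R\<^esub> c)"
      using r c(1) by (simp add: fm flip: mult.assoc)
    finally have prod: "x * y * f (s' \<otimes>\<^bsub>R\<^esub> v) = f (r \<otimes>\<^bsub>R\<^esub> c)" .
    show "x \<otimes>\<^bsub>ring_of_type_algebra\<^esub> y \<in> K"
      unfolding type_algebra_simps by (rule KI [OF prod]) (use r(1) r'(1,2) c(1,2) S(3) in simp_all)
  qed (use fK [OF R.one_closed] f1 in simp_all)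
  have RK: "ring RK"
    unfolding RK_def using T.subring_is_ring [OF K] .
  interpret RK: ring RK by (rule RK)
  have RK_simps [simp]: "carrier RK = K" "x \<otimes>\<^bsub>RK\<^esub> y = x * y" "x \<oplus>\<^bsub>RK\<^esub> y = x + y"
    "\<one>\<^bsub>RK\<^esub> = 1" for x y
    by (simp_all add: RK_def)
  have frac: "ring_of_fractions R S RK f"
  proof (rule ring_of_fractionsI [OF R RK _ inj S(1)])
    show "f \<in> ring_hom R RK"
      by (rule ring_hom_memI) (simp_all add: fK fm f1)
    show "S \<noteq> {}" using S(2) by blast
    show "f ` S \<subseteq> Units RK"
    proof
      fix y assume "y \<in> f ` S"
      then obtain s where s: "s \<in> S" "y = f s" by blast
      then obtain i where i: "f s * i = 1" "i * f s = 1" using f_unit by blast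
      then have "i \<in> K" using s f1 by (intro KI [of i s "\<one>\<^bsub>R\<^esub>"]) simp_all
      then show "y \<in> Units RK" using i s fK by (auto simp: Units_def)
    qed
    fix x assume x: "x \<in> carrier RK"
    then obtain r s where r: "r \<in> carrier R" "s \<in> S" "x * f s = f r" unfolding RK_simps K_def by blast
    then show "\<exists>r\<in>carrier R. \<exists>s\<in>S. x \<otimes>\<^bsub>RK\<^esub> f s = f r" by auto
    obtain r' s' where r': "r' \<in> carrier R" "s' \<in> S" "s' \<otimes>\<^bsub>R\<^esub> r = r' \<otimes>\<^bsub>R\<^esub> s"
      using left_ore r(1,2) unfolding left_ore_set_def by blast
    have "f s' * x * f s = f (s' \<otimes>\<^bsub>R\<^esub> r)" using r r'(2) by (simp add: fm mult.assoc)
    also have "\<dots> = f r' * f s" unfolding r'(3) using r r'(1) by (simp add: fm)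
    finally have "f s' * x = f r'" by (rule unit_cancel) (rule r)
    then show "\<exists>r\<in>carrier R. \<exists>s\<in>S. f s \<otimes>\<^bsub>RK\<^esub> x = f r" using r' by auto
  qed
  define \<gamma> where "\<gamma> x = {(a, b). a \<in> carrier R \<and> b \<in> carrier R \<and> x * f a = f b}" for x
  have "inj_on \<gamma> (carrier RK)"
  proof (rule inj_onI)
    fix x y assume "x \<in> carrier RK" and eq: "\<gamma> x = \<gamma> y"
    then obtain r s where r: "r \<in> carrier R" "s \<in> S" "x * f s = f r" unfolding RK_simps K_def by blast
    then have "(s, r) \<in> \<gamma> x" by (simp add: \<gamma>_def)
    then have "y * f s = f r" unfolding eq by (simp add: \<gamma>_def)
    then show "x = y" using r unit_cancel by metis
  qed
  then have "\<gamma> \<in> ring_iso RK (image_ring \<gamma> RK)" "ring (image_ring \<gamma> RK)"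
    by (rule inj_imp_image_ring_iso, intro RK.inj_imp_image_ring_is_ring)
  then have "ring_of_fractions R S (image_ring \<gamma> RK) (\<gamma> \<circ> f)"
    using ring_of_fractions_iso [OF R frac S(1) inj] by blast
  then show ?thesis by blast
qed

section \<open>Presented algebras\<close>

abbreviation relation_ideal :: "('g word \<Rightarrow>\<^sub>0 'k::field) set \<Rightarrow> ('g word \<Rightarrow>\<^sub>0 'k) set" where
  "relation_ideal E \<equiv> Idl\<^bsub>ring_of_type_algebra\<^esub> E"

lemma ideal_relation_ideal: "ideal (relation_ideal E) ring_of_type_algebra"
  by (rule ring.genideal_ideal [OF ring_type_algebra]) simp

lemma type_algebra_a_minus: "x \<ominus>\<^bsub>ring_of_type_algebra\<^esub> y = x - (y :: 'a::ring_1)"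
proof -
  have "\<ominus>\<^bsub>ring_of_type_algebra\<^esub> y = - y"
    by (rule abelian_group.minus_equality [OF ring.is_abelian_group [OF ring_type_algebra]]) simp_all
  then show ?thesis by (simp add: a_minus_def)
qed

lemma relation_ideal_closed:
  shows "0 \<in> relation_ideal E"
    and "a \<in> relation_ideal E \<Longrightarrow> b \<in> relation_ideal E \<Longrightarrow> a + b \<in> relation_ideal E"
    and "a \<in> relation_ideal E \<Longrightarrow> b \<in> relation_ideal E \<Longrightarrow> a - b \<in> relation_ideal E"
    and "a \<in> relation_ideal E \<Longrightarrow> p * a \<in> relation_ideal E"
    and "a \<in> relation_ideal E \<Longrightarrow> a * p \<in> relation_ideal E"
    and "e \<in> E \<Longrightarrow> e \<in> relation_ideal E"
proof -
  interpret ideal "relation_ideal E" ring_of_type_algebra by (rule ideal_relation_ideal)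
  show 0: "0 \<in> relation_ideal E"
    using additive_subgroup.zero_closed [OF is_additive_subgroup] by simp
  show add: "a + b \<in> relation_ideal E" if "a \<in> relation_ideal E" "b \<in> relation_ideal E" for a b
    using additive_subgroup.a_closed [OF is_additive_subgroup that] by simp
  show mult: "p * a \<in> relation_ideal E" if "a \<in> relation_ideal E" for p a
    using I_l_closed [OF that, of p] by simp
  show "a * p \<in> relation_ideal E" if "a \<in> relation_ideal E"
    using I_r_closed [OF that, of p] by simp
  show "a - b \<in> relation_ideal E" if "a \<in> relation_ideal E" "b \<in> relation_ideal E"
    using add [OF that(1) mult [OF that(2), of "- 1"]] by simp
  show "e \<in> E \<Longrightarrow> e \<in> relation_ideal E"
    using ring.genideal_self [OF ring_type_algebra, of E] by auto
qed

lemma ring_presented_algebra: "ring (presented_algebra E)"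
  unfolding presented_algebra_def by (rule ideal.quotient_is_ring [OF ideal_relation_ideal])

lemma carrier_presented_algebra: "carrier (presented_algebra E) = range (presented_class E)"
  by (auto simp: presented_algebra_def FactRing_def A_RCOSETS_def' presented_class_def)

lemma presented_class_mult:
  "presented_class E a \<otimes>\<^bsub>presented_algebra E\<^esub> presented_class E b = presented_class E (a * b)"
  using ideal.rcoset_mult_add [OF ideal_relation_ideal, of a b E]
  by (simp add: presented_algebra_def FactRing_def presented_class_def)

lemma presented_class_add:
  "presented_class E a \<oplus>\<^bsub>presented_algebra E\<^esub> presented_class E b = presented_class E (a + b)"
  using ideal.a_rcos_sum [OF ideal_relation_ideal, of a b E]
  by (simp add: presented_algebra_def FactRing_def presented_class_def)

lemma presented_class_1: "\<one>\<^bsub>presented_algebra E\<^esub> = presented_class E 1"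
  by (simp add: presented_algebra_def FactRing_def presented_class_def)

lemma presented_class_eq_iff:
  "presented_class E a = presented_class E b \<longleftrightarrow> a - b \<in> relation_ideal E"
  using ring.quotient_eq_iff_same_a_r_cos [OF ring_type_algebra ideal_relation_ideal, of a b E]
  unfolding presented_class_def type_algebra_a_minus by auto

lemma vanishes_on_relation_ideal:
  fixes f :: "('g word \<Rightarrow>\<^sub>0 'k::field) \<Rightarrow> 't::ring_1"
  assumes add: "\<And>a b. f (a + b) = f a + f b" and mult: "\<And>a b. f (a * b) = f a * f b"
    and E: "\<And>e. e \<in> E \<Longrightarrow> f e = 0" and a: "a \<in> relation_ideal E"
  shows "f a = 0"
proof -
  have 0: "f 0 = 0" using add [of 0 0] by simp
  have neg: "f (- a) = - f a" for a using add [of "- a" a] by (simp add: 0 eq_neg_iff_add_eq_0)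
  have "ideal {a. f a = 0} ring_of_type_algebra"
  proof (rule idealI [OF ring_type_algebra])
    show "subgroup {a. f a = 0} (add_monoid ring_of_type_algebra)"
    proof (rule group.subgroupI)
      show "group (add_monoid (ring_of_type_algebra :: ('g word \<Rightarrow>\<^sub>0 'k) ring))"
        using ring.is_abelian_group [OF ring_type_algebra] abelian_group.a_group by blast
      fix a assume "a \<in> {a. f a = 0}"
      moreover have "inv\<^bsub>add_monoid ring_of_type_algebra\<^esub> a = - a"
        using type_algebra_a_minus [of 0 a] by (simp add: a_minus_def a_inv_def)
      ultimately show "inv\<^bsub>add_monoid ring_of_type_algebra\<^esub> a \<in> {a. f a = 0}"
        by (simp add: neg)
    qed (use 0 add in auto)
  qed (simp_all add: mult)
  then have "relation_ideal E \<subseteq> {a. f a = 0}"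
    by (rule ring.genideal_minimal [OF ring_type_algebra]) (use E in auto)
  then show ?thesis using a by blast
qed

lemma presented_algebra_hom:
  fixes f :: "('g word \<Rightarrow>\<^sub>0 'k::field) \<Rightarrow> 't::ring_1"
  assumes add: "\<And>a b. f (a + b) = f a + f b" and mult: "\<And>a b. f (a * b) = f a * f b"
    and one: "f 1 = 1" and E: "\<And>e. e \<in> E \<Longrightarrow> f e = 0"
    and inj: "\<And>a. f a = 0 \<Longrightarrow> a \<in> relation_ideal E"
  obtains g where "g \<in> ring_hom (presented_algebra E) ring_of_type_algebra"
    "inj_on g (carrier (presented_algebra E))" "\<And>a. g (presented_class E a) = f a"
proof -
  have diff: "f (a - b) = f a - f b" for a b using add [of "a - b" b] by (simp add: algebra_simps)
  have ker: "a \<in> relation_ideal E \<longleftrightarrow> f a = 0" for a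
    using inj vanishes_on_relation_ideal [of f E a, OF add mult E] by blast
  define g where "g = (\<lambda>c. f (inv_into UNIV (presented_class E) c))"
  have g: "g (presented_class E a) = f a" for a
  proof -
    have "presented_class E (inv_into UNIV (presented_class E) (presented_class E a)) = presented_class E a"
      by (rule f_inv_into_f) simp
    then show ?thesis
      unfolding g_def presented_class_eq_iff ker diff by simp
  qed
  show thesis
  proof
    show "g \<in> ring_hom (presented_algebra E) ring_of_type_algebra"
      unfolding type_algebra_ring_hom_iff
      by (auto simp: carrier_presented_algebra presented_class_mult presented_class_add
          presented_class_1 g add mult one)
    show "inj_on g (carrier (presented_algebra E))"
      by (auto simp: inj_on_def carrier_presented_algebra g presented_class_eq_iff ker diff)
  qed (rule g)
qed

definition free_eval :: "('k::field \<Rightarrow> 't::ring_1) \<Rightarrow> ('g \<Rightarrow> 't) \<Rightarrow> ('g word \<Rightarrow>\<^sub>0 'k) \<Rightarrow> 't" where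
  "free_eval \<iota> x p = (\<Sum>w\<in>Poly_Mapping.keys p. \<iota> (Poly_Mapping.lookup p w) * prod_list (map x (letters w)))"

lemma poly_mapping_single_induct [case_names 0 single add]:
  assumes "P 0" "\<And>k v. P (Poly_Mapping.single k v)" "\<And>p q. P p \<Longrightarrow> P q \<Longrightarrow> P (p + q)"
  shows "P (p :: 'a \<Rightarrow>\<^sub>0 'b::comm_monoid_add)"
proof -
  have "p = (\<Sum>k\<in>Poly_Mapping.keys p. Poly_Mapping.single k (Poly_Mapping.lookup p k))"
    by (rule poly_mapping_eqI)
       (auto simp: lookup_sum lookup_single when_def not_in_keys_iff_lookup_eq_zero)
  moreover have "P (\<Sum>k\<in>A. Poly_Mapping.single k (Poly_Mapping.lookup p k))" for A
    by (induction A rule: infinite_finite_induct) (simp_all add: assms)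
  ultimately show ?thesis by metis
qed

lemma letters_0 [simp]: "letters 0 = []"
  by (simp add: zero_word_def)

locale central_hom =
  fixes \<iota> :: "'k::field \<Rightarrow> 't::ring_1" and x :: "'g \<Rightarrow> 't"
  assumes \<iota>_add: "\<iota> (a + b) = \<iota> a + \<iota> b" and \<iota>_mult: "\<iota> (a * b) = \<iota> a * \<iota> b"
    and \<iota>_1: "\<iota> 1 = 1" and \<iota>_central: "\<iota> a * u = u * \<iota> a"
begin

lemma \<iota>_0: "\<iota> 0 = 0"
  using \<iota>_add [of 0 0] by simp

lemma free_eval_single: "free_eval \<iota> x (Poly_Mapping.single w c) = \<iota> c * prod_list (map x (letters w))"
  by (cases "c = 0") (simp_all add: free_eval_def \<iota>_0)

lemma free_eval_0: "free_eval \<iota> x 0 = 0"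
  by (simp add: free_eval_def)

lemma free_eval_add: "free_eval \<iota> x (p + q) = free_eval \<iota> x p + free_eval \<iota> x q"
  unfolding free_eval_def
  by (rule setsum_keys_plus_distrib) (simp_all add: \<iota>_0 \<iota>_add distrib_right)

lemma free_eval_mult: "free_eval \<iota> x (p * q) = free_eval \<iota> x p * free_eval \<iota> x q"
proof (induction p rule: poly_mapping_single_induct)
  case (single u a)
  show ?case
  proof (induction q rule: poly_mapping_single_induct)
    case (single v b)
    show ?case
      unfolding mult_single free_eval_single
      by (simp add: plus_word_def \<iota>_mult) (metis \<iota>_central mult.assoc)
  qed (simp_all add: free_eval_0 free_eval_add distrib_left)
qed (simp_all add: free_eval_0 free_eval_add distrib_right)

lemma free_eval_1: "free_eval \<iota> x 1 = 1"
  using free_eval_single [of 0 1] by (simp add: \<iota>_1 letters_0)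

lemma free_eval_const: "free_eval \<iota> x (free_const c) = \<iota> c"
  by (simp add: free_const_def free_eval_single zero_word_def)

lemma free_eval_gen: "free_eval \<iota> x (free_gen g) = x g"
  by (simp add: free_gen_def free_eval_single \<iota>_1)

lemma free_eval_uminus: "free_eval \<iota> x (- p) = - free_eval \<iota> x p"
  using free_eval_add [of "- p" p] by (simp add: free_eval_0 eq_neg_iff_add_eq_0)

lemma free_eval_diff: "free_eval \<iota> x (p - q) = free_eval \<iota> x p - free_eval \<iota> x q"
  using free_eval_add [of p "- q"] by (simp add: free_eval_uminus)

lemmas free_eval_simps = free_eval_0 free_eval_1 free_eval_add free_eval_mult free_eval_const
  free_eval_gen free_eval_uminus free_eval_diff

end

lemma free_const_0 [simp]: "free_const 0 = 0"
  by (simp add: free_const_def)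

lemma free_const_1 [simp]: "free_const 1 = 1"
  by (simp add: free_const_def)

lemma free_const_add: "free_const (a + b) = free_const a + free_const b"
  by (simp add: free_const_def single_add)

lemma free_const_mult: "free_const (a * b) = free_const a * free_const b"
  by (simp add: free_const_def mult_single)

lemma free_const_central: "free_const c * p = p * free_const c"
  by (induction p rule: poly_mapping_single_induct)
     (simp_all add: free_const_def mult_single distrib_left distrib_right mult.commute)

lemma free_algebra_induct [case_names 1 add const gen]:
  fixes p :: "'g word \<Rightarrow>\<^sub>0 'k::field"
  assumes one: "P 1" and add: "\<And>p q. P p \<Longrightarrow> P q \<Longrightarrow> P (p + q)"
    and const: "\<And>c p. P p \<Longrightarrow> P (free_const c * p)" and gen: "\<And>g p. P p \<Longrightarrow> P (free_gen g * p)"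
  shows "P p"
proof (induction p rule: poly_mapping_single_induct)
  case 0
  show ?case using const [OF one, of 0] by simp
next
  case (single w c)
  have "P (Poly_Mapping.single (Word l) 1)" for l :: "'g list"
  proof (induction l)
    case Nil
    then show ?case using one by (simp flip: zero_word_def)
  next
    case (Cons g l)
    have "Poly_Mapping.single (Word (g # l)) (1 :: 'k) = free_gen g * Poly_Mapping.single (Word l) 1"
      by (simp add: free_gen_def mult_single plus_word_def)
    then show ?case using gen [OF Cons.IH] by simp
  qed
  from const [OF this [of "letters w"], of c] show ?case
    by (simp add: free_const_def mult_single)
qed (rule add)

definition congruent_mod :: "('g word \<Rightarrow>\<^sub>0 'k::field) set \<Rightarrow> ('g word \<Rightarrow>\<^sub>0 'k) \<Rightarrow> ('g word \<Rightarrow>\<^sub>0 'k) \<Rightarrow> bool" where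
  "congruent_mod E a b \<longleftrightarrow> a - b \<in> relation_ideal E"

lemma congruent_mod_refl [simp]: "congruent_mod E a a"
  by (simp add: congruent_mod_def relation_ideal_closed)

lemma congruent_mod_sym: "congruent_mod E a b \<Longrightarrow> congruent_mod E b a"
  using relation_ideal_closed(3) [OF relation_ideal_closed(1)] unfolding congruent_mod_def
  by fastforce

lemma congruent_mod_trans [trans]:
  "congruent_mod E a b \<Longrightarrow> congruent_mod E b c \<Longrightarrow> congruent_mod E a c"
  using relation_ideal_closed(2) [of "a - b" E "b - c"] unfolding congruent_mod_def by simp

lemma congruent_mod_eq_trans [trans]:
  "congruent_mod E a b \<Longrightarrow> b = c \<Longrightarrow> congruent_mod E a c"
  "a = b \<Longrightarrow> congruent_mod E b c \<Longrightarrow> congruent_mod E a c"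
  by simp_all

lemma congruent_mod_add:
  "congruent_mod E a b \<Longrightarrow> congruent_mod E c d \<Longrightarrow> congruent_mod E (a + c) (b + d)"
  using relation_ideal_closed(2) [of "a - b" E "c - d"] unfolding congruent_mod_def
  by (simp add: algebra_simps)

lemma congruent_mod_diff:
  "congruent_mod E a b \<Longrightarrow> congruent_mod E c d \<Longrightarrow> congruent_mod E (a - c) (b - d)"
  using relation_ideal_closed(3) [of "a - b" E "c - d"] unfolding congruent_mod_def
  by (simp add: algebra_simps)

lemma congruent_mod_left: "congruent_mod E a b \<Longrightarrow> congruent_mod E (p * a) (p * b)"
  using relation_ideal_closed(4) [of "a - b" E p] unfolding congruent_mod_def
  by (simp add: algebra_simps)

lemma congruent_mod_right: "congruent_mod E a b \<Longrightarrow> congruent_mod E (a * p) (b * p)"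
  using relation_ideal_closed(5) [of "a - b" E p] unfolding congruent_mod_def
  by (simp add: algebra_simps)

lemma normal_forms_exhaust:
  assumes one: "1 \<in> V" and add: "\<And>u v. u \<in> V \<Longrightarrow> v \<in> V \<Longrightarrow> u + v \<in> V"
    and const: "\<And>c v. v \<in> V \<Longrightarrow> free_const c * v \<in> V"
    and gen: "\<And>g v. v \<in> V \<Longrightarrow> \<exists>v'\<in>V. congruent_mod E (free_gen g * v) v'"
  shows "\<exists>v\<in>V. congruent_mod E p v"
proof (induction p rule: free_algebra_induct)
  case 1
  then show ?case using one congruent_mod_refl by blast
next
  case (add p q)
  then show ?case using assms(2) congruent_mod_add by blast
next
  case (const c p)
  then show ?case using assms(3) congruent_mod_left by blast
next
  case (gen g p)
  then obtain v where v: "v \<in> V" "congruent_mod E p v" by blast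
  then show ?case using assms(4) [OF v(1), of g] congruent_mod_left congruent_mod_trans by blast
qed

definition poly_at :: "('g word \<Rightarrow>\<^sub>0 'k) \<Rightarrow> 'k poly \<Rightarrow> 'g word \<Rightarrow>\<^sub>0 'k::field" where
  "poly_at z p = fold_coeffs (\<lambda>a r. free_const a + z * r) p 0"

definition poly_poly_at ::
    "('g word \<Rightarrow>\<^sub>0 'k) \<Rightarrow> ('g word \<Rightarrow>\<^sub>0 'k) \<Rightarrow> 'k poly poly \<Rightarrow> 'g word \<Rightarrow>\<^sub>0 'k::field" where
  "poly_poly_at z w P = fold_coeffs (\<lambda>p r. poly_at z p + r * w) P 0"

lemma poly_at_0 [simp]: "poly_at z 0 = 0"
  by (simp add: poly_at_def)

lemma poly_at_pCons [simp]: "poly_at z (pCons a p) = free_const a + z * poly_at z p"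
  by (cases "a = 0 \<and> p = 0") (auto simp: poly_at_def)

lemma poly_poly_at_0 [simp]: "poly_poly_at z w 0 = 0"
  by (simp add: poly_poly_at_def)

lemma poly_poly_at_pCons [simp]:
  "poly_poly_at z w (pCons p P) = poly_at z p + poly_poly_at z w P * w"
  by (cases "p = 0 \<and> P = 0") (auto simp: poly_poly_at_def)

lemma poly_at_add: "poly_at z (p + q) = poly_at z p + poly_at z q"
  by (induction p q rule: poly_induct2) (simp_all add: free_const_add distrib_left add_ac)

lemma poly_poly_at_add: "poly_poly_at z w (P + Q) = poly_poly_at z w P + poly_poly_at z w Q"
  by (induction P Q rule: poly_induct2) (simp_all add: poly_at_add distrib_right add_ac)

lemma poly_at_smult: "poly_at z (smult c p) = free_const c * poly_at z p"
  by (induction p)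
     (simp_all add: free_const_mult distrib_left, metis free_const_central mult.assoc)

lemma poly_poly_at_smult_const:
  "poly_poly_at z w (smult [:c:] P) = free_const c * poly_poly_at z w P"
  by (induction P) (simp_all add: poly_at_smult distrib_left mult.assoc)

lemma poly_poly_at_smult_var: "poly_poly_at z w (smult [:0, 1:] P) = z * poly_poly_at z w P"
  by (induction P) (simp_all add: distrib_left mult.assoc)

lemma poly_poly_at_uminus: "poly_poly_at z w (- P) = - poly_poly_at z w P"
  using poly_poly_at_add [of z w "- P" P] by (simp add: eq_neg_iff_add_eq_0)

section \<open>The presentation of the Weyl algebra\<close>

lemma weyl_c_1 [simp]: "weyl_c 1 = 1"
  by (simp add: pCons_one)

lemma weyl_algebra_iso:
  obtains g :: "'k::field weyl_elt \<Rightarrow> 'k weyl" where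
    "g \<in> ring_hom weyl_algebra ring_of_type_algebra"
    "bij_betw g (carrier weyl_algebra) UNIV" "\<And>c. g (weyl_const c) = weyl_c c"
proof -
  define x where "x = (\<lambda>i. case i of Weyl_D \<Rightarrow> weyl_d | Weyl_T \<Rightarrow> (weyl_t :: 'k weyl))"
  have x: "x Weyl_D = weyl_d" "x Weyl_T = weyl_t" by (simp_all add: x_def)
  interpret central_hom weyl_c x
    by unfold_locales (simp_all add: weyl_c_central flip: weyl_p_add weyl_p_mult)
  let ?E = "weyl_relations :: (weyl_gen word \<Rightarrow>\<^sub>0 'k) set"
  let ?t = "free_gen Weyl_T :: weyl_gen word \<Rightarrow>\<^sub>0 'k"
  let ?d = "free_gen Weyl_D :: weyl_gen word \<Rightarrow>\<^sub>0 'k"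
  note cong = congruent_mod_add congruent_mod_left congruent_mod_right
  have dt: "congruent_mod ?E (?d * ?t) (?t * ?d + 1)"
  proof -
    have "?d * ?t - ?t * ?d - 1 \<in> ?E" by (simp add: weyl_relations_def Let_def)
    from relation_ideal_closed(6) [OF this] show ?thesis
      by (simp add: congruent_mod_def diff_diff_eq)
  qed
  have d_poly: "congruent_mod ?E (?d * poly_at ?t p) (poly_at ?t p * ?d + poly_at ?t (pderiv p))" for p
  proof (induction p)
    case 0
    then show ?case by simp
  next
    case (pCons a p)
    have "?d * poly_at ?t (pCons a p) = free_const a * ?d + ?d * ?t * poly_at ?t p"
      by (simp add: distrib_left free_const_central mult.assoc)
    also have "congruent_mod ?E \<dots> (free_const a * ?d + (?t * ?d + 1) * poly_at ?t p)"
      by (intro cong dt congruent_mod_refl)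
    also have "\<dots> = free_const a * ?d + poly_at ?t p + ?t * (?d * poly_at ?t p)"
      by (simp add: distrib_right mult.assoc)
    also have "congruent_mod ?E \<dots> (free_const a * ?d + poly_at ?t p
        + ?t * (poly_at ?t p * ?d + poly_at ?t (pderiv p)))"
      by (intro cong pCons.IH congruent_mod_refl)
    also have "\<dots> = poly_at ?t (pCons a p) * ?d + poly_at ?t (pderiv (pCons a p))"
      by (simp add: pderiv_pCons poly_at_add algebra_simps)
    finally show ?case .
  qed
  let ?N = "poly_poly_at ?t ?d"
  have d_N: "congruent_mod ?E (?d * ?N P) (?N (weyl_deriv P))" for P
  proof (induction P)
    case 0
    then show ?case by simp
  next
    case (pCons p P)
    have "?d * ?N (pCons p P) = ?d * poly_at ?t p + ?d * ?N P * ?d"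
      by (simp add: distrib_left mult.assoc)
    also have "congruent_mod ?E \<dots> (poly_at ?t p * ?d + poly_at ?t (pderiv p) + ?N (weyl_deriv P) * ?d)"
      by (intro cong d_poly pCons.IH)
    also have "\<dots> = ?N (weyl_deriv (pCons p P))"
      by (simp add: weyl_deriv_pCons poly_poly_at_add algebra_simps)
    finally show ?case .
  qed
  have N: "\<exists>P. congruent_mod ?E a (?N P)" for a
  proof -
    have "\<exists>v\<in>range ?N. congruent_mod ?E a v"
    proof (rule normal_forms_exhaust)
      have "?N 1 = 1" by (simp add: one_pCons)
      then show "1 \<in> range ?N" by (metis rangeI)
      show "u + v \<in> range ?N" if "u \<in> range ?N" "v \<in> range ?N" for u v
        using that by (auto simp flip: poly_poly_at_add)
      show "free_const c * v \<in> range ?N" if "v \<in> range ?N" for c v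
        using that by (auto simp flip: poly_poly_at_smult_const)
      show "\<exists>v'\<in>range ?N. congruent_mod ?E (free_gen g * v) v'" if "v \<in> range ?N" for g v
      proof (cases g)
        case Weyl_D
        with that d_N show ?thesis by blast
      next
        case Weyl_T
        with that obtain P where "free_gen g * v = ?N (smult [:0, 1:] P)"
          by (auto simp: poly_poly_at_smult_var)
        then show ?thesis by (metis congruent_mod_refl rangeI)
      qed
    qed
    then show ?thesis by blast
  qed
  let ?f = "free_eval weyl_c x"
  have poly: "?f (poly_at ?t p) = weyl_p p" for p
  proof (induction p)
    case (pCons a p)
    have "weyl_p (pCons a p) = weyl_c a + weyl_t * weyl_p p"
      by (simp flip: weyl_p_add weyl_p_mult)
    then show ?case using pCons.IH by (simp add: free_eval_simps x)
  qed (simp add: free_eval_0)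
  have f_N: "?f (?N P) = Weyl P" for P
    by (induction P) (simp_all add: free_eval_simps poly x Weyl_pCons flip: zero_weyl_def)
  have rel: "?f e = 0" if "e \<in> ?E" for e
    using that by (auto simp: weyl_relations_def Let_def free_eval_simps x weyl_d_p pderiv_pCons)
  have inj: "a \<in> relation_ideal ?E" if a: "?f a = 0" for a
  proof -
    obtain P where P: "congruent_mod ?E a (?N P)" using N by blast
    have "?f (a - ?N P) = 0"
      using vanishes_on_relation_ideal [of ?f ?E, OF free_eval_add free_eval_mult rel]
        P [unfolded congruent_mod_def] by blast
    then have "Weyl P = 0" using a unfolding free_eval_diff f_N by simp
    then have "P = 0" unfolding zero_weyl_def Weyl_eq_iff .
    with P show ?thesis by (simp add: congruent_mod_def)
  qed
  obtain g where g: "g \<in> ring_hom (presented_algebra ?E) ring_of_type_algebra"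
    "inj_on g (carrier (presented_algebra ?E))" "\<And>a. g (presented_class ?E a) = ?f a"
    by (rule presented_algebra_hom [of ?f ?E, OF free_eval_add free_eval_mult free_eval_1 rel inj])
       (assumption+, rule that)
  have "w \<in> g ` carrier (presented_algebra ?E)" for w
  proof -
    have "w = g (presented_class ?E (?N (weyl_poly w)))" by (simp add: g f_N)
    then show ?thesis by (simp add: carrier_presented_algebra)
  qed
  then have "bij_betw g (carrier weyl_algebra) UNIV"
    using g(2) unfolding bij_betw_def weyl_algebra_def by blast
  then show thesis
    using g by (intro that [of g]) (simp_all add: weyl_algebra_def weyl_const_def free_eval_const)
qed

section \<open>Two by two matrices\<close>

datatype 'a mat2 = Mat2 (m11: 'a) (m12: 'a) (m21: 'a) (m22: 'a)

instantiation mat2 :: (ring_1) ring_1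
begin

definition "0 = Mat2 0 0 0 0"
definition "1 = Mat2 1 0 0 1"
definition "A + B = Mat2 (m11 A + m11 B) (m12 A + m12 B) (m21 A + m21 B) (m22 A + m22 B)"
definition "A - B = Mat2 (m11 A - m11 B) (m12 A - m12 B) (m21 A - m21 B) (m22 A - m22 B)"
definition "- A = Mat2 (- m11 A) (- m12 A) (- m21 A) (- m22 A)"
definition "A * B = Mat2 (m11 A * m11 B + m12 A * m21 B) (m11 A * m12 B + m12 A * m22 B)
  (m21 A * m11 B + m22 A * m21 B) (m21 A * m12 B + m22 A * m22 B)"

instance
  by standard (auto simp: zero_mat2_def one_mat2_def plus_mat2_def minus_mat2_def uminus_mat2_def
      times_mat2_def algebra_simps)

end

lemma Mat2_simps [simp]:
  "Mat2 a b c d + Mat2 a' b' c' d' = Mat2 (a + a') (b + b') (c + c') (d + d')"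
  "Mat2 a b c d - Mat2 a' b' c' d' = Mat2 (a - a') (b - b') (c - c') (d - d')"
  "- Mat2 a b c d = Mat2 (- a) (- b) (- c) (- d)"
  "Mat2 a b c d * Mat2 a' b' c' d' =
     Mat2 (a * a' + b * c') (a * b' + b * d') (c * a' + d * c') (c * b' + d * d')"
  "Mat2 a b c d = 0 \<longleftrightarrow> a = 0 \<and> b = 0 \<and> c = 0 \<and> d = 0"
  "0 = Mat2 a b c d \<longleftrightarrow> a = 0 \<and> b = 0 \<and> c = 0 \<and> d = 0"
  "Mat2 a b c d = 1 \<longleftrightarrow> a = 1 \<and> b = 0 \<and> c = 0 \<and> d = 1"
  by (auto simp: plus_mat2_def minus_mat2_def uminus_mat2_def times_mat2_def zero_mat2_def
      one_mat2_def)

abbreviation scalar2 :: "'a::ring_1 \<Rightarrow> 'a mat2" where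
  "scalar2 a \<equiv> Mat2 a 0 0 a"

section \<open>The super Jordan plane inside the matrices over the Weyl algebra\<close>

definition jordan_gen_mat :: "jordan_gen \<Rightarrow> 'k::field weyl mat2" where
  "jordan_gen_mat g = (case g of Jordan_X \<Rightarrow> Mat2 0 1 0 0 | Jordan_Y \<Rightarrow> Mat2 0 (weyl_t * weyl_d) weyl_t 0)"

lemma weyl_d_t: "weyl_d * weyl_t = weyl_t * weyl_d + 1"
  by (simp add: weyl_d_p pderiv_pCons)

interpretation jordan: central_hom "\<lambda>c. scalar2 (weyl_c c)" "jordan_gen_mat :: _ \<Rightarrow> 'k::field weyl mat2"
proof
  fix a :: 'k and u :: "'k weyl mat2"
  show "scalar2 (weyl_c a) * u = u * scalar2 (weyl_c a)"
    by (cases u) (simp add: weyl_c_central)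
qed (simp_all flip: weyl_p_add weyl_p_mult)

definition jordan_eval :: "(jordan_gen word \<Rightarrow>\<^sub>0 'k::field) \<Rightarrow> 'k weyl mat2" where
  "jordan_eval = free_eval (\<lambda>c. scalar2 (weyl_c c)) jordan_gen_mat"

lemmas jordan_eval_simps = jordan.free_eval_simps [folded jordan_eval_def]

context
begin

private abbreviation (input) gx :: "jordan_gen word \<Rightarrow>\<^sub>0 'k::field" where "gx \<equiv> free_gen Jordan_X"
private abbreviation (input) gy :: "jordan_gen word \<Rightarrow>\<^sub>0 'k::field" where "gy \<equiv> free_gen Jordan_Y"
private abbreviation (input) gs :: "jordan_gen word \<Rightarrow>\<^sub>0 'k::field" where "gs \<equiv> gx * gy + gy * gx"

private abbreviation cong :: "(jordan_gen word \<Rightarrow>\<^sub>0 'k::field) \<Rightarrow> _ \<Rightarrow> bool" (infix "\<sim>" 50) where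
  "a \<sim> b \<equiv> congruent_mod jordan_relations a b"

lemma jordan_relations_vanish: "e \<in> jordan_relations \<Longrightarrow> jordan_eval e = 0"
proof -
  have *: "weyl_t * (weyl_d * weyl_t) = weyl_t * (weyl_t * weyl_d) + (weyl_t :: 'a weyl)"
    by (simp add: weyl_d_t distrib_left)
  show "e \<in> jordan_relations \<Longrightarrow> jordan_eval e = (0 :: 'a weyl mat2)"
    by (auto simp: jordan_relations_def Let_def jordan_eval_simps jordan_gen_mat_def mult.assoc * )
qed

lemma jordan_relation_x: "gx * gx \<sim> 0"
  using relation_ideal_closed(6) [of "gx * gx" jordan_relations]
  by (simp add: congruent_mod_def jordan_relations_def Let_def)

lemma jordan_relation_y: "gy * gy * gx \<sim> gx * gy * gy + gx * gy * gx"
  using relation_ideal_closed(6) [of "gy * gy * gx - gx * gy * gy - gx * gy * gx" jordan_relations]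
  by (simp add: congruent_mod_def jordan_relations_def Let_def diff_diff_eq)

lemma jordan_x_s: "gx * gs \<sim> gs * gx"
proof -
  have "gx * gs = gx * gx * gy + gx * gy * gx" by (simp add: algebra_simps)
  also have "\<dots> \<sim> 0 * gy + gx * gy * gx"
    by (intro congruent_mod_add congruent_mod_right jordan_relation_x congruent_mod_refl)
  also have "\<dots> = gx * gy * gx + gy * 0" by simp
  also have "\<dots> \<sim> gx * gy * gx + gy * (gx * gx)"
    by (intro congruent_mod_add congruent_mod_left congruent_mod_sym [OF jordan_relation_x]
        congruent_mod_refl)
  also have "\<dots> = gs * gx" by (simp add: algebra_simps)
  finally show ?thesis .
qed

lemma jordan_y_s: "gy * gs \<sim> gs * gy + gx * gs"
proof -
  have "gy * gs = gy * gx * gy + gy * gy * gx" by (simp add: algebra_simps)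
  also have "\<dots> \<sim> gy * gx * gy + (gx * gy * gy + gx * gy * gx)"
    by (intro congruent_mod_add jordan_relation_y congruent_mod_refl)
  also have "\<dots> = gs * gy + gx * gy * gx + 0 * gy" by (simp add: algebra_simps)
  also have "\<dots> \<sim> gs * gy + gx * gy * gx + gx * gx * gy"
    by (intro congruent_mod_add congruent_mod_right congruent_mod_sym [OF jordan_relation_x]
        congruent_mod_refl)
  also have "\<dots> = gs * gy + gx * gs" by (simp add: algebra_simps)
  finally show ?thesis .
qed

lemma jordan_y_poly: "gy * poly_at gs p \<sim> poly_at gs p * gy + gx * poly_at gs (pCons 0 (pderiv p))"
proof (induction p)
  case 0
  then show ?case by simp
next
  case (pCons a p)
  let ?p = "poly_at gs p" and ?p' = "poly_at gs (pCons 0 (pderiv p))"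
  have "gy * poly_at gs (pCons a p) = free_const a * gy + gy * gs * ?p"
    by (simp add: free_const_central [of a gy] algebra_simps)
  also have "\<dots> \<sim> free_const a * gy + (gs * gy + gx * gs) * ?p"
    by (intro congruent_mod_add congruent_mod_right jordan_y_s congruent_mod_refl)
  also have "\<dots> = free_const a * gy + gx * gs * ?p + gs * (gy * ?p)"
    by (simp add: algebra_simps)
  also have "\<dots> \<sim> free_const a * gy + gx * gs * ?p + gs * (?p * gy + gx * ?p')"
    by (intro congruent_mod_add congruent_mod_left pCons.IH congruent_mod_refl)
  also have "\<dots> = poly_at gs (pCons a p) * gy + gx * gs * ?p + gs * gx * ?p'"
    by (simp add: algebra_simps)
  also have "\<dots> \<sim> poly_at gs (pCons a p) * gy + gx * gs * ?p + gx * gs * ?p'"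
    by (intro congruent_mod_add congruent_mod_right congruent_mod_sym [OF jordan_x_s] congruent_mod_refl)
  also have "\<dots> = poly_at gs (pCons a p) * gy + gx * poly_at gs (pCons 0 (pderiv (pCons a p)))"
    by (simp add: pderiv_pCons poly_at_add algebra_simps)
  finally show ?case .
qed

lemma jordan_y_normal:
  "\<exists>A B. gy * poly_poly_at gs gy P \<sim> poly_poly_at gs gy A + gx * poly_poly_at gs gy B"
proof (induction P)
  case 0
  have "gy * poly_poly_at gs gy 0 = poly_poly_at gs gy 0 + gx * poly_poly_at gs gy 0" by simp
  then show ?case by (metis congruent_mod_refl)
next
  case (pCons p P)
  let ?N = "poly_poly_at gs gy" and ?p' = "pCons 0 (pderiv p)"
  from pCons.IH obtain A B where IH: "gy * ?N P \<sim> ?N A + gx * ?N B" by blast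
  have "gy * ?N (pCons p P) = gy * poly_at gs p + gy * ?N P * gy"
    by (simp add: distrib_left mult.assoc)
  also have "\<dots> \<sim> (poly_at gs p * gy + gx * poly_at gs ?p') + (?N A + gx * ?N B) * gy"
    by (intro congruent_mod_add congruent_mod_right IH jordan_y_poly)
  also have "\<dots> = ?N (pCons 0 (pCons p 0 + A)) + gx * ?N (pCons ?p' B)"
    by (simp add: poly_poly_at_add algebra_simps del: poly_at_pCons)
  finally show ?case by blast
qed

lemma jordan_normal_form:
  fixes p :: "jordan_gen word \<Rightarrow>\<^sub>0 'k::field"
  shows "\<exists>A B. p \<sim> poly_poly_at gs gy A + gx * poly_poly_at gs gy B"
proof -
  let ?N = "poly_poly_at gs gy :: 'k poly poly \<Rightarrow> _"
  define V where "V = {?N A + gx * ?N B | A B. True}"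
  have VI: "?N A + gx * ?N B \<in> V" for A B unfolding V_def by blast
  have "\<exists>v\<in>V. p \<sim> v"
  proof (rule normal_forms_exhaust)
    show "1 \<in> V" using VI [of 1 0] by (simp add: one_pCons)
  next
    fix u v assume "u \<in> V" "v \<in> V"
    then obtain A B A' B' where "u = ?N A + gx * ?N B" "v = ?N A' + gx * ?N B'"
      unfolding V_def by blast
    then have "u + v = ?N (A + A') + gx * ?N (B + B')"
      by (simp add: poly_poly_at_add distrib_left)
    then show "u + v \<in> V" using VI by simp
  next
    fix c v assume "v \<in> V"
    then obtain A B where "v = ?N A + gx * ?N B" unfolding V_def by blast
    moreover have "free_const c * (gx * ?N B) = gx * (free_const c * ?N B)"
      by (simp add: free_const_central [of c gx] flip: mult.assoc)
    ultimately have "free_const c * v = ?N (smult [:c:] A) + gx * ?N (smult [:c:] B)"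
      by (simp add: distrib_left poly_poly_at_smult_const)
    then show "free_const c * v \<in> V" using VI by simp
  next
    fix g v assume "v \<in> V"
    then obtain A B where v: "v = ?N A + gx * ?N B" unfolding V_def by blast
    show "\<exists>v'\<in>V. free_gen g * v \<sim> v'"
    proof (cases g)
      case Jordan_X
      have "gx * v = gx * ?N A + gx * gx * ?N B" by (simp add: v distrib_left mult.assoc)
      also have "\<dots> \<sim> gx * ?N A + 0 * ?N B"
        by (intro congruent_mod_add congruent_mod_right jordan_relation_x congruent_mod_refl)
      also have "\<dots> = ?N 0 + gx * ?N A" by simp
      finally show ?thesis using VI Jordan_X by blast
    next
      case Jordan_Y
      obtain C D where CD: "gy * ?N A \<sim> ?N C + gx * ?N D" using jordan_y_normal by blast
      obtain F G where FG: "gy * ?N B \<sim> ?N F + gx * ?N G" using jordan_y_normal by blast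
      have "gy * v = gy * ?N A + (gs * ?N B - gx * (gy * ?N B))"
        by (simp add: v algebra_simps)
      also have "\<dots> \<sim> (?N C + gx * ?N D) + (gs * ?N B - gx * (?N F + gx * ?N G))"
        by (intro congruent_mod_add congruent_mod_diff congruent_mod_left CD FG congruent_mod_refl)
      also have "\<dots> = ?N C + gx * ?N D + gs * ?N B - gx * ?N F - gx * gx * ?N G"
        by (simp add: algebra_simps)
      also have "\<dots> \<sim> ?N C + gx * ?N D + gs * ?N B - gx * ?N F - 0 * ?N G"
        by (intro congruent_mod_diff congruent_mod_right jordan_relation_x congruent_mod_refl)
      also have "\<dots> = ?N (C + smult [:0, 1:] B) + gx * ?N (D + - F)"
        unfolding poly_poly_at_add poly_poly_at_smult_var poly_poly_at_uminus
        by (simp add: right_diff_distrib)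
      finally show ?thesis using VI Jordan_Y by blast
    qed
  qed
  then show ?thesis unfolding V_def by blast
qed

lemma jordan_eval_s: "jordan_eval gs = scalar2 weyl_t"
  by (simp add: jordan_eval_simps jordan_gen_mat_def)

lemma jordan_eval_poly: "jordan_eval (poly_at gs p) = scalar2 (weyl_p p)"
proof (induction p)
  case (pCons a p)
  have "weyl_p (pCons a p) = weyl_c a + weyl_t * weyl_p p"
    by (simp flip: weyl_p_add weyl_p_mult)
  moreover have "jordan_eval (poly_at gs (pCons a p)) = scalar2 (weyl_c a) + jordan_eval gs * jordan_eval (poly_at gs p)"
    by (simp only: poly_at_pCons jordan_eval_simps)
  ultimately show ?case by (simp add: jordan_eval_s pCons.IH)
qed (simp add: jordan_eval_simps)

lemma jordan_normal_eval_row: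
  fixes P :: "'k::field poly poly"
  defines "A \<equiv> jordan_eval (poly_poly_at gs gy P)"
  assumes "m21 A = 0" "m22 A = 0"
  shows "P = 0"
  using assms(2,3) unfolding A_def
proof (induction P)
  case (pCons p P)
  let ?A = "jordan_eval (poly_poly_at gs gy P)"
  have eq: "jordan_eval (poly_poly_at gs gy (pCons p P))
      = scalar2 (weyl_p p) + ?A * Mat2 0 (weyl_t * weyl_d) weyl_t 0"
    by (simp add: jordan_eval_simps jordan_eval_poly jordan_gen_mat_def)
  have row: "m22 ?A * weyl_t = 0" "weyl_p p + m21 ?A * weyl_t * weyl_d = 0"
    using pCons.prems unfolding eq by (cases ?A; simp add: mult.assoc)+
  have "m21 ?A = 0"
  proof (rule ccontr)
    assume "m21 ?A \<noteq> 0"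
    then have "m21 ?A * weyl_t \<noteq> 0" by simp
    then have nz: "weyl_poly (m21 ?A * weyl_t) \<noteq> 0" by (simp only: weyl_poly_eq_0_iff not_False_eq_True)
    have "m21 ?A * weyl_t * weyl_d = - weyl_p p" using row(2)
      by (simp add: eq_neg_iff_add_eq_0 add.commute)
    moreover have "weyl_poly (u * weyl_d) = pCons 0 (weyl_poly u)" for u :: "'k weyl"
      using Weyl_pCons [of 0 "weyl_poly u"] by (metis add_0 weyl_p_0 weyl_poly_Weyl weyl_poly_inverse)
    ultimately have "pCons 0 (weyl_poly (m21 ?A * weyl_t)) = - [:p:]"
      by (metis weyl_p_def weyl_poly_Weyl weyl_poly_simps(5))
    with nz show False by (simp del: weyl_poly_simps)
  qed
  moreover from row have "m22 ?A = 0" by simp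
  ultimately show ?case using pCons.IH row(2) by simp
qed simp

lemma jordan_eval_0_iff:
  fixes p :: "jordan_gen word \<Rightarrow>\<^sub>0 'k::field"
  shows "jordan_eval p = 0 \<longleftrightarrow> p \<in> relation_ideal jordan_relations"
proof
  assume p: "jordan_eval p = 0"
  let ?N = "poly_poly_at gs gy :: 'k poly poly \<Rightarrow> _"
  obtain A B where AB: "p \<sim> ?N A + gx * ?N B" using jordan_normal_form by blast
  then have "jordan_eval (p - (?N A + gx * ?N B)) = 0"
    unfolding congruent_mod_def
    using vanishes_on_relation_ideal [of jordan_eval, OF jordan_eval_simps(3,4)
        jordan_relations_vanish] by blast
  then have eq: "jordan_eval (?N A) + Mat2 0 1 0 0 * jordan_eval (?N B) = 0"
    by (simp only: jordan_eval_simps p diff_0 neg_equal_0_iff_equal jordan_gen_mat_def jordan_gen.case)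
  then have "A = 0"
    by (intro jordan_normal_eval_row) (cases "jordan_eval (?N A)"; cases "jordan_eval (?N B)"; simp)+
  moreover from this have "B = 0"
    using eq by (intro jordan_normal_eval_row)
      (cases "jordan_eval (?N B)"; simp add: jordan_eval_simps)+
  ultimately show "p \<in> relation_ideal jordan_relations" using AB by (simp add: congruent_mod_def)
next
  assume "p \<in> relation_ideal jordan_relations"
  then show "jordan_eval p = 0"
    using vanishes_on_relation_ideal [of jordan_eval, OF jordan_eval_simps(3,4)
        jordan_relations_vanish] by blast
qed

end

lemma jordan_embedding:
  obtains \<rho> :: "'k::field jordan_elt \<Rightarrow> 'k weyl mat2" where
    "\<rho> \<in> ring_hom super_jordan ring_of_type_algebra" "inj_on \<rho> (carrier super_jordan)"
    "\<rho> jordan_x = Mat2 0 1 0 0" "\<rho> jordan_y = Mat2 0 (weyl_t * weyl_d) weyl_t 0"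
    "\<And>c. \<rho> (jordan_const c) = scalar2 (weyl_c c)"
    "\<rho> ` carrier super_jordan = range jordan_eval"
proof -
  obtain \<rho> :: "'k jordan_elt \<Rightarrow> 'k weyl mat2" where
    "\<rho> \<in> ring_hom (presented_algebra jordan_relations) ring_of_type_algebra"
    "inj_on \<rho> (carrier (presented_algebra jordan_relations))"
    "\<And>a. \<rho> (presented_class jordan_relations a) = jordan_eval a"
    by (rule presented_algebra_hom [of jordan_eval jordan_relations, OF jordan_eval_simps(3,4,2)
          jordan_relations_vanish jordan_eval_0_iff [THEN iffD1]]) (assumption+, rule that)
  then show thesis
    by (intro that [of \<rho>])
      (simp_all add: super_jordan_def jordan_x_def jordan_y_def jordan_const_def jordan_eval_simps
        jordan_gen_mat_def carrier_presented_algebra image_image)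
qed

section \<open>Denominators\<close>

abbreviation jordan_mats :: "'k::field weyl mat2 set" where
  "jordan_mats \<equiv> range jordan_eval"

lemma jordan_mats_closed:
  "1 \<in> jordan_mats" "A \<in> jordan_mats \<Longrightarrow> B \<in> jordan_mats \<Longrightarrow> A + B \<in> jordan_mats"
  "A \<in> jordan_mats \<Longrightarrow> B \<in> jordan_mats \<Longrightarrow> A - B \<in> jordan_mats"
  "A \<in> jordan_mats \<Longrightarrow> B \<in> jordan_mats \<Longrightarrow> A * B \<in> jordan_mats"
  by (auto simp flip: jordan_eval_simps)

lemma jordan_mats_scalar: "scalar2 (weyl_p p) \<in> jordan_mats"
  by (metis jordan_eval_poly rangeI)

lemma jordan_mats_t_power: "scalar2 (weyl_t ^ n) \<in> jordan_mats"
  using jordan_mats_scalar [of "[:0, 1:] ^ n"] by (simp add: weyl_p_power)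

lemma jordan_mats_x: "Mat2 0 1 0 0 \<in> jordan_mats"
  and jordan_mats_y: "Mat2 0 (weyl_t * weyl_d) weyl_t 0 \<in> jordan_mats"
proof -
  have "Mat2 0 1 0 0 = jordan_eval (free_gen Jordan_X)"
    "Mat2 0 (weyl_t * weyl_d) weyl_t 0 = jordan_eval (free_gen Jordan_Y)"
    by (simp_all add: jordan_eval_simps jordan_gen_mat_def)
  then show "Mat2 0 1 0 0 \<in> jordan_mats" "Mat2 0 (weyl_t * weyl_d) weyl_t 0 \<in> jordan_mats"
    by (metis rangeI)+
qed

lemma jordan_mats_units:
  "Mat2 weyl_t 0 0 0 \<in> jordan_mats" "Mat2 0 0 (weyl_t * weyl_t) 0 \<in> jordan_mats"
  "Mat2 (weyl_t * weyl_t * weyl_d * weyl_t * weyl_t) 0 0 0 \<in> jordan_mats"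
proof -
  let ?x = "Mat2 0 1 0 0" and ?y = "Mat2 0 (weyl_t * weyl_d) weyl_t 0"
  show "Mat2 weyl_t 0 0 0 \<in> jordan_mats"
    using jordan_mats_closed(4) [OF jordan_mats_x jordan_mats_y] by simp
  show "Mat2 0 0 (weyl_t * weyl_t) 0 \<in> jordan_mats"
    using jordan_mats_closed(4) [OF jordan_mats_closed(4) [OF jordan_mats_y jordan_mats_x] jordan_mats_y]
    by simp
  then show "Mat2 (weyl_t * weyl_t * weyl_d * weyl_t * weyl_t) 0 0 0 \<in> jordan_mats"
    using jordan_mats_closed(4) [OF jordan_mats_closed(4)
        [OF \<open>Mat2 weyl_t 0 0 0 \<in> jordan_mats\<close> jordan_mats_y]]
    by (fastforce simp: mult.assoc)
qed

lemma weyl_d_t_power: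
  "weyl_d * weyl_t ^ Suc n = weyl_t ^ Suc n * weyl_d + weyl_c (of_nat (Suc n)) * weyl_t ^ n"
  unfolding weyl_p_power [symmetric] weyl_d_p weyl_p_mult [symmetric]
  by (simp add: pderiv_power_Suc pderiv_pCons del: of_nat_Suc power_Suc)

lemma scalar2_commute_t_power: "scalar2 (weyl_t ^ n) * scalar2 (weyl_t ^ m) = scalar2 (weyl_t ^ (n + m))"
  by (simp add: power_add)

lemma left_denominator_11: "\<exists>n. Mat2 (weyl_t ^ n * a) 0 0 0 \<in> jordan_mats"
proof -
  define P where "P a \<longleftrightarrow> (\<exists>n. Mat2 (weyl_t ^ n * a) 0 0 0 \<in> jordan_mats)" for a :: "'a weyl"
  have shift: "Mat2 (weyl_t ^ (m + n) * a) 0 0 0 \<in> jordan_mats"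
    if "Mat2 (weyl_t ^ n * a) 0 0 0 \<in> jordan_mats" for m n and a :: "'a weyl"
    using jordan_mats_closed(4) [OF jordan_mats_t_power [of m] that] by (simp add: power_add mult.assoc)
  have "P 1" unfolding P_def using jordan_mats_units(1) by (auto intro!: exI [of _ 1])
  then have "P (a * 1)"
  proof (induction rule: weyl_induct_left)
    fix u v assume "P u" "P v"
    then obtain m n where mn: "Mat2 (weyl_t ^ m * u) 0 0 0 \<in> jordan_mats"
      "Mat2 (weyl_t ^ n * v) 0 0 0 \<in> jordan_mats" unfolding P_def by blast
    have "Mat2 (weyl_t ^ (n + m) * (u + v)) 0 0 0 \<in> jordan_mats"
      using jordan_mats_closed(2) [OF shift [OF mn(1), of n] shift [OF mn(2), of m]]
      by (simp add: distrib_left add.commute)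
    then show "P (u + v)" unfolding P_def by blast
  next
    fix c u assume "P u"
    then obtain n where n: "Mat2 (weyl_t ^ n * u) 0 0 0 \<in> jordan_mats" unfolding P_def by blast
    have "Mat2 (weyl_t ^ n * (weyl_c c * u)) 0 0 0 \<in> jordan_mats"
      using jordan_mats_closed(4) [OF jordan_mats_scalar [of "[:c:]"] n]
      by (simp add: weyl_c_central [of c "weyl_t ^ n"] flip: mult.assoc)
    then show "P (weyl_c c * u)" unfolding P_def by blast
  next
    fix u assume "P u"
    then obtain n where n: "Mat2 (weyl_t ^ n * u) 0 0 0 \<in> jordan_mats" unfolding P_def by blast
    have "Mat2 (weyl_t ^ n * (weyl_t * u)) 0 0 0 \<in> jordan_mats"
      using shift [OF n, of 1] by (simp add: power_commutes flip: mult.assoc)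
    then show "P (weyl_t * u)" unfolding P_def by blast
    let ?w = "weyl_t * weyl_t * weyl_d * weyl_t * weyl_t :: 'a weyl"
    let ?c = "weyl_c (of_nat (Suc (Suc n))) :: 'a weyl"
    have "weyl_t ^ (n + 4) * (weyl_d * u) = weyl_t * weyl_t * (weyl_t ^ Suc (Suc n) * weyl_d) * u"
      by (simp add: mult.assoc eval_nat_numeral)
    also have "weyl_t ^ Suc (Suc n) * weyl_d = weyl_d * weyl_t ^ Suc (Suc n) - ?c * weyl_t ^ Suc n"
      unfolding weyl_d_t_power by simp
    also have "weyl_t * weyl_t * (weyl_d * weyl_t ^ Suc (Suc n) - ?c * weyl_t ^ Suc n) * u
        = ?w * (weyl_t ^ n * u) - weyl_t * weyl_t * ?c * (weyl_t * weyl_t ^ n * u)"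
      by (simp add: right_diff_distrib left_diff_distrib mult.assoc del: of_nat_Suc)
    also have "weyl_t * weyl_t * ?c = ?c * (weyl_t * weyl_t)"
      by (rule weyl_c_central [symmetric])
    also have "?c * (weyl_t * weyl_t) * (weyl_t * weyl_t ^ n * u) = ?c * (weyl_t ^ 3 * (weyl_t ^ n * u))"
      by (simp add: mult.assoc eval_nat_numeral del: of_nat_Suc)
    finally have "Mat2 (weyl_t ^ (n + 4) * (weyl_d * u)) 0 0 0 =
        Mat2 ?w 0 0 0 * Mat2 (weyl_t ^ n * u) 0 0 0 -
        scalar2 (weyl_c (of_nat (Suc (Suc n)))) * (scalar2 (weyl_t ^ 3) * Mat2 (weyl_t ^ n * u) 0 0 0)"
      by simp
    also have "\<dots> \<in> jordan_mats"
      by (intro jordan_mats_closed(3,4) jordan_mats_units jordan_mats_scalar jordan_mats_t_power n)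
    finally show "P (weyl_d * u)" unfolding P_def by blast
  qed
  then show ?thesis by (simp add: P_def)
qed

lemma right_denominator_column:
  fixes C :: "'k::field weyl \<Rightarrow> 'k weyl mat2"
  assumes C_add: "\<And>u v. C (u + v) = C u + C v" and C_scalar: "\<And>u v. C (u * v) = C u * scalar2 v"
    and C_11: "\<And>u v. C (u * v) = C u * Mat2 v 0 0 0" and C_t: "C (weyl_t * weyl_t) \<in> jordan_mats"
  shows "\<exists>n. C (a * weyl_t ^ n) \<in> jordan_mats"
proof -
  define P where "P a \<longleftrightarrow> (\<exists>n. C (a * weyl_t ^ n) \<in> jordan_mats)" for a :: "'k weyl"
  have shift: "C (a * weyl_t ^ (n + m)) \<in> jordan_mats" if "C (a * weyl_t ^ n) \<in> jordan_mats" for m n a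
    using jordan_mats_closed(4) [OF that jordan_mats_t_power [of m]]
    unfolding C_scalar [symmetric] by (simp add: power_add mult.assoc)
  have C_diff: "C (u - v) = C u - C v" for u v
    using C_add [of "u - v" v] by (simp add: algebra_simps)
  have "P 1" unfolding P_def using C_t by (auto simp: power2_eq_square intro!: exI [of _ 2])
  then have "P (1 * a)"
  proof (induction rule: weyl_induct_right)
    fix u v assume "P u" "P v"
    then obtain m n where mn: "C (u * weyl_t ^ m) \<in> jordan_mats" "C (v * weyl_t ^ n) \<in> jordan_mats"
      unfolding P_def by blast
    have "C ((u + v) * weyl_t ^ (m + n)) \<in> jordan_mats"
      using jordan_mats_closed(2) [OF shift [OF mn(1), of n] shift [OF mn(2), of m]]
      by (simp add: distrib_right C_add add.commute)
    then show "P (u + v)" unfolding P_def by blast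
  next
    fix c u assume "P u"
    then obtain n where n: "C (u * weyl_t ^ n) \<in> jordan_mats" unfolding P_def by blast
    have "C (u * weyl_c c * weyl_t ^ n) = C (u * weyl_t ^ n) * scalar2 (weyl_c c)"
      unfolding C_scalar [symmetric] by (simp add: weyl_c_central [of c] mult.assoc)
    also have "\<dots> \<in> jordan_mats" by (intro jordan_mats_closed(4) n jordan_mats_scalar)
    finally show "P (u * weyl_c c)" unfolding P_def by blast
  next
    fix u assume "P u"
    then obtain n where n: "C (u * weyl_t ^ n) \<in> jordan_mats" unfolding P_def by blast
    have "C (u * weyl_t * weyl_t ^ n) \<in> jordan_mats"
      using shift [OF n, of 1] by (simp add: power_commutes mult.assoc)
    then show "P (u * weyl_t)" unfolding P_def by blast
    let ?w = "weyl_t * weyl_t * weyl_d * weyl_t * weyl_t :: 'k weyl"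
    let ?c = "weyl_c (of_nat (Suc (Suc n))) :: 'k weyl"
    have t4: "weyl_t ^ (n + 4) = weyl_t ^ Suc (Suc n) * (weyl_t * weyl_t :: 'k weyl)"
    proof -
      have "n + 4 = Suc (Suc n) + 2" by simp
      then show ?thesis by (simp only: power_add power2_eq_square)
    qed
    have t2: "weyl_t ^ Suc (Suc n) = weyl_t ^ n * (weyl_t * weyl_t :: 'k weyl)"
      using power_add [of "weyl_t :: 'k weyl" n 2] by (simp add: power2_eq_square del: power_Suc)
    have "u * weyl_d * weyl_t ^ (n + 4) = u * (weyl_d * weyl_t ^ Suc (Suc n)) * (weyl_t * weyl_t)"
      by (simp only: t4 mult.assoc)
    also have "\<dots> = u * (weyl_t ^ Suc (Suc n) * weyl_d) * (weyl_t * weyl_t)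
        + u * (?c * weyl_t ^ Suc n) * (weyl_t * weyl_t)"
      unfolding weyl_d_t_power by (simp only: distrib_left distrib_right)
    also have "u * (weyl_t ^ Suc (Suc n) * weyl_d) * (weyl_t * weyl_t) = u * weyl_t ^ n * ?w"
      by (simp only: t2 mult.assoc)
    also have "?c * weyl_t ^ Suc n = weyl_t ^ n * (weyl_t * ?c)"
      by (subst weyl_c_central) (simp only: power_Suc2 mult.assoc)
    finally have "C (u * weyl_d * weyl_t ^ (n + 4)) = C (u * weyl_t ^ n) * Mat2 ?w 0 0 0
        + C (u * weyl_t ^ n) * scalar2 (weyl_t ^ 1) * scalar2 ?c * scalar2 (weyl_t ^ 1) * scalar2 (weyl_t ^ 1)"
      unfolding C_11 [symmetric] C_scalar [symmetric]
      by (simp add: C_add mult.assoc del: of_nat_Suc)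
    also have "\<dots> \<in> jordan_mats"
      by (intro jordan_mats_closed(2,4) jordan_mats_units jordan_mats_scalar jordan_mats_t_power n)
    finally show "P (u * weyl_d)" unfolding P_def by blast
  qed
  then show ?thesis by (simp add: P_def)
qed

lemma left_denominator: "\<exists>n. scalar2 (weyl_t ^ n) * A \<in> jordan_mats"
proof -
  define P where "P A \<longleftrightarrow> (\<exists>n. scalar2 (weyl_t ^ n) * A \<in> jordan_mats)" for A :: "'a weyl mat2"
  have add: "P (A + B)" if "P A" "P B" for A B
  proof -
    from that obtain m n where mn: "scalar2 (weyl_t ^ m) * A \<in> jordan_mats" "scalar2 (weyl_t ^ n) * B \<in> jordan_mats"
      unfolding P_def by blast
    have "scalar2 (weyl_t ^ n) * (scalar2 (weyl_t ^ m) * A)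
        + scalar2 (weyl_t ^ m) * (scalar2 (weyl_t ^ n) * B) \<in> jordan_mats"
      by (rule jordan_mats_closed(2)
          [OF jordan_mats_closed(4) [OF jordan_mats_t_power mn(1)] jordan_mats_closed(4) [OF jordan_mats_t_power mn(2)]])
    then have "scalar2 (weyl_t ^ (m + n)) * (A + B) \<in> jordan_mats"
      unfolding mult.assoc [symmetric] scalar2_commute_t_power
      by (simp add: distrib_left add.commute)
    then show ?thesis unfolding P_def by blast
  qed
  have P11: "P (Mat2 a 0 0 0)" for a
    using left_denominator_11 [of a] by (simp add: P_def)
  have P12: "P (A * Mat2 0 1 0 0)" if "P A" for A
    using that jordan_mats_closed(4) [OF _ jordan_mats_x] unfolding P_def mult.assoc [symmetric] by blast
  have P21: "P (Mat2 0 0 a 0)" for a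
  proof -
    obtain n where "Mat2 (weyl_t ^ n * a) 0 0 0 \<in> jordan_mats" using left_denominator_11 by blast
    from jordan_mats_closed(4) [OF jordan_mats_units(2) this]
    have "scalar2 (weyl_t ^ (2 + n)) * Mat2 0 0 a 0 \<in> jordan_mats" by (simp add: mult.assoc)
    then show ?thesis unfolding P_def by blast
  qed
  have "P (Mat2 a b c d)" for a b c d
    using add [OF add [OF P11 [of a] P12 [OF P11 [of b]]] add [OF P21 [of c] P12 [OF P21 [of d]]]]
    by simp
  then show ?thesis unfolding P_def by (metis mat2.exhaust)
qed

lemma right_denominator: "\<exists>n. A * scalar2 (weyl_t ^ n) \<in> jordan_mats"
proof -
  define P where "P A \<longleftrightarrow> (\<exists>n. A * scalar2 (weyl_t ^ n) \<in> jordan_mats)" for A :: "'a weyl mat2"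
  have add: "P (A + B)" if "P A" "P B" for A B
  proof -
    from that obtain m n where mn: "A * scalar2 (weyl_t ^ m) \<in> jordan_mats" "B * scalar2 (weyl_t ^ n) \<in> jordan_mats"
      unfolding P_def by blast
    have "A * scalar2 (weyl_t ^ m) * scalar2 (weyl_t ^ n)
        + B * scalar2 (weyl_t ^ n) * scalar2 (weyl_t ^ m) \<in> jordan_mats"
      by (rule jordan_mats_closed(2)
          [OF jordan_mats_closed(4) [OF mn(1) jordan_mats_t_power] jordan_mats_closed(4) [OF mn(2) jordan_mats_t_power]])
    then have "(A + B) * scalar2 (weyl_t ^ (m + n)) \<in> jordan_mats"
      unfolding mult.assoc scalar2_commute_t_power
      by (simp add: distrib_right add.commute)
    then show ?thesis unfolding P_def by blast
  qed
  have P11: "P (Mat2 a 0 0 0)" for a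
  proof -
    have "Mat2 (weyl_t * weyl_t) 0 0 0 \<in> (jordan_mats :: 'a weyl mat2 set)"
      using jordan_mats_closed(4) [OF jordan_mats_units(1) jordan_mats_units(1)] by simp
    then have "\<exists>n. Mat2 (a * weyl_t ^ n) 0 0 0 \<in> jordan_mats"
      by (rule right_denominator_column [of "\<lambda>v. Mat2 v 0 0 0", rotated 3]) simp_all
    then show ?thesis unfolding P_def by simp
  qed
  have P21: "P (Mat2 0 0 a 0)" for a
  proof -
    have "\<exists>n. Mat2 0 0 (a * weyl_t ^ n) 0 \<in> jordan_mats"
      by (rule right_denominator_column [of "\<lambda>v. Mat2 0 0 v 0", OF _ _ _ jordan_mats_units(2)]) simp_all
    then show ?thesis unfolding P_def by simp
  qed
  have P12: "P (A * Mat2 0 1 0 0)" if "P A" for A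
  proof -
    from that obtain n where "A * scalar2 (weyl_t ^ n) \<in> jordan_mats" unfolding P_def by blast
    from jordan_mats_closed(4) [OF this jordan_mats_x]
    have "A * Mat2 0 1 0 0 * scalar2 (weyl_t ^ n) \<in> jordan_mats" by (simp add: mult.assoc)
    then show ?thesis unfolding P_def by blast
  qed
  have "P (Mat2 a b c d)" for a b c d
    using add [OF add [OF P11 [of a] P12 [OF P11 [of b]]] add [OF P21 [of c] P12 [OF P21 [of d]]]]
    by simp
  then show ?thesis unfolding P_def by (metis mat2.exhaust)
qed

lemma jordan_mats_normal:
  assumes "A \<in> jordan_mats"
  shows "\<exists>B\<in>jordan_mats. A * scalar2 (weyl_t ^ n) = scalar2 (weyl_t ^ n) * B"
    and "\<exists>B\<in>jordan_mats. scalar2 (weyl_t ^ n) * A = B * scalar2 (weyl_t ^ n)"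
proof -
  let ?t = "scalar2 weyl_t :: 'a weyl mat2"
  let ?x = "Mat2 0 1 0 0 :: 'a weyl mat2"
  let ?y = "Mat2 0 (weyl_t * weyl_d) weyl_t 0 :: 'a weyl mat2"
  have eval_gen: "jordan_eval (free_gen g) = (case g of Jordan_X \<Rightarrow> ?x | Jordan_Y \<Rightarrow> ?y)" for g
    by (simp add: jordan_eval_simps jordan_gen_mat_def)
  have x: "?x * ?t = ?t * ?x" "?t * ?x = ?x * ?t" by simp_all
  have y: "?y * ?t = ?t * (?y + ?x)" "?t * ?y = (?y - ?x) * ?t"
    by (simp_all add: weyl_d_t algebra_simps)
  have right: "\<exists>B\<in>jordan_mats. jordan_eval p * ?t = ?t * B" for p :: "jordan_gen word \<Rightarrow>\<^sub>0 'a"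
  proof (induction p rule: free_algebra_induct)
    case 1
    show ?case by (intro bexI [of _ 1] jordan_mats_closed) (simp add: jordan_eval_simps)
  next
    case (add p q)
    then obtain B C where "B \<in> jordan_mats" "jordan_eval p * ?t = ?t * B"
      "C \<in> jordan_mats" "jordan_eval q * ?t = ?t * C" by blast
    then show ?case
      by (intro bexI [of _ "B + C"] jordan_mats_closed)
         (simp_all only: jordan_eval_simps distrib_left distrib_right)
  next
    case (const c p)
    then obtain B where B: "B \<in> jordan_mats" "jordan_eval p * ?t = ?t * B" by blast
    have "jordan_eval (free_const c * p) * ?t = scalar2 (weyl_c c) * ?t * B"
      by (simp only: jordan_eval_simps mult.assoc B)
    also have "scalar2 (weyl_c c) * ?t = ?t * scalar2 (weyl_c c)" by (simp add: weyl_c_central)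
    finally show ?case using B(1) jordan_mats_scalar [of "[:c:]"]
      by (intro bexI [of _ "scalar2 (weyl_c c) * B"] jordan_mats_closed) (simp_all only: mult.assoc)
  next
    case (gen g p)
    then obtain B where B: "B \<in> jordan_mats" "jordan_eval p * ?t = ?t * B" by blast
    obtain G where G: "G \<in> jordan_mats" "jordan_eval (free_gen g) * ?t = ?t * G"
    proof (cases g)
      case Jordan_X
      then show ?thesis using that [OF jordan_mats_x] x(1) by (simp only: eval_gen jordan_gen.case)
    next
      case Jordan_Y
      then show ?thesis
        using that [OF jordan_mats_closed(2) [OF jordan_mats_y jordan_mats_x]] y(1) by (simp only: eval_gen jordan_gen.case)
    qed
    have "jordan_eval (free_gen g * p) * ?t = jordan_eval (free_gen g) * ?t * B"
      by (simp only: jordan_eval_simps(4) mult.assoc B)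
    then show ?case using B(1) G
      by (intro bexI [of _ "G * B"] jordan_mats_closed) (simp_all only: mult.assoc)
  qed
  have left: "\<exists>B\<in>jordan_mats. ?t * jordan_eval p = B * ?t" for p :: "jordan_gen word \<Rightarrow>\<^sub>0 'a"
  proof (induction p rule: free_algebra_induct)
    case 1
    show ?case by (intro bexI [of _ 1] jordan_mats_closed) (simp add: jordan_eval_simps)
  next
    case (add p q)
    then obtain B C where "B \<in> jordan_mats" "?t * jordan_eval p = B * ?t"
      "C \<in> jordan_mats" "?t * jordan_eval q = C * ?t" by blast
    then show ?case
      by (intro bexI [of _ "B + C"] jordan_mats_closed)
         (simp_all only: jordan_eval_simps distrib_left distrib_right)
  next
    case (const c p)
    then obtain B where B: "B \<in> jordan_mats" "?t * jordan_eval p = B * ?t" by blast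
    have "?t * jordan_eval (free_const c * p) = ?t * scalar2 (weyl_c c) * jordan_eval p"
      by (simp only: jordan_eval_simps mult.assoc)
    also have "?t * scalar2 (weyl_c c) = scalar2 (weyl_c c) * ?t" by (simp add: weyl_c_central)
    finally show ?case using B jordan_mats_scalar [of "[:c:]"]
      by (intro bexI [of _ "scalar2 (weyl_c c) * B"] jordan_mats_closed) (simp_all only: mult.assoc)
  next
    case (gen g p)
    then obtain B where B: "B \<in> jordan_mats" "?t * jordan_eval p = B * ?t" by blast
    obtain G where G: "G \<in> jordan_mats" "?t * jordan_eval (free_gen g) = G * ?t"
    proof (cases g)
      case Jordan_X
      then show ?thesis using that [OF jordan_mats_x] x(2) by (simp only: eval_gen jordan_gen.case)
    next
      case Jordan_Y
      then show ?thesis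
        using that [OF jordan_mats_closed(3) [OF jordan_mats_y jordan_mats_x]] y(2) by (simp only: eval_gen jordan_gen.case)
    qed
    have "?t * jordan_eval (free_gen g * p) = G * (?t * jordan_eval p)"
      by (simp only: jordan_eval_simps(4) mult.assoc [symmetric] G)
    then show ?case using B G(1)
      by (intro bexI [of _ "G * B"] jordan_mats_closed) (simp_all only: mult.assoc)
  qed
  have t_Suc: "scalar2 (weyl_t ^ Suc n) = ?t * scalar2 (weyl_t ^ n)"
    "scalar2 (weyl_t ^ Suc n) = scalar2 (weyl_t ^ n) * ?t" for n
    by (simp_all add: power_commutes)
  show "\<exists>B\<in>jordan_mats. A * scalar2 (weyl_t ^ n) = scalar2 (weyl_t ^ n) * B"
  proof (induction n)
    case 0
    show ?case using assms by (intro bexI [of _ A]) (simp_all flip: one_mat2_def)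
  next
    case (Suc n)
    then obtain B where B: "B \<in> jordan_mats" "A * scalar2 (weyl_t ^ n) = scalar2 (weyl_t ^ n) * B" by blast
    obtain C where C: "C \<in> jordan_mats" "B * ?t = ?t * C" using right B(1) by blast
    have "A * scalar2 (weyl_t ^ Suc n) = scalar2 (weyl_t ^ n) * (B * ?t)"
      unfolding t_Suc(2) mult.assoc [symmetric] B(2) ..
    then have "A * scalar2 (weyl_t ^ Suc n) = scalar2 (weyl_t ^ Suc n) * C"
      unfolding C(2) t_Suc(2) mult.assoc .
    then show ?case using C(1) by blast
  qed
  show "\<exists>B\<in>jordan_mats. scalar2 (weyl_t ^ n) * A = B * scalar2 (weyl_t ^ n)"
  proof (induction n)
    case 0
    show ?case using assms by (intro bexI [of _ A]) (simp_all flip: one_mat2_def)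
  next
    case (Suc n)
    then obtain B where B: "B \<in> jordan_mats" "scalar2 (weyl_t ^ n) * A = B * scalar2 (weyl_t ^ n)" by blast
    obtain C where C: "C \<in> jordan_mats" "?t * B = C * ?t" using left B(1) by blast
    have "scalar2 (weyl_t ^ Suc n) * A = (?t * B) * scalar2 (weyl_t ^ n)"
      unfolding t_Suc(1) mult.assoc B(2) ..
    then have "scalar2 (weyl_t ^ Suc n) * A = C * scalar2 (weyl_t ^ Suc n)"
      unfolding C(2) t_Suc(1) mult.assoc .
    then show ?case using C(1) by blast
  qed
qed

section \<open>Matrices over the skew field of fractions\<close>

lemma mat2_unit_or_zero_divisor:
  fixes A :: "'a::division_ring mat2"
  shows "(\<exists>B. A * B = 1 \<and> B * A = 1) \<or> (\<exists>B. B \<noteq> 0 \<and> A * B = 0)"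
proof -
  have unit_mult: "\<exists>B. U * V * B = 1 \<and> B * (U * V) = 1"
    if "U * U' = 1" "U' * U = 1" "V * V' = 1" "V' * V = 1" for U U' V V' :: "'a mat2"
  proof (intro exI conjI)
    have "U * V * (V' * U') = U * (V * V') * U'" by (simp only: mult.assoc)
    then show "U * V * (V' * U') = 1" by (simp add: that)
    have "V' * U' * (U * V) = V' * (U' * U) * V" by (simp only: mult.assoc)
    then show "V' * U' * (U * V) = 1" by (simp add: that)
  qed
  have main: "(\<exists>B. A * B = 1 \<and> B * A = 1) \<or> (\<exists>B. B \<noteq> 0 \<and> A * B = 0)"
    if A: "A = Mat2 a b c d" and a: "a \<noteq> 0" for A :: "'a mat2" and a b c d
  proof -
    define \<delta> where "\<delta> = d - c * inverse a * b"
    show ?thesis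
    proof (cases "\<delta> = 0")
      case True
      have "a * (inverse a * b) = b" using a by (simp flip: mult.assoc)
      then have "A * Mat2 (- (inverse a * b)) 0 1 0 = 0"
        using True by (simp add: A \<delta>_def mult.assoc)
      then show ?thesis by (intro disjI2 exI [of _ "Mat2 (- (inverse a * b)) 0 1 0"]) simp
    next
      case False
      let ?L = "Mat2 1 0 (c * inverse a) 1" and ?L' = "Mat2 1 0 (- (c * inverse a)) 1"
      let ?U = "Mat2 1 (inverse a * b) 0 1" and ?U' = "Mat2 1 (- (inverse a * b)) 0 1"
      let ?D = "Mat2 a 0 0 \<delta>" and ?D' = "Mat2 (inverse a) 0 0 (inverse \<delta>)"
      have "a * (inverse a * b) = b" "c * inverse a * a = c" "c * inverse a * a * (inverse a * b) = c * (inverse a * b)"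
        using a by (simp_all flip: mult.assoc) (simp_all add: mult.assoc a)
      then have A': "A = ?L * (?D * ?U)"
        using a by (simp add: A \<delta>_def mult.assoc)
      obtain B where "?D * ?U * B = 1 \<and> B * (?D * ?U) = 1"
        using unit_mult [of ?D ?D' ?U ?U'] a False by auto
      then show ?thesis
        unfolding A' using unit_mult [of ?L ?L' "?D * ?U" B] by simp
    qed
  qed
  obtain a b c d where A: "A = Mat2 a b c d" by (cases A)
  consider "a \<noteq> 0" | "a = 0" "c \<noteq> 0" | "a = 0" "c = 0" by blast
  then show ?thesis
  proof cases
    case 1
    then show ?thesis using main [OF A] by blast
  next
    case 2
    let ?P = "Mat2 0 1 1 (0 :: 'a)"
    have PP: "?P * ?P = 1" by simp
    have PA: "?P * A = Mat2 c d a b" by (simp add: A)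
    have A': "A = ?P * (?P * A)" by (simp only: PP mult_1_left mult.assoc [symmetric])
    from main [OF PA 2(2)] show ?thesis
    proof
      assume "\<exists>B. ?P * A * B = 1 \<and> B * (?P * A) = 1"
      then obtain B where "?P * A * B = 1" "B * (?P * A) = 1" by blast
      from unit_mult [OF PP PP this] show ?thesis by (simp add: A' [symmetric])
    next
      assume "\<exists>B. B \<noteq> 0 \<and> ?P * A * B = 0"
      then obtain B where B: "B \<noteq> 0" "?P * A * B = 0" by blast
      have "A * B = ?P * (?P * A * B)" by (simp only: PP mult_1_left mult.assoc [symmetric])
      then show ?thesis using B by auto
    qed
  next
    case 3
    then have "A * Mat2 1 0 0 0 = 0" by (simp add: A)
    then show ?thesis by (intro disjI2 exI [of _ "Mat2 1 0 0 0"]) simp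
  qed
qed

definition frac_mat :: "'a::ore_domain mat2 \<Rightarrow> 'a fraction mat2" where
  "frac_mat = map_mat2 frac"

lemma frac_mat_simps:
  "frac_mat (Mat2 a b c d) = Mat2 (frac a) (frac b) (frac c) (frac d)"
  "frac_mat 0 = 0" "frac_mat 1 = 1"
  "frac_mat (A + B) = frac_mat A + frac_mat B" "frac_mat (A - B) = frac_mat A - frac_mat B"
  "frac_mat (A * B) = frac_mat A * frac_mat B"
  by (cases A; cases B; simp add: frac_mat_def zero_mat2_def one_mat2_def frac_add frac_mult frac_diff)+

lemma frac_mat_eq_iff: "frac_mat A = frac_mat B \<longleftrightarrow> A = B"
  by (cases A; cases B; simp add: frac_mat_simps)

lemma common_denominator_right: "\<exists>b N. b \<noteq> 0 \<and> A * scalar2 (frac b) = frac_mat N"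
proof -
  have step: "\<exists>c. c \<noteq> 0 \<and> q * frac (b * c) \<in> range frac \<and> (\<forall>p\<in>P. p * frac (b * c) \<in> range frac)"
    if b: "b \<noteq> 0" and P: "\<forall>p\<in>P. p * frac b \<in> range frac" for b :: 'a and q P
  proof -
    obtain a c where c: "c \<noteq> 0" "q * frac b * frac c = frac a"
      using fraction_mult_denominator by blast
    have "p * frac (b * c) \<in> range frac" if "p \<in> P" for p
    proof -
      obtain x where "p * frac b = frac x" using P \<open>p \<in> P\<close> by blast
      then have "p * frac (b * c) = frac (x * c)" by (simp add: frac_mult flip: mult.assoc)
      then show ?thesis by simp
    qed
    moreover have "q * frac (b * c) = frac a" using c(2) by (simp add: frac_mult mult.assoc)
    ultimately show ?thesis using c(1) by auto
  qed
  obtain p q r s where A: "A = Mat2 p q r s" by (cases A)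
  obtain b1 where b1: "b1 \<noteq> 0" "\<forall>x\<in>{p}. x * frac b1 \<in> range frac"
    using step [of 1 "{}" p] by auto
  obtain c where c: "c \<noteq> 0" "\<forall>x\<in>{q, p}. x * frac (b1 * c) \<in> range frac"
    using step [OF b1, of q] by auto
  then have b2: "b1 * c \<noteq> 0" using b1 by simp
  obtain c' where c': "c' \<noteq> 0" "\<forall>x\<in>{r, q, p}. x * frac (b1 * c * c') \<in> range frac"
    using step [OF b2 c(2), of r] by auto
  then have b3: "b1 * c * c' \<noteq> 0" using b2 by simp
  obtain c'' where c'': "c'' \<noteq> 0" "\<forall>x\<in>{s, r, q, p}. x * frac (b1 * c * c' * c'') \<in> range frac"
    using step [OF b3 c'(2), of s] by auto
  let ?b = "b1 * c * c' * c''"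
  from c''(2) obtain w x y z where "p * frac ?b = frac w" "q * frac ?b = frac x"
    "r * frac ?b = frac y" "s * frac ?b = frac z" by auto
  then have "A * scalar2 (frac ?b) = frac_mat (Mat2 w x y z)" by (simp add: A frac_mat_simps)
  moreover have "?b \<noteq> 0" using b3 c'' by simp
  ultimately show ?thesis by blast
qed

lemma common_denominator_left: "\<exists>b N. b \<noteq> 0 \<and> scalar2 (frac b) * A = frac_mat N"
proof -
  have step: "\<exists>c. c \<noteq> 0 \<and> frac (c * b) * q \<in> range frac \<and> (\<forall>p\<in>P. frac (c * b) * p \<in> range frac)"
    if b: "b \<noteq> 0" and P: "\<forall>p\<in>P. frac b * p \<in> range frac" for b :: 'a and q P
  proof -
    obtain a c where c: "c \<noteq> 0" "frac c * (frac b * q) = frac a"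
      using denominator_mult_fraction by blast
    have "frac (c * b) * p \<in> range frac" if "p \<in> P" for p
    proof -
      obtain x where "frac b * p = frac x" using P \<open>p \<in> P\<close> by blast
      then have "frac (c * b) * p = frac (c * x)" by (simp add: frac_mult mult.assoc)
      then show ?thesis by simp
    qed
    moreover have "frac (c * b) * q = frac a" using c(2) by (simp add: frac_mult mult.assoc)
    ultimately show ?thesis using c(1) by auto
  qed
  obtain p q r s where A: "A = Mat2 p q r s" by (cases A)
  obtain b1 where b1: "b1 \<noteq> 0" "\<forall>x\<in>{p}. frac b1 * x \<in> range frac"
    using step [of 1 "{}" p] by auto
  obtain c where c: "c \<noteq> 0" "\<forall>x\<in>{q, p}. frac (c * b1) * x \<in> range frac"
    using step [OF b1, of q] by auto
  then have b2: "c * b1 \<noteq> 0" using b1 by simp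
  obtain c' where c': "c' \<noteq> 0" "\<forall>x\<in>{r, q, p}. frac (c' * (c * b1)) * x \<in> range frac"
    using step [OF b2 c(2), of r] by auto
  then have b3: "c' * (c * b1) \<noteq> 0" using b2 by simp
  obtain c'' where c'': "c'' \<noteq> 0" "\<forall>x\<in>{s, r, q, p}. frac (c'' * (c' * (c * b1))) * x \<in> range frac"
    using step [OF b3 c'(2), of s] by auto
  let ?b = "c'' * (c' * (c * b1))"
  from c''(2) obtain w x y z where "frac ?b * p = frac w" "frac ?b * q = frac x"
    "frac ?b * r = frac y" "frac ?b * s = frac z" by auto
  then have "scalar2 (frac ?b) * A = frac_mat (Mat2 w x y z)" by (simp add: A frac_mat_simps)
  moreover have "?b \<noteq> 0" using b3 c'' by simp
  ultimately show ?thesis by blast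
qed

lemma weyl_t_power_nonzero: "weyl_t ^ n \<noteq> 0"
  by simp

lemma jordan_fraction_right:
  fixes A :: "'k::field weyl fraction mat2"
  shows "\<exists>b N. b \<noteq> 0 \<and> scalar2 b \<in> jordan_mats \<and> N \<in> jordan_mats \<and> A * frac_mat (scalar2 b) = frac_mat N"
proof -
  obtain b N where b: "b \<noteq> 0" "A * scalar2 (frac b) = frac_mat N"
    using common_denominator_right by blast
  obtain m where m: "scalar2 b * scalar2 (weyl_t ^ m) \<in> jordan_mats" using right_denominator by blast
  obtain n where n: "N * scalar2 (weyl_t ^ n) \<in> jordan_mats" using right_denominator by blast
  have 1: "scalar2 (b * weyl_t ^ (m + n)) \<in> jordan_mats"
    using jordan_mats_closed(4) [OF m jordan_mats_t_power [of n]] by (simp add: power_add mult.assoc)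
  have 2: "N * scalar2 (weyl_t ^ (m + n)) \<in> jordan_mats"
    using jordan_mats_closed(4) [OF n jordan_mats_t_power [of m]]
    unfolding mult.assoc scalar2_commute_t_power by (simp only: add.commute)
  have "A * frac_mat (scalar2 (b * weyl_t ^ (m + n))) = A * scalar2 (frac b) * frac_mat (scalar2 (weyl_t ^ (m + n)))"
    by (simp add: frac_mat_simps frac_mult mult.assoc)
  then have "A * frac_mat (scalar2 (b * weyl_t ^ (m + n))) = frac_mat (N * scalar2 (weyl_t ^ (m + n)))"
    unfolding b(2) frac_mat_simps(6) .
  moreover have "b * weyl_t ^ (m + n) \<noteq> 0" using b(1) by simp
  ultimately show ?thesis using 1 2 by blast
qed

lemma jordan_fraction_left:
  fixes A :: "'k::field weyl fraction mat2"
  shows "\<exists>b N. b \<noteq> 0 \<and> scalar2 b \<in> jordan_mats \<and> N \<in> jordan_mats \<and> frac_mat (scalar2 b) * A = frac_mat N"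
proof -
  obtain b N where b: "b \<noteq> 0" "scalar2 (frac b) * A = frac_mat N"
    using common_denominator_left by blast
  obtain m where m: "scalar2 (weyl_t ^ m) * scalar2 b \<in> jordan_mats" using left_denominator by blast
  obtain n where n: "scalar2 (weyl_t ^ n) * N \<in> jordan_mats" using left_denominator by blast
  have 1: "scalar2 (weyl_t ^ (n + m) * b) \<in> jordan_mats"
    using jordan_mats_closed(4) [OF jordan_mats_t_power [of n] m] by (simp add: power_add mult.assoc)
  have 2: "scalar2 (weyl_t ^ (n + m)) * N \<in> jordan_mats"
    using jordan_mats_closed(4) [OF jordan_mats_t_power [of m] n]
    unfolding mult.assoc [symmetric] scalar2_commute_t_power by (simp only: add.commute)
  have "frac_mat (scalar2 (weyl_t ^ (n + m) * b)) * A = frac_mat (scalar2 (weyl_t ^ (n + m))) * (scalar2 (frac b) * A)"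
    by (simp add: frac_mat_simps frac_mult flip: mult.assoc)
  then have "frac_mat (scalar2 (weyl_t ^ (n + m) * b)) * A = frac_mat (scalar2 (weyl_t ^ (n + m)) * N)"
    unfolding b(2) frac_mat_simps(6) .
  moreover have "weyl_t ^ (n + m) * b \<noteq> 0" using b(1) by simp
  ultimately show ?thesis using 1 2 by blast
qed

section \<open>Commutators in the Weyl algebra\<close>

lemma weyl_t_commutator: "weyl_poly (u * weyl_t - weyl_t * u) = pderiv (weyl_poly u)"
proof -
  have "Weyl P * weyl_t - weyl_t * Weyl P = Weyl (pderiv P)" for P :: "'a poly poly"
  proof (induction P)
    case 0
    then show ?case by (simp flip: zero_weyl_def)
  next
    case (pCons p P)
    have "Weyl (pCons p P) * weyl_t - weyl_t * Weyl (pCons p P)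
        = Weyl P + (Weyl P * weyl_t - weyl_t * Weyl P) * weyl_d"
      by (simp add: Weyl_pCons algebra_simps weyl_d_t weyl_p_commute [of p])
    also have "\<dots> = Weyl (P + pCons 0 (pderiv P))"
      unfolding pCons.IH using Weyl_pCons [of 0 "pderiv P"] by (simp add: plus_weyl_def)
    finally show ?case by (simp only: pderiv_pCons)
  qed
  from this [of "weyl_poly u"] show ?thesis by simp
qed

lemma weyl_t_centralizer:
  fixes u :: "'k::field_char_0 weyl"
  assumes "u * weyl_t = weyl_t * u"
  shows "\<exists>p. u = weyl_p p"
proof -
  have "pderiv (weyl_poly u) = 0" using weyl_t_commutator [of u] assms by simp
  then have "degree (weyl_poly u) = 0" by (simp add: pderiv_eq_0_iff)
  then obtain p where "weyl_poly u = [:p:]" by (rule degree_eq_zeroE)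
  then show ?thesis by (metis weyl_p_def weyl_poly_inverse)
qed

lemma euler_eigenvector:
  fixes p :: "'k::field_char_0 poly"
  assumes "[:0, 1:] * pderiv p = of_nat n * p"
  shows "p = monom (coeff p n) n"
proof (rule poly_eqI)
  fix i
  have "of_nat i * coeff p i = of_nat n * coeff p i"
    using arg_cong [OF assms, of "\<lambda>q. coeff q i"]
    by (cases i) (simp_all add: coeff_pderiv coeff_pCons of_nat_poly)
  then show "coeff p i = coeff (monom (coeff p n) n) i" by auto
qed

lemma weyl_p_of_nat: "weyl_p (of_nat n) = of_nat n"
  by (induction n) (simp_all add: weyl_p_add)

lemma fraction_scalar_central:
  "frac (weyl_c c) * q = q * frac (weyl_c c)" for q :: "'k::field weyl fraction"
proof -
  obtain a b where ab: "b \<noteq> 0" "q * frac b = frac a" using fraction_mult_denominator by blast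
  have "frac (weyl_c c) * q * frac b = frac (weyl_c c * a)" by (simp add: ab mult.assoc frac_mult)
  also have "\<dots> = frac a * frac (weyl_c c)" by (simp only: weyl_c_central frac_mult)
  also have "\<dots> = q * frac (weyl_c c * b)" unfolding ab(2) [symmetric] weyl_c_central by (simp add: frac_mult mult.assoc)
  also have "\<dots> = q * frac (weyl_c c) * frac b" by (simp add: frac_mult mult.assoc)
  finally show ?thesis using ab(1) by simp
qed

text \<open>Commutation with \<open>x\<close> and \<open>y\<close> forces a scalar matrix whose entry commutes with \<open>t\<close> and
  \<open>\<partial>\<close>; being a fraction with denominator \<open>t\<^sup>n\<close>, it is a Laurent polynomial in \<open>t\<close> with zero
  derivative.\<close>

lemma jordan_centralizer:
  fixes A :: "'k::field_char_0 weyl fraction mat2"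
  assumes den: "A * frac_mat (scalar2 (weyl_t ^ n)) = frac_mat N"
    and x: "A * frac_mat (Mat2 0 1 0 0) = frac_mat (Mat2 0 1 0 0) * A"
    and y: "A * frac_mat (Mat2 0 (weyl_t * weyl_d) weyl_t 0) = frac_mat (Mat2 0 (weyl_t * weyl_d) weyl_t 0) * A"
  shows "\<exists>c. A = frac_mat (scalar2 (weyl_c c))"
proof -
  obtain a b c d where A: "A = Mat2 a b c d" by (cases A)
  obtain p p2 p3 p4 where N: "N = Mat2 p p2 p3 p4" by (cases N)
  let ?t = "frac (weyl_t :: 'k weyl)" and ?d = "frac (weyl_d :: 'k weyl)"
  have c: "c = 0" "d = a" using x by (simp_all add: A frac_mat_simps)
  have t: "a * ?t = ?t * a" and b: "b * ?t = 0 \<or> ?t * b = 0" and td: "a * (?t * ?d) = ?t * ?d * a"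
    using y by (simp_all add: A c frac_mat_simps frac_mult)
  from b have b: "b = 0" by simp
  have ad: "a * ?d = ?d * a"
  proof -
    have "?t * (a * ?d) = ?t * (?d * a)" using td by (simp only: t flip: mult.assoc)
    then show ?thesis by simp
  qed
  have p: "a * ?t ^ n = frac p" using den by (simp add: A N frac_mat_simps frac_power)
  have tn: "?t ^ n * ?t = ?t * ?t ^ n" by (simp add: power_commutes)
  have "frac (p * weyl_t) = frac (weyl_t * p)"
    unfolding frac_mult p [symmetric] by (simp only: mult.assoc tn) (simp only: t flip: mult.assoc)
  then obtain q where q: "p = weyl_p q" using weyl_t_centralizer by auto
  have "weyl_t * (weyl_d * p) = weyl_t * (p * weyl_d) + of_nat n * p"
  proof (cases n)
    case 0
    then have "frac (weyl_d * p) = frac (p * weyl_d)"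
      unfolding frac_mult p [symmetric] using ad by simp
    then show ?thesis using 0 by simp
  next
    case (Suc m)
    have "frac (weyl_d * p) = a * frac (weyl_d * weyl_t ^ n)"
      unfolding frac_mult p [symmetric] frac_power by (simp only: ad flip: mult.assoc)
    also have "\<dots> = a * ?t ^ n * ?d + frac (weyl_c (of_nat n)) * (a * ?t ^ m)"
      unfolding Suc weyl_d_t_power frac_add frac_mult
      by (simp add: distrib_left frac_power frac_mult mult.assoc fraction_scalar_central del: of_nat_Suc)
    also have "\<dots> = frac (p * weyl_d) + frac (weyl_c (of_nat n)) * (a * ?t ^ m)"
      by (simp only: p frac_mult)
    finally have "frac (weyl_t * (weyl_d * p)) = frac (weyl_t * (p * weyl_d)) + ?t * (frac (weyl_c (of_nat n)) * (a * ?t ^ m))"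
      by (simp add: frac_mult distrib_left)
    also have "?t * (frac (weyl_c (of_nat n)) * (a * ?t ^ m)) = frac (weyl_c (of_nat n)) * (a * ?t ^ n)"
      unfolding Suc power_Suc
      by (simp only: mult.assoc [symmetric] fraction_scalar_central [symmetric])
         (simp only: mult.assoc t)
    also have "\<dots> = frac (of_nat n * p)"
      unfolding p frac_mult of_nat_poly [symmetric] weyl_p_of_nat ..
    finally show ?thesis by (simp flip: frac_add)
  qed
  then have "weyl_t * weyl_p (pderiv q) = of_nat n * weyl_p q"
    by (simp add: q weyl_d_p distrib_left)
  then have "weyl_p ([:0, 1:] * pderiv q) = weyl_p (of_nat n * q)"
    by (simp only: weyl_p_mult weyl_p_of_nat)
  then have "q = monom (coeff q n) n" by (intro euler_eigenvector) (simp only: weyl_p_eq_iff)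
  then obtain k where k: "q = monom k n" by blast
  have "q = [:k:] * [:0, 1:] ^ n" by (simp add: k monom_altdef)
  then have "p = weyl_c k * weyl_t ^ n" by (simp only: q weyl_p_mult weyl_p_power)
  then have "a * ?t ^ n = frac (weyl_c k) * ?t ^ n" using p by (simp add: frac_mult frac_power)
  then have "a = frac (weyl_c k)" by simp
  then show ?thesis by (auto simp: A b c frac_mat_simps)
qed

lemma saturated_ideal_contains_1:
  fixes K :: "'k::field_char_0 weyl mat2 set"
  assumes add: "\<And>A B. A \<in> K \<Longrightarrow> B \<in> K \<Longrightarrow> A + B \<in> K"
    and left: "\<And>A B. A \<in> jordan_mats \<Longrightarrow> B \<in> K \<Longrightarrow> A * B \<in> K"
    and right: "\<And>A B. A \<in> jordan_mats \<Longrightarrow> B \<in> K \<Longrightarrow> B * A \<in> K"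
    and saturated: "\<And>A. A \<in> jordan_mats \<Longrightarrow> scalar2 weyl_t * A \<in> K \<Longrightarrow> A \<in> K"
    and N: "N \<in> K" "N \<noteq> 0"
  shows "1 \<in> K"
proof -
  define C where "C a \<longleftrightarrow> Mat2 a 0 0 0 \<in> K" for a :: "'k weyl"
  have t: "scalar2 weyl_t \<in> (jordan_mats :: 'k weyl mat2 set)"
    using jordan_mats_scalar [of "[:0, 1:]"] by simp
  have C_left: "C (weyl_p p * a)" if "C a" for p a
    using left [OF jordan_mats_scalar that [unfolded C_def], of p] by (simp add: C_def)
  have C_right: "C (a * weyl_p p)" if "C a" for p a
    using right [OF jordan_mats_scalar that [unfolded C_def], of p] by (simp add: C_def)
  have C_diff: "C (a - b)" if "C a" "C b" for a b
    using add [OF that(1) [unfolded C_def] C_left [OF that(2), of "- 1", unfolded C_def]]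
    by (simp add: C_def weyl_p_uminus)
  have "\<exists>a. a \<noteq> 0 \<and> C a"
  proof -
    obtain a b c d where abcd: "N = Mat2 a b c d" by (cases N)
    let ?t = "Mat2 weyl_t 0 0 0" and ?t2 = "Mat2 0 0 (weyl_t * weyl_t) 0" and ?x = "Mat2 0 1 0 0"
    have "C (weyl_t * (a * weyl_t))"
      using left [OF jordan_mats_units(1) right [OF jordan_mats_units(1) N(1)]] by (simp add: C_def abcd)
    moreover have "C (weyl_t * (b * (weyl_t * weyl_t)))"
      using left [OF jordan_mats_units(1) right [OF jordan_mats_units(2) N(1)]] by (simp add: C_def abcd)
    moreover have "C (c * weyl_t)"
      using left [OF jordan_mats_x right [OF jordan_mats_units(1) N(1)]] by (simp add: C_def abcd)
    moreover have "C (d * (weyl_t * weyl_t))"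
      using left [OF jordan_mats_x right [OF jordan_mats_units(2) N(1)]] by (simp add: C_def abcd)
    moreover have "a \<noteq> 0 \<or> b \<noteq> 0 \<or> c \<noteq> 0 \<or> d \<noteq> 0" using N(2) abcd by simp
    ultimately show ?thesis
      by (metis (no_types, lifting) mult_eq_0_iff weyl_p_eq_0_iff pCons_eq_0_iff one_neq_zero)
  qed
  then obtain a where a: "a \<noteq> 0" "C a" by blast
  have "\<exists>p. p \<noteq> 0 \<and> C (weyl_p p)" using a
  proof (induction "degree (weyl_poly a)" arbitrary: a rule: less_induct)
    case less
    define b where "b = a * weyl_t - weyl_t * a"
    have C: "C b" unfolding b_def by (intro C_diff C_left C_right less.prems)
    have pb: "weyl_poly b = pderiv (weyl_poly a)" unfolding b_def by (rule weyl_t_commutator)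
    show ?case
    proof (cases "b = 0")
      case True
      then obtain p where "a = weyl_p p" using weyl_t_centralizer [of a] by (auto simp: b_def)
      then show ?thesis using less.prems by auto
    next
      case False
      then have "pderiv (weyl_poly a) \<noteq> 0" using pb by (metis weyl_poly_eq_0_iff)
      then have "degree (weyl_poly b) < degree (weyl_poly a)"
        unfolding pb degree_pderiv by (simp add: pderiv_eq_0_iff)
      then show ?thesis using less.hyps False C by blast
    qed
  qed
  then obtain p where p: "p \<noteq> 0" "C (weyl_p p)" by blast
  define C' where "C' p \<longleftrightarrow> C (weyl_p (pCons 0 p))" for p
  have pCons_0: "pCons 0 p = [:0, 1:] * p" for p :: "'k poly" by simp
  have C'_sat: "C' p" if "C' (pCons 0 p)" for p
  proof -
    have "Mat2 (weyl_p (pCons 0 p)) 0 0 0 = Mat2 weyl_t 0 0 0 * scalar2 (weyl_p p)"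
      by (simp flip: weyl_p_mult)
    also have "\<dots> \<in> jordan_mats" by (intro jordan_mats_closed(4) jordan_mats_units jordan_mats_scalar)
    finally show ?thesis
      using saturated that by (simp add: C'_def C_def flip: weyl_p_mult)
  qed
  have C'_deriv: "C' (pderiv p)" if "C' p" for p
  proof -
    let ?q = "pCons 0 p" and ?w = "weyl_t * weyl_t * weyl_d * weyl_t * weyl_t :: 'k weyl"
    have q: "Mat2 (weyl_p ?q) 0 0 0 \<in> K" using that by (simp add: C'_def C_def)
    have "C (?w * weyl_p ?q - weyl_p ?q * ?w)"
      using left [OF jordan_mats_units(3) q] right [OF jordan_mats_units(3) q]
      by (intro C_diff) (simp_all add: C_def)
    also have "?w * weyl_p ?q - weyl_p ?q * ?w = weyl_t * weyl_t * (weyl_d * weyl_p ?q - weyl_p ?q * weyl_d) * weyl_t * weyl_t"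
    proof -
      have "?w * weyl_p ?q = weyl_t * weyl_t * (weyl_d * (weyl_t * weyl_t * weyl_p ?q))"
        by (simp only: mult.assoc)
      also have "weyl_t * weyl_t * weyl_p ?q = weyl_p ?q * (weyl_t * weyl_t)"
        unfolding weyl_p_mult [symmetric] by (simp only: mult.commute)
      finally have 1: "?w * weyl_p ?q = weyl_t * weyl_t * (weyl_d * weyl_p ?q) * weyl_t * weyl_t"
        by (simp only: mult.assoc)
      have "weyl_p ?q * ?w = weyl_p ?q * (weyl_t * weyl_t) * weyl_d * weyl_t * weyl_t"
        by (simp only: mult.assoc)
      also have "weyl_p ?q * (weyl_t * weyl_t) = weyl_t * weyl_t * weyl_p ?q"
        unfolding weyl_p_mult [symmetric] by (simp only: mult.commute)
      finally have 2: "weyl_p ?q * ?w = weyl_t * weyl_t * (weyl_p ?q * weyl_d) * weyl_t * weyl_t"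
        by (simp only: mult.assoc)
      show ?thesis unfolding 1 2 by (simp only: left_diff_distrib right_diff_distrib)
    qed
    also have "\<dots> = weyl_p ([:0, 1:] * [:0, 1:] * pderiv ?q * [:0, 1:] * [:0, 1:])"
      unfolding weyl_d_p add_diff_cancel_left' weyl_p_mult ..
    finally have "C (weyl_p ([:0, 1:] * [:0, 1:] * pderiv ?q * [:0, 1:] * [:0, 1:]))" .
    moreover have "C (weyl_p ([:0, 1:] * [:0, 1:] * [:0, 1:]) * weyl_p ?q)"
      using that unfolding C'_def by (rule C_left)
    ultimately have "C (weyl_p ([:0, 1:] * [:0, 1:] * pderiv ?q * [:0, 1:] * [:0, 1:])
        - weyl_p ([:0, 1:] * [:0, 1:] * [:0, 1:]) * weyl_p ?q)"
      by (rule C_diff)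
    also have "weyl_p ([:0, 1:] * [:0, 1:] * pderiv ?q * [:0, 1:] * [:0, 1:])
        - weyl_p ([:0, 1:] * [:0, 1:] * [:0, 1:]) * weyl_p ?q
        = weyl_p (pCons 0 (pCons 0 (pCons 0 (pCons 0 (pCons 0 (pderiv p))))))"
    proof -
      have "[:0, 1:] * [:0, 1:] * pderiv ?q * [:0, 1:] * [:0, 1:]
        = pCons 0 (pCons 0 (pCons 0 (pCons 0 (pCons 0 (pderiv p))))) + [:0, 1:] * [:0, 1:] * [:0, 1:] * ?q"
        by (simp add: pderiv_pCons algebra_simps)
      then show ?thesis by (simp only: weyl_p_add weyl_p_mult [symmetric] add_diff_cancel_right')
    qed
    finally show ?thesis unfolding C'_def [symmetric]
      by (rule C'_sat [OF C'_sat [OF C'_sat [OF C'_sat]]])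
  qed
  have "C' p" unfolding C'_def using C_left [OF p(2), of "[:0, 1:]"] by (simp flip: weyl_p_mult)
  with p(1) have "C' 1"
  proof (induction "degree p" arbitrary: p rule: less_induct)
    case less
    show ?case
    proof (cases "pderiv p = 0")
      case True
      then have "degree p = 0" by (simp add: pderiv_eq_0_iff)
      then obtain c where c: "p = [:c:]" by (rule degree_eq_zeroE)
      then have "c \<noteq> 0" using less.prems by simp
      then have "pCons 0 1 = [:inverse c:] * pCons 0 p" by (simp add: c one_pCons)
      then show ?thesis
        using C_left [OF less.prems(2) [unfolded C'_def], of "[:inverse c:]"]
        unfolding C'_def weyl_p_mult [symmetric] by simp
    next
      case False
      then have "degree (pderiv p) < degree p" by (simp add: degree_pderiv pderiv_eq_0_iff)
      then show ?thesis using less.hyps False C'_deriv less.prems(2) by blast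
    qed
  qed
  then have 11: "Mat2 weyl_t 0 0 0 \<in> K" by (simp add: C'_def C_def one_pCons)
  have "Mat2 0 0 (weyl_t * weyl_t) 0 * (Mat2 weyl_t 0 0 0 * Mat2 0 1 0 0) + scalar2 weyl_t * (scalar2 weyl_t * Mat2 weyl_t 0 0 0) \<in> K"
    by (intro add left right jordan_mats_units(2) jordan_mats_x t 11)
  then have "scalar2 weyl_t * (scalar2 weyl_t * (scalar2 weyl_t * 1)) \<in> K"
    by (simp add: mult.assoc)
  then show ?thesis
    by (rule saturated [OF jordan_mats_closed(1) saturated
          [OF jordan_mats_closed(4) [OF t jordan_mats_closed(1)] saturated
            [OF jordan_mats_closed(4) [OF t jordan_mats_closed(4) [OF t jordan_mats_closed(1)]]]]])
qed

section \<open>Transfer along isomorphisms onto a type\<close>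

lemma ring_hom_type_algebraD:
  assumes "f \<in> ring_hom R ring_of_type_algebra"
  shows "a \<in> carrier R \<Longrightarrow> b \<in> carrier R \<Longrightarrow> f (a \<otimes>\<^bsub>R\<^esub> b) = f a * f b"
    and "a \<in> carrier R \<Longrightarrow> b \<in> carrier R \<Longrightarrow> f (a \<oplus>\<^bsub>R\<^esub> b) = f a + f b"
    and "f \<one>\<^bsub>R\<^esub> = 1"
  using assms unfolding type_algebra_ring_hom_iff by blast+

lemma unit_preimage_regular:
  fixes f :: "'a \<Rightarrow> 't::ring_1"
  assumes R: "ring R" and f: "f \<in> ring_hom R ring_of_type_algebra" and inj: "inj_on f (carrier R)"
    and c: "c \<in> carrier R" "f c \<in> Units ring_of_type_algebra"
  shows "c \<in> regular_elements R"
proof -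
  interpret R: ring R by (rule R)
  note fD = ring_hom_type_algebraD [OF f]
  have f0: "f \<zero>\<^bsub>R\<^esub> = 0" by (rule ring_hom_type_algebra_0 [OF R f])
  obtain i where i: "f c * i = 1" "i * f c = 1" using c(2) unfolding type_algebra_Units_iff by blast
  have 1: "r = \<zero>\<^bsub>R\<^esub>" if "r \<in> carrier R" "c \<otimes>\<^bsub>R\<^esub> r = \<zero>\<^bsub>R\<^esub>" for r
  proof -
    have "f c * f r = 0" using fD(1) [OF c(1) that(1)] that(2) f0 by simp
    then have "i * f c * f r = 0" by (simp add: mult.assoc)
    then have "f r = f \<zero>\<^bsub>R\<^esub>" by (simp add: i f0)
    then show ?thesis by (rule inj_onD [OF inj]) (use that(1) in simp_all)
  qed
  have 2: "r = \<zero>\<^bsub>R\<^esub>" if "r \<in> carrier R" "r \<otimes>\<^bsub>R\<^esub> c = \<zero>\<^bsub>R\<^esub>" for r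
  proof -
    have "f r * f c = 0" using fD(1) [OF that(1) c(1)] that(2) f0 by simp
    then have "f r * (f c * i) = 0" by (simp flip: mult.assoc)
    then have "f r = f \<zero>\<^bsub>R\<^esub>" by (simp add: i f0)
    then show ?thesis by (rule inj_onD [OF inj]) (use that(1) in simp_all)
  qed
  show ?thesis
    unfolding regular_elements_def using c(1) 1 2 by blast
qed

lemma ore_sets_of_units:
  fixes f :: "'a \<Rightarrow> 't::ring_1"
  assumes R: "ring R" and f: "f \<in> ring_hom R ring_of_type_algebra" and inj: "inj_on f (carrier R)"
    and S: "S \<subseteq> carrier R" and unit: "f ` S \<subseteq> Units ring_of_type_algebra"
    and right: "\<And>\<tau>. \<exists>r\<in>carrier R. \<exists>s\<in>S. \<tau> * f s = f r"
    and left: "\<And>\<tau>. \<exists>r\<in>carrier R. \<exists>s\<in>S. f s * \<tau> = f r"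
  shows "right_ore_set R S" "left_ore_set R S"
proof -
  interpret R: ring R by (rule R)
  note fD = ring_hom_type_algebraD [OF f]
  have inv: "\<exists>i. f s * i = 1 \<and> i * f s = 1" if "s \<in> S" for s
    using subsetD [OF unit imageI [OF that]] by (simp add: type_algebra_Units_iff)
  have SR: "s \<in> carrier R" if "s \<in> S" for s using S that by blast
  show "right_ore_set R S"
    unfolding right_ore_set_def
  proof (intro ballI)
    fix r s assume r: "r \<in> carrier R" and s: "s \<in> S"
    obtain i where i: "f s * i = 1" using inv [OF s] by blast
    obtain r' s' where r': "r' \<in> carrier R" "s' \<in> S" "i * f r * f s' = f r'" using right by blast
    have "f (s \<otimes>\<^bsub>R\<^esub> r') = f s * (i * f r * f s')" by (simp add: fD SR s r'(1) r'(3))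
    also have "\<dots> = f s * i * (f r * f s')" by (simp only: mult.assoc)
    also have "\<dots> = f (r \<otimes>\<^bsub>R\<^esub> s')" by (simp add: i fD r SR r'(2))
    finally have "r \<otimes>\<^bsub>R\<^esub> s' = s \<otimes>\<^bsub>R\<^esub> r'"
      by (intro inj_onD [OF inj]) (simp_all add: r SR s r'(1,2))
    then show "\<exists>r'\<in>carrier R. \<exists>s'\<in>S. r \<otimes>\<^bsub>R\<^esub> s' = s \<otimes>\<^bsub>R\<^esub> r'" using r' by blast
  qed
  show "left_ore_set R S"
    unfolding left_ore_set_def
  proof (intro ballI)
    fix r s assume r: "r \<in> carrier R" and s: "s \<in> S"
    obtain i where i: "i * f s = 1" using inv [OF s] by blast
    obtain r' s' where r': "r' \<in> carrier R" "s' \<in> S" "f s' * (f r * i) = f r'" using left by blast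
    have "f (r' \<otimes>\<^bsub>R\<^esub> s) = f s' * (f r * i) * f s" by (simp add: fD SR s r'(1) r'(3))
    also have "\<dots> = f s' * f r * (i * f s)" by (simp only: mult.assoc)
    also have "\<dots> = f (s' \<otimes>\<^bsub>R\<^esub> r)" by (simp add: i fD r SR r'(2))
    finally have "s' \<otimes>\<^bsub>R\<^esub> r = r' \<otimes>\<^bsub>R\<^esub> s"
      by (intro inj_onD [OF inj]) (simp_all add: r SR s r'(1,2))
    then show "\<exists>r'\<in>carrier R. \<exists>s'\<in>S. s' \<otimes>\<^bsub>R\<^esub> r = r' \<otimes>\<^bsub>R\<^esub> s" using r' by blast
  qed
qed

lemma ideal_image_closed:
  fixes f :: "'a \<Rightarrow> 't::ring_1"
  assumes R: "ring R" and f: "f \<in> ring_hom R ring_of_type_algebra" and I: "ideal I R"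
  shows "A \<in> f ` I \<Longrightarrow> B \<in> f ` I \<Longrightarrow> A + B \<in> f ` I"
    and "A \<in> f ` carrier R \<Longrightarrow> B \<in> f ` I \<Longrightarrow> A * B \<in> f ` I"
    and "A \<in> f ` carrier R \<Longrightarrow> B \<in> f ` I \<Longrightarrow> B * A \<in> f ` I"
proof -
  interpret ideal I R by (rule I)
  note fD = ring_hom_type_algebraD [OF f]
  show "A + B \<in> f ` I" if "A \<in> f ` I" "B \<in> f ` I"
  proof -
    from that obtain a b where "a \<in> I" "b \<in> I" "A = f a" "B = f b" by blast
    then show ?thesis
      using fD(2) [of a b] additive_subgroup.a_closed [OF is_additive_subgroup, of a b] a_Hcarr
      by (metis imageI)
  qed
  show "A * B \<in> f ` I" if "A \<in> f ` carrier R" "B \<in> f ` I"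
  proof -
    from that obtain a b where "a \<in> carrier R" "b \<in> I" "A = f a" "B = f b" by blast
    then show ?thesis using fD(1) [of a b] I_l_closed [of b a] a_Hcarr by (metis imageI)
  qed
  show "B * A \<in> f ` I" if "A \<in> f ` carrier R" "B \<in> f ` I"
  proof -
    from that obtain a b where "a \<in> carrier R" "b \<in> I" "A = f a" "B = f b" by blast
    then show ?thesis using fD(1) [of b a] I_r_closed [of b a] a_Hcarr by (metis imageI)
  qed
qed

lemma simple_ringI_embedded:
  fixes f :: "'a \<Rightarrow> 't::ring_1"
  assumes R: "ring R" and f: "f \<in> ring_hom R ring_of_type_algebra" and inj: "inj_on f (carrier R)"
    and 1: "\<And>I A. ideal I R \<Longrightarrow> A \<in> f ` I \<Longrightarrow> A \<noteq> 0 \<Longrightarrow> 1 \<in> f ` I"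
  shows "simple_ring R"
  unfolding simple_ring_def
proof (intro conjI allI impI)
  interpret R: ring R by (rule R)
  note fD = ring_hom_type_algebraD [OF f]
  have f0: "f \<zero>\<^bsub>R\<^esub> = 0" by (rule ring_hom_type_algebra_0 [OF R f])
  show "ring R" by (rule R)
  show "\<one>\<^bsub>R\<^esub> \<noteq> \<zero>\<^bsub>R\<^esub>" using f0 fD(3) by auto
  fix I assume I: "ideal I R"
  interpret I: ideal I R by (rule I)
  show "I = {\<zero>\<^bsub>R\<^esub>} \<or> I = carrier R"
  proof (cases "\<exists>a\<in>I. a \<noteq> \<zero>\<^bsub>R\<^esub>")
    case False
    then show ?thesis using additive_subgroup.zero_closed [OF I.is_additive_subgroup] by blast
  next
    case True
    then obtain a where a: "a \<in> I" "a \<noteq> \<zero>\<^bsub>R\<^esub>" by blast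
    have "f a \<noteq> f \<zero>\<^bsub>R\<^esub>" using inj_onD [OF inj, of a "\<zero>\<^bsub>R\<^esub>"] a I.a_Hcarr by auto
    then have "1 \<in> f ` I" using 1 [OF I, of "f a"] a(1) f0 by auto
    then obtain u where u: "u \<in> I" "f u = 1" by force
    then have "u = \<one>\<^bsub>R\<^esub>" using inj_onD [OF inj, of u "\<one>\<^bsub>R\<^esub>"] I.a_Hcarr fD(3) by auto
    then show ?thesis using u(1) I.one_imp_carrier by blast
  qed
qed

lemma simple_ring_imp_prime_ring:
  assumes "simple_ring R"
  shows "prime_ring R"
  unfolding prime_ring_def
proof (intro conjI allI impI)
  note s = assms [unfolded simple_ring_def]
  show R: "ring R" and ne: "\<one>\<^bsub>R\<^esub> \<noteq> \<zero>\<^bsub>R\<^esub>" using s by blast+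
  interpret R: ring R by (rule R)
  fix I J assume IJ: "ideal I R \<and> ideal J R \<and> (\<forall>a\<in>I. \<forall>b\<in>J. a \<otimes>\<^bsub>R\<^esub> b = \<zero>\<^bsub>R\<^esub>)"
  show "I = {\<zero>\<^bsub>R\<^esub>} \<or> J = {\<zero>\<^bsub>R\<^esub>}"
  proof (rule ccontr)
    assume "\<not> ?thesis"
    then have "I = carrier R" "J = carrier R" using s IJ by blast+
    then have "\<one>\<^bsub>R\<^esub> \<otimes>\<^bsub>R\<^esub> \<one>\<^bsub>R\<^esub> = \<zero>\<^bsub>R\<^esub>" using IJ R.one_closed by blast
    then show False using ne by simp
  qed
qed

lemma skewfieldI_division_ring:
  fixes f :: "'a \<Rightarrow> 't::division_ring"
  assumes R: "ring R" and f: "f \<in> ring_hom R ring_of_type_algebra" and bij: "bij_betw f (carrier R) UNIV"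
  shows "skewfield R"
proof -
  interpret R: ring R by (rule R)
  note fD = ring_hom_type_algebraD [OF f]
  have inj: "inj_on f (carrier R)" using bij by (simp add: bij_betw_def)
  have f0: "f \<zero>\<^bsub>R\<^esub> = 0" by (rule ring_hom_type_algebra_0 [OF R f])
  have ne: "\<one>\<^bsub>R\<^esub> \<noteq> \<zero>\<^bsub>R\<^esub>" using f0 fD(3) by auto
  have "a \<in> Units R" if a: "a \<in> carrier R" "a \<noteq> \<zero>\<^bsub>R\<^esub>" for a
  proof -
    have "f a \<noteq> 0" using inj_onD [OF inj, of a "\<zero>\<^bsub>R\<^esub>"] a f0 by auto
    obtain b where b: "b \<in> carrier R" "f b = inverse (f a)"
      using bij_betw_imp_surj_on [OF bij] by (metis UNIV_I imageE)
    have "f (a \<otimes>\<^bsub>R\<^esub> b) = f \<one>\<^bsub>R\<^esub>" "f (b \<otimes>\<^bsub>R\<^esub> a) = f \<one>\<^bsub>R\<^esub>"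
      using fD a(1) b \<open>f a \<noteq> 0\<close> by simp_all
    then have "a \<otimes>\<^bsub>R\<^esub> b = \<one>\<^bsub>R\<^esub>" "b \<otimes>\<^bsub>R\<^esub> a = \<one>\<^bsub>R\<^esub>"
      using inj_onD [OF inj, of "a \<otimes>\<^bsub>R\<^esub> b" "\<one>\<^bsub>R\<^esub>"] inj_onD [OF inj, of "b \<otimes>\<^bsub>R\<^esub> a" "\<one>\<^bsub>R\<^esub>"] a(1) b(1)
      by simp_all
    then show ?thesis using a(1) b(1) unfolding Units_def by blast
  qed
  moreover have "\<zero>\<^bsub>R\<^esub> \<notin> Units R"
  proof
    assume "\<zero>\<^bsub>R\<^esub> \<in> Units R"
    then obtain x where "x \<in> carrier R" "x \<otimes>\<^bsub>R\<^esub> \<zero>\<^bsub>R\<^esub> = \<one>\<^bsub>R\<^esub>" unfolding Units_def by blast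
    then show False using ne by simp
  qed
  ultimately have "Units R = carrier R - {\<zero>\<^bsub>R\<^esub>}"
    using R.Units_closed by blast
  then show ?thesis using R ne by (simp add: skewfield_def)
qed

lemma mat2_ideal_contains_1:
  fixes K :: "'a::division_ring mat2 set"
  assumes add: "\<And>A B. A \<in> K \<Longrightarrow> B \<in> K \<Longrightarrow> A + B \<in> K"
    and left: "\<And>A B. B \<in> K \<Longrightarrow> A * B \<in> K" and right: "\<And>A B. B \<in> K \<Longrightarrow> B * A \<in> K"
    and N: "N \<in> K" "N \<noteq> 0"
  shows "1 \<in> K"
proof -
  obtain a b c d where abcd: "N = Mat2 a b c d" by (cases N)
  have row: "Mat2 1 0 0 0 \<in> K" if "Mat2 u v 0 0 \<in> K" "u \<noteq> 0 \<or> v \<noteq> 0" for u v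
  proof (cases "u = 0")
    case False
    then have "Mat2 (inverse u) 0 0 0 * (Mat2 u v 0 0 * Mat2 1 0 0 0) = Mat2 1 0 0 0" by simp
    then show ?thesis using left right that(1) by metis
  next
    case True
    with that(2) have "Mat2 (inverse v) 0 0 0 * (Mat2 u v 0 0 * Mat2 0 0 1 0) = Mat2 1 0 0 0" by simp
    then show ?thesis using left right that(1) by metis
  qed
  have 1: "Mat2 a b 0 0 \<in> K" using left [OF N(1), of "Mat2 1 0 0 0"] by (simp add: abcd)
  have 2: "Mat2 c d 0 0 \<in> K" using left [OF N(1), of "Mat2 0 1 0 0"] by (simp add: abcd)
  have e11: "Mat2 1 0 0 0 \<in> K"
    using row [OF 1] row [OF 2] N(2) abcd by auto
  have "Mat2 0 0 0 1 \<in> K" using right [OF left [OF e11, of "Mat2 0 0 1 0"], of "Mat2 0 1 0 0"] by simp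
  from add [OF e11 this] show ?thesis by (simp add: one_mat2_def)
qed

lemma ring_iso_through_type:
  fixes f :: "'a \<Rightarrow> 't::ring_1" and g :: "'b \<Rightarrow> 't"
  assumes R: "ring R" and f: "f \<in> ring_hom R ring_of_type_algebra" "bij_betw f (carrier R) UNIV"
    and g: "g \<in> ring_hom M ring_of_type_algebra" "bij_betw g (carrier M) UNIV"
    and closed: "\<And>a b. a \<in> carrier M \<Longrightarrow> b \<in> carrier M \<Longrightarrow> a \<otimes>\<^bsub>M\<^esub> b \<in> carrier M"
      "\<And>a b. a \<in> carrier M \<Longrightarrow> b \<in> carrier M \<Longrightarrow> a \<oplus>\<^bsub>M\<^esub> b \<in> carrier M" "\<one>\<^bsub>M\<^esub> \<in> carrier M"
  obtains h where "h \<in> ring_iso R M" "\<And>r. r \<in> carrier R \<Longrightarrow> g (h r) = f r"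
proof -
  interpret R: ring R by (rule R)
  define h where "h = (\<lambda>r. inv_into (carrier M) g (f r))"
  have gM: "g ` carrier M = UNIV" and inj: "inj_on g (carrier M)" using g(2) by (simp_all add: bij_betw_def)
  have gh: "g (h r) = f r" for r unfolding h_def by (rule f_inv_into_f) (simp add: gM)
  have hM: "h r \<in> carrier M" for r unfolding h_def by (rule inv_into_into) (simp add: gM)
  note fD = ring_hom_type_algebraD [OF f(1)] and gD = ring_hom_type_algebraD [OF g(1)]
  have "h \<in> ring_iso R M"
  proof (rule ring_iso_memI)
    fix x y assume xy: "x \<in> carrier R" "y \<in> carrier R"
    show "h (x \<otimes>\<^bsub>R\<^esub> y) = h x \<otimes>\<^bsub>M\<^esub> h y"
      by (rule inj_onD [OF inj]) (simp_all add: gh gD hM closed fD xy)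
    show "h (x \<oplus>\<^bsub>R\<^esub> y) = h x \<oplus>\<^bsub>M\<^esub> h y"
      by (rule inj_onD [OF inj]) (simp_all add: gh gD hM closed fD xy)
  next
    show "h \<one>\<^bsub>R\<^esub> = \<one>\<^bsub>M\<^esub>"
      by (rule inj_onD [OF inj]) (simp_all add: gh gD hM closed fD)
    have "bij_betw (inv_into (carrier M) g) UNIV (carrier M)" by (rule bij_betw_inv_into [OF g(2)])
    from bij_betw_trans [OF f(2) this] show "bij_betw h (carrier R) (carrier M)"
      by (simp add: h_def comp_def)
  qed (simp add: hM)
  then show thesis using that gh by blast
qed

lemma matrix_ring_2_iso:
  fixes f :: "'a \<Rightarrow> 't::ring_1" and D :: "('a, 'm) ring_scheme"
  assumes D: "ring D" and f: "f \<in> ring_hom D ring_of_type_algebra" "bij_betw f (carrier D) UNIV"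
  defines "M \<equiv> matrix_ring 2 D"
    and "g \<equiv> \<lambda>A. Mat2 (f (A (0, 0))) (f (A (0, 1))) (f (A (1, 0))) (f (A (1::nat, 1::nat)))"
  shows "g \<in> ring_hom M ring_of_type_algebra" "bij_betw g (carrier M) UNIV"
    and "A \<in> carrier M \<Longrightarrow> B \<in> carrier M \<Longrightarrow> A \<otimes>\<^bsub>M\<^esub> B \<in> carrier M"
    and "A \<in> carrier M \<Longrightarrow> B \<in> carrier M \<Longrightarrow> A \<oplus>\<^bsub>M\<^esub> B \<in> carrier M"
    and "\<one>\<^bsub>M\<^esub> \<in> carrier M"
    and "d \<in> carrier D \<Longrightarrow> scalar_matrix 2 D d \<in> carrier M"
    and "d \<in> carrier D \<Longrightarrow> g (scalar_matrix 2 D d) = scalar2 (f d)"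
proof -
  interpret D: ring D by (rule D)
  note fD = ring_hom_type_algebraD [OF f(1)]
  have f0: "f \<zero>\<^bsub>D\<^esub> = 0" by (rule ring_hom_type_algebra_0 [OF D f(1)])
  have I: "{..<2::nat} = {0, 1}" by auto
  have fin: "(\<Oplus>\<^bsub>D\<^esub>l\<in>{..<2::nat}. F l) = F 0 \<oplus>\<^bsub>D\<^esub> F 1" if "F 0 \<in> carrier D" "F 1 \<in> carrier D" for F
    unfolding I using that by (simp add: D.finsum_insert)
  have entry: "A (i, j) \<in> carrier D" if "A \<in> carrier M" "i < 2" "j < 2" for A i j
    using that unfolding M_def matrix_ring_def by (auto simp: PiE_def Pi_def)
  have mult: "(A \<otimes>\<^bsub>M\<^esub> B) (i, j) = A (i, 0) \<otimes>\<^bsub>D\<^esub> B (0, j) \<oplus>\<^bsub>D\<^esub> A (i, 1) \<otimes>\<^bsub>D\<^esub> B (1, j)"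
    if "A \<in> carrier M" "B \<in> carrier M" "i < 2" "j < 2" for A B i j
  proof -
    have "(A \<otimes>\<^bsub>M\<^esub> B) (i, j) = (\<Oplus>\<^bsub>D\<^esub>l\<in>{..<2}. A (i, l) \<otimes>\<^bsub>D\<^esub> B (l, j))"
      unfolding M_def matrix_ring_def using that by simp
    also have "\<dots> = A (i, 0) \<otimes>\<^bsub>D\<^esub> B (0, j) \<oplus>\<^bsub>D\<^esub> A (i, 1) \<otimes>\<^bsub>D\<^esub> B (1, j)"
      by (rule fin) (use that entry in simp_all)
    finally show ?thesis .
  qed
  have add: "(A \<oplus>\<^bsub>M\<^esub> B) (i, j) = A (i, j) \<oplus>\<^bsub>D\<^esub> B (i, j)" if "i < 2" "j < 2" for A B i j
    unfolding M_def matrix_ring_def using that by simp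
  have one: "\<one>\<^bsub>M\<^esub> (i, j) = (if i = j then \<one>\<^bsub>D\<^esub> else \<zero>\<^bsub>D\<^esub>)" if "i < 2" "j < 2" for i j
    unfolding M_def matrix_ring_def using that by simp
  have carrierI: "A \<in> carrier M"
    if "A \<in> extensional ({..<2} \<times> {..<2})" "\<And>i j. i < 2 \<Longrightarrow> j < 2 \<Longrightarrow> A (i, j) \<in> carrier D" for A
    using that unfolding M_def matrix_ring_def by (auto simp: PiE_def)
  show mult_closed: "A \<otimes>\<^bsub>M\<^esub> B \<in> carrier M" if "A \<in> carrier M" "B \<in> carrier M" for A B
  proof (rule carrierI)
    show "A \<otimes>\<^bsub>M\<^esub> B \<in> extensional ({..<2} \<times> {..<2})" unfolding M_def matrix_ring_def by simp
  qed (use that entry in \<open>simp add: mult\<close>)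
  show add_closed: "A \<oplus>\<^bsub>M\<^esub> B \<in> carrier M" if "A \<in> carrier M" "B \<in> carrier M" for A B
  proof (rule carrierI)
    show "A \<oplus>\<^bsub>M\<^esub> B \<in> extensional ({..<2} \<times> {..<2})" unfolding M_def matrix_ring_def by simp
  qed (use that entry in \<open>simp add: add\<close>)
  show one_closed: "\<one>\<^bsub>M\<^esub> \<in> carrier M"
  proof (rule carrierI)
    show "\<one>\<^bsub>M\<^esub> \<in> extensional ({..<2} \<times> {..<2})" unfolding M_def matrix_ring_def by simp
  qed (simp add: one)
  show "scalar_matrix 2 D d \<in> carrier M" if "d \<in> carrier D"
    by (rule carrierI) (use that in \<open>simp_all add: scalar_matrix_def\<close>)
  show "g (scalar_matrix 2 D d) = scalar2 (f d)" if "d \<in> carrier D"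
    by (simp add: g_def scalar_matrix_def f0)
  show "g \<in> ring_hom M ring_of_type_algebra"
    unfolding type_algebra_ring_hom_iff
  proof (intro conjI ballI)
    fix A B assume AB: "A \<in> carrier M" "B \<in> carrier M"
    show "g (A \<otimes>\<^bsub>M\<^esub> B) = g A * g B"
      unfolding g_def by (simp add: mult AB fD entry)
    show "g (A \<oplus>\<^bsub>M\<^esub> B) = g A + g B"
      unfolding g_def by (simp add: add AB fD entry)
  next
    show "g \<one>\<^bsub>M\<^esub> = 1" unfolding g_def by (simp add: one fD f0)
  qed
  show "bij_betw g (carrier M) UNIV"
    unfolding bij_betw_def
  proof
    have inj: "inj_on f (carrier D)" and surj: "f ` carrier D = UNIV" using f(2) by (simp_all add: bij_betw_def)
    show "inj_on g (carrier M)"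
    proof (rule inj_onI)
      fix A B assume AB: "A \<in> carrier M" "B \<in> carrier M" and eq: "g A = g B"
      have "A (i, j) = B (i, j)" if "i < 2" "j < 2" for i j
      proof (rule inj_onD [OF inj])
        from that have "i = 0 \<or> i = 1" "j = 0 \<or> j = 1" by auto
        then show "f (A (i, j)) = f (B (i, j))" using eq unfolding g_def by auto
      qed (use AB that entry in simp_all)
      then show "A = B"
        using AB unfolding M_def matrix_ring_def partial_object.simps
        by (intro PiE_ext) auto
    qed
    have "\<exists>A\<in>carrier M. N = g A" for N
    proof -
      obtain a b c d where N: "N = Mat2 a b c d" by (cases N)
      define i where "i = inv_into (carrier D) f"
      have i: "f (i x) = x" "i x \<in> carrier D" for x
        unfolding i_def by (rule f_inv_into_f, simp add: surj, rule inv_into_into, simp add: surj)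
      define A where "A = (\<lambda>(k, l)\<in>{..<2}\<times>{..<2}. i (if k = (0::nat) then (if l = (0::nat) then a else b) else (if l = 0 then c else d)))"
      have "A \<in> carrier M" by (rule carrierI) (simp_all add: A_def i)
      moreover have "N = g A" by (simp add: g_def A_def N i)
      ultimately show ?thesis by blast
    qed
    then show "g ` carrier M = UNIV" by blast
  qed
qed

lemma mat2_center:
  "(\<forall>B. A * B = B * A) \<longleftrightarrow> (\<exists>a. A = scalar2 a \<and> (\<forall>b. a * b = b * (a :: 'a::ring_1)))"
proof
  assume comm: "\<forall>B. A * B = B * A"
  obtain a b c d where A: "A = Mat2 a b c d" by (cases A)
  have "c = 0" "d = a" using comm [rule_format, of "Mat2 0 1 0 0"] by (auto simp: A)
  moreover have "b = 0" using comm [rule_format, of "Mat2 0 0 1 0"] by (auto simp: A)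
  moreover have "a * u = u * a" for u using comm [rule_format, of "Mat2 u 0 0 0"] by (auto simp: A)
  ultimately show "\<exists>a. A = scalar2 a \<and> (\<forall>b. a * b = b * a)" using A by blast
next
  assume "\<exists>a. A = scalar2 a \<and> (\<forall>b. a * b = b * a)"
  then obtain a where a: "A = scalar2 a" "\<And>b. a * b = b * a" by blast
  show "\<forall>B. A * B = B * A"
  proof
    fix B show "A * B = B * A" by (cases B) (simp add: a)
  qed
qed

lemma ring_center_transfer:
  fixes f :: "'a \<Rightarrow> 't::ring_1"
  assumes R: "ring R" and f: "f \<in> ring_hom R ring_of_type_algebra" "bij_betw f (carrier R) UNIV"
    and z: "z \<in> carrier R"
  shows "z \<in> ring_center R \<longleftrightarrow> (\<forall>b. f z * b = b * f z)"
proof -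
  interpret R: ring R by (rule R)
  note fD = ring_hom_type_algebraD [OF f(1)]
  have inj: "inj_on f (carrier R)" and surj: "f ` carrier R = UNIV" using f(2) by (simp_all add: bij_betw_def)
  have "z \<otimes>\<^bsub>R\<^esub> r = r \<otimes>\<^bsub>R\<^esub> z \<longleftrightarrow> f z * f r = f r * f z" if "r \<in> carrier R" for r
    using inj_on_eq_iff [OF inj, of "z \<otimes>\<^bsub>R\<^esub> r" "r \<otimes>\<^bsub>R\<^esub> z"] fD(1) z that by simp
  then have "z \<in> ring_center R \<longleftrightarrow> (\<forall>r\<in>carrier R. f z * f r = f r * f z)"
    unfolding ring_center_def using z by simp
  also have "\<dots> \<longleftrightarrow> (\<forall>b\<in>f ` carrier R. f z * b = b * f z)" by blast
  finally show ?thesis unfolding surj by simp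
qed

lemma central_simple_over_mat2:
  fixes f :: "'d \<Rightarrow> 't::division_ring" and g :: "'a \<Rightarrow> 't mat2"
  assumes D: "ring D" and f: "f \<in> ring_hom D ring_of_type_algebra" "bij_betw f (carrier D) UNIV"
    and Q: "ring Q" and g: "g \<in> ring_hom Q ring_of_type_algebra" "bij_betw g (carrier Q) UNIV"
    and \<iota>: "\<And>d. d \<in> carrier D \<Longrightarrow> \<iota> d \<in> carrier Q" "\<And>d. d \<in> carrier D \<Longrightarrow> g (\<iota> d) = scalar2 (f d)"
  shows "central_simple_over D Q \<iota>"
  unfolding central_simple_over_def
proof (intro conjI)
  interpret D: ring D by (rule D)
  interpret Q: ring Q by (rule Q)
  note fD = ring_hom_type_algebraD [OF f(1)] and gD = ring_hom_type_algebraD [OF g(1)]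
  have f_surj: "f ` carrier D = UNIV" using f(2) by (simp_all add: bij_betw_def)
  have g_inj: "inj_on g (carrier Q)" and g_surj: "g ` carrier Q = UNIV" using g(2) by (simp_all add: bij_betw_def)
  have g0: "g \<zero>\<^bsub>Q\<^esub> = 0" by (rule ring_hom_type_algebra_0 [OF Q g(1)])
  show "skewfield D" by (rule skewfieldI_division_ring [OF D f])
  show "simple_ring Q"
  proof (rule simple_ringI_embedded [OF Q g(1) g_inj])
    fix I A assume I: "ideal I Q" and A: "A \<in> g ` I" "A \<noteq> 0"
    note closed = ideal_image_closed [OF Q g(1) I, unfolded g_surj]
    show "1 \<in> g ` I"
      by (rule mat2_ideal_contains_1 [OF closed(1) closed(2) [OF UNIV_I] closed(3) [OF UNIV_I] A])
  qed
  show "\<iota> \<in> ring_hom D Q"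
  proof (rule ring_hom_memI)
    fix x y assume xy: "x \<in> carrier D" "y \<in> carrier D"
    show "\<iota> x \<in> carrier Q" using \<iota>(1) xy by blast
    show "\<iota> (x \<otimes>\<^bsub>D\<^esub> y) = \<iota> x \<otimes>\<^bsub>Q\<^esub> \<iota> y"
      by (rule inj_onD [OF g_inj]) (simp_all add: \<iota> xy fD gD)
    show "\<iota> (x \<oplus>\<^bsub>D\<^esub> y) = \<iota> x \<oplus>\<^bsub>Q\<^esub> \<iota> y"
      by (rule inj_onD [OF g_inj]) (simp_all add: \<iota> xy fD gD)
  next
    show "\<iota> \<one>\<^bsub>D\<^esub> = \<one>\<^bsub>Q\<^esub>"
      by (rule inj_onD [OF g_inj]) (simp_all add: \<iota> fD gD)
  qed
  show "ring_center Q = \<iota> ` ring_center D"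
  proof (intro equalityI subsetI)
    fix z assume z: "z \<in> ring_center Q"
    then have zQ: "z \<in> carrier Q" by (simp add: ring_center_def)
    obtain a where a: "g z = scalar2 a" "\<forall>b. a * b = b * a"
      using z ring_center_transfer [OF Q g zQ] mat2_center [of "g z"] by blast
    obtain d where d: "d \<in> carrier D" "f d = a" using f_surj by (metis UNIV_I imageE)
    have "z = \<iota> d" by (rule inj_onD [OF g_inj]) (simp_all add: a(1) d \<iota> zQ)
    moreover have "d \<in> ring_center D" using ring_center_transfer [OF D f d(1)] a(2) d(2) by simp
    ultimately show "z \<in> \<iota> ` ring_center D" by blast
  next
    fix z assume "z \<in> \<iota> ` ring_center D"
    then obtain d where d: "d \<in> ring_center D" "z = \<iota> d" by blast
    then have dD: "d \<in> carrier D" by (simp add: ring_center_def)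
    have "\<forall>b. f d * b = b * f d" using d(1) ring_center_transfer [OF D f dD] by blast
    then have "\<forall>B. g z * B = B * g z"
      using mat2_center [of "g z"] \<iota>(2) [OF dD] d(2) by blast
    then show "z \<in> ring_center Q" using ring_center_transfer [OF Q g \<iota>(1) [OF dD]] d(2) by blast
  qed
  define i where "i = inv_into (carrier Q) g"
  define j where "j = inv_into (carrier D) f"
  have i: "g (i x) = x" "i x \<in> carrier Q" for x
    unfolding i_def by (rule f_inv_into_f, simp add: g_surj, rule inv_into_into, simp add: g_surj)
  have j: "f (j x) = x" "j x \<in> carrier D" for x
    unfolding j_def by (rule f_inv_into_f, simp add: f_surj, rule inv_into_into, simp add: f_surj)
  define U where "U = {Mat2 1 0 0 0, Mat2 0 1 0 0, Mat2 0 0 1 0, Mat2 0 0 0 (1 :: 't)}"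
  define coef where "coef N u = (if m11 u = 1 then m11 N else if m12 u = 1 then m12 N
    else if m21 u = 1 then m21 N else m22 N)" for N u :: "'t mat2"
  have finsum: "g (finsum Q F B) = (\<Sum>b\<in>B. g (F b))"
    if "finite B" "F \<in> B \<rightarrow> carrier Q" for F and B :: "'a set"
    using that by (induction rule: finite_induct) (simp_all add: g0 gD Pi_def Q.finsum_insert)
  have "\<exists>c\<in>i ` U \<rightarrow> carrier D. q = (\<Oplus>\<^bsub>Q\<^esub>b\<in>i ` U. \<iota> (c b) \<otimes>\<^bsub>Q\<^esub> b)" if q: "q \<in> carrier Q" for q
  proof
    define c where "c b = j (coef (g q) (g b))" for b
    have cD: "c b \<in> carrier D" for b by (simp add: c_def j)
    then show "c \<in> i ` U \<rightarrow> carrier D" by simp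
    have closed: "(\<lambda>b. \<iota> (c b) \<otimes>\<^bsub>Q\<^esub> b) \<in> i ` U \<rightarrow> carrier Q" using \<iota>(1) cD i by auto
    have "g (\<Oplus>\<^bsub>Q\<^esub>b\<in>i ` U. \<iota> (c b) \<otimes>\<^bsub>Q\<^esub> b) = (\<Sum>b\<in>i ` U. g (\<iota> (c b) \<otimes>\<^bsub>Q\<^esub> b))"
      by (rule finsum [OF _ closed]) (simp add: U_def)
    also have "\<dots> = (\<Sum>b\<in>i ` U. scalar2 (coef (g q) (g b)) * g b)"
      by (rule sum.cong) (auto simp: gD \<iota> cD i c_def j)
    also have "\<dots> = (\<Sum>u\<in>U. scalar2 (coef (g q) u) * u)"
      by (subst sum.reindex) (auto intro: inj_on_inverseI [of _ g] simp: i)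
    also have "\<dots> = g q" by (cases "g q") (simp add: U_def coef_def)
    finally show "q = (\<Oplus>\<^bsub>Q\<^esub>b\<in>i ` U. \<iota> (c b) \<otimes>\<^bsub>Q\<^esub> b)"
      by (intro inj_onD [OF g_inj]) (simp_all add: q Q.finsum_closed [OF closed])
  qed
  then show "\<exists>B\<subseteq>carrier Q. finite B \<and> (\<forall>q\<in>carrier Q. \<exists>c\<in>B \<rightarrow> carrier D. q = (\<Oplus>\<^bsub>Q\<^esub>b\<in>B. \<iota> (c b) \<otimes>\<^bsub>Q\<^esub> b))"
    using i(2) by (intro exI [of _ "i ` U"]) (auto simp: U_def)
qed

section \<open>Localizations of the super Jordan plane\<close>

lemma frac_mat_scalar_unit:
  "b \<noteq> 0 \<Longrightarrow> frac_mat (scalar2 b) * scalar2 (inverse (frac b)) = 1"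
  "b \<noteq> 0 \<Longrightarrow> scalar2 (inverse (frac b)) * frac_mat (scalar2 b) = 1"
  by (simp_all add: frac_mat_simps)

lemma frac_mat_scalar_Units: "b \<noteq> 0 \<Longrightarrow> frac_mat (scalar2 b) \<in> Units ring_of_type_algebra"
  unfolding type_algebra_Units_iff using frac_mat_scalar_unit by blast

locale jordan_fraction_embedding =
  fixes \<sigma> :: "'k::field_char_0 jordan_elt \<Rightarrow> 'k weyl fraction mat2"
  assumes hom: "\<sigma> \<in> ring_hom super_jordan ring_of_type_algebra"
    and inj: "inj_on \<sigma> (carrier super_jordan)"
    and image: "\<sigma> ` carrier super_jordan = frac_mat ` jordan_mats"
    and \<sigma>_x: "\<sigma> jordan_x = frac_mat (Mat2 0 1 0 0)"
    and \<sigma>_y: "\<sigma> jordan_y = frac_mat (Mat2 0 (weyl_t * weyl_d) weyl_t 0)"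
    and \<sigma>_const: "\<sigma> (jordan_const c) = frac_mat (scalar2 (weyl_c c))"
begin

abbreviation "J \<equiv> super_jordan :: 'k jordan_elt ring"

lemma ring_J: "ring J"
  unfolding super_jordan_def by (rule ring_presented_algebra)

sublocale J: ring J
  by (rule ring_J)

lemmas \<sigma>_simps = ring_hom_type_algebraD [OF hom]

lemma \<sigma>_0: "\<sigma> \<zero>\<^bsub>J\<^esub> = 0"
  by (rule ring_hom_type_algebra_0 [OF ring_J hom])

lemma gens_closed: "jordan_x \<in> carrier J" "jordan_y \<in> carrier J" "jordan_const c \<in> carrier J"
  by (simp_all add: super_jordan_def carrier_presented_algebra jordan_x_def jordan_y_def
      jordan_const_def)

lemma \<sigma>_mem: "r \<in> carrier J \<Longrightarrow> \<exists>N\<in>jordan_mats. \<sigma> r = frac_mat N"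
  using image by blast

lemma mem_\<sigma>: "N \<in> jordan_mats \<Longrightarrow> \<exists>r\<in>carrier J. \<sigma> r = frac_mat N"
  using image by (metis (no_types, lifting) imageE imageI)

lemma s_closed: "jordan_s \<in> carrier J"
  unfolding jordan_s_def using gens_closed by simp

lemma \<sigma>_s_power: "\<sigma> (jordan_s [^]\<^bsub>J\<^esub> n) = frac_mat (scalar2 (weyl_t ^ n))" for n :: nat
proof (induction n)
  case 0
  show ?case by (simp add: \<sigma>_simps frac_mat_simps)
next
  case (Suc n)
  have "\<sigma> jordan_s = frac_mat (scalar2 weyl_t)"
    unfolding jordan_s_def by (simp add: \<sigma>_simps gens_closed \<sigma>_x \<sigma>_y frac_mat_simps)
  then show ?case
    using Suc by (simp add: \<sigma>_simps s_closed power_Suc2 del: power_Suc flip: frac_mat_simps(6))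
qed

lemma s_powers_closed: "jordan_s_powers \<subseteq> carrier J"
  unfolding jordan_s_powers_def using s_closed by auto

lemma s_powersE:
  assumes "s \<in> jordan_s_powers"
  obtains n where "s = jordan_s [^]\<^bsub>J\<^esub> n" "\<sigma> s = frac_mat (scalar2 (weyl_t ^ n))"
  using assms \<sigma>_s_power unfolding jordan_s_powers_def by blast

lemma s_power_mem: "jordan_s [^]\<^bsub>J\<^esub> (n::nat) \<in> jordan_s_powers"
  unfolding jordan_s_powers_def by blast

lemma s_powers_units: "\<sigma> ` jordan_s_powers \<subseteq> Units ring_of_type_algebra"
proof
  fix x assume "x \<in> \<sigma> ` jordan_s_powers"
  then obtain n where "x = frac_mat (scalar2 (weyl_t ^ n))" by (metis imageE s_powersE)
  then show "x \<in> Units ring_of_type_algebra"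
    using frac_mat_scalar_Units [OF weyl_t_power_nonzero] by simp
qed

lemma s_powers_regular: "jordan_s_powers \<subseteq> regular_elements J"
  using unit_preimage_regular [OF ring_J hom inj] s_powers_closed s_powers_units by blast

lemma s_powers_ore: "right_ore_set J jordan_s_powers" "left_ore_set J jordan_s_powers"
proof -
  show "right_ore_set J jordan_s_powers"
    unfolding right_ore_set_def
  proof (intro ballI)
    fix r s :: "'k jordan_elt" assume r: "r \<in> carrier J" and s: "s \<in> jordan_s_powers"
    obtain n where n: "\<sigma> s = frac_mat (scalar2 (weyl_t ^ n))" using s by (rule s_powersE)
    have sJ: "s \<in> carrier J" using s s_powers_closed by blast
    obtain A where A: "A \<in> jordan_mats" "\<sigma> r = frac_mat A" using \<sigma>_mem r by blast
    obtain B where B: "B \<in> jordan_mats" "A * scalar2 (weyl_t ^ n) = scalar2 (weyl_t ^ n) * B"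
      using jordan_mats_normal(1) [OF A(1)] by blast
    obtain r' where r': "r' \<in> carrier J" "\<sigma> r' = frac_mat B" using mem_\<sigma> B(1) by blast
    have "r \<otimes>\<^bsub>J\<^esub> s = s \<otimes>\<^bsub>J\<^esub> r'"
      by (rule inj_onD [OF inj])
         (simp_all add: \<sigma>_simps r sJ r' A(2) n B(2) flip: frac_mat_simps(6))
    then show "\<exists>r'\<in>carrier J. \<exists>s'\<in>jordan_s_powers. r \<otimes>\<^bsub>J\<^esub> s' = s \<otimes>\<^bsub>J\<^esub> r'" using r'(1) s by blast
  qed
  show "left_ore_set J jordan_s_powers"
    unfolding left_ore_set_def
  proof (intro ballI)
    fix r s :: "'k jordan_elt" assume r: "r \<in> carrier J" and s: "s \<in> jordan_s_powers"
    obtain n where n: "\<sigma> s = frac_mat (scalar2 (weyl_t ^ n))" using s by (rule s_powersE)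
    have sJ: "s \<in> carrier J" using s s_powers_closed by blast
    obtain A where A: "A \<in> jordan_mats" "\<sigma> r = frac_mat A" using \<sigma>_mem r by blast
    obtain B where B: "B \<in> jordan_mats" "scalar2 (weyl_t ^ n) * A = B * scalar2 (weyl_t ^ n)"
      using jordan_mats_normal(2) [OF A(1)] by blast
    obtain r' where r': "r' \<in> carrier J" "\<sigma> r' = frac_mat B" using mem_\<sigma> B(1) by blast
    have "s \<otimes>\<^bsub>J\<^esub> r = r' \<otimes>\<^bsub>J\<^esub> s"
      by (rule inj_onD [OF inj])
         (simp_all add: \<sigma>_simps r sJ r' A(2) n B(2) flip: frac_mat_simps(6))
    then show "\<exists>r'\<in>carrier J. \<exists>s'\<in>jordan_s_powers. s' \<otimes>\<^bsub>J\<^esub> r = r' \<otimes>\<^bsub>J\<^esub> s" using r'(1) s by blast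
  qed
qed

lemma localization_exists:
  "\<exists>(L :: ('k jordan_elt \<times> 'k jordan_elt) set ring) \<phi>. ring_of_fractions J jordan_s_powers L \<phi>"
proof (rule ring_of_fractions_exists [OF ring_J hom inj s_powers_closed _ _ s_powers_units s_powers_ore])
  show "\<one>\<^bsub>J\<^esub> \<in> jordan_s_powers" using s_power_mem [of 0] by simp
  show "s \<otimes>\<^bsub>J\<^esub> t \<in> jordan_s_powers" if "s \<in> jordan_s_powers" "t \<in> jordan_s_powers"
    for s t :: "'k jordan_elt"
  proof -
    obtain m where "s = jordan_s [^]\<^bsub>J\<^esub> (m::nat)" using \<open>s \<in> jordan_s_powers\<close> by (rule s_powersE)
    moreover obtain n where "t = jordan_s [^]\<^bsub>J\<^esub> (n::nat)" using \<open>t \<in> jordan_s_powers\<close> by (rule s_powersE)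
    ultimately show ?thesis using s_power_mem [of "m + n"] J.nat_pow_mult [OF s_closed] by simp
  qed
qed

lemma const_commutes: "frac_mat (scalar2 (weyl_c c)) * B = B * frac_mat (scalar2 (weyl_c c))"
  for B :: "'k weyl fraction mat2"
  using mat2_center [of "scalar2 (frac (weyl_c c))"] fraction_scalar_central
  unfolding frac_mat_simps frac_0 by blast

lemma center_J: "ring_center J = range jordan_const"
proof (intro equalityI subsetI)
  fix z assume "z \<in> ring_center J"
  then have z: "z \<in> carrier J" and comm: "\<And>r. r \<in> carrier J \<Longrightarrow> z \<otimes>\<^bsub>J\<^esub> r = r \<otimes>\<^bsub>J\<^esub> z"
    unfolding ring_center_def by blast+
  obtain N where N: "\<sigma> z = frac_mat N" using \<sigma>_mem z by blast
  have "\<sigma> z * \<sigma> r = \<sigma> r * \<sigma> z" if "r \<in> carrier J" for r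
    using \<sigma>_simps(1) [OF z that] \<sigma>_simps(1) [OF that z] comm [OF that] by simp
  from this [OF gens_closed(1)] this [OF gens_closed(2)]
  obtain c where "\<sigma> z = frac_mat (scalar2 (weyl_c c))"
    using jordan_centralizer [of "\<sigma> z" 0 N] unfolding \<sigma>_x \<sigma>_y
    by (auto simp: N frac_mat_simps(3) simp flip: one_mat2_def)
  then have "z = jordan_const c"
    by (intro inj_onD [OF inj]) (simp_all add: z gens_closed \<sigma>_const)
  then show "z \<in> range jordan_const" by simp
next
  fix z :: "'k jordan_elt" assume "z \<in> range jordan_const"
  then obtain c where c: "z = jordan_const c" by blast
  have "z \<otimes>\<^bsub>J\<^esub> r = r \<otimes>\<^bsub>J\<^esub> z" if "r \<in> carrier J" for r
    by (rule inj_onD [OF inj]) (simp_all add: c gens_closed that \<sigma>_simps \<sigma>_const const_commutes)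
  then show "z \<in> ring_center J" unfolding ring_center_def using c gens_closed by blast
qed

lemma localization:
  fixes L :: "('l, 'm) ring_scheme"
  assumes frac: "ring_of_fractions J jordan_s_powers L \<phi>"
  shows "ring_center L = range (\<phi> \<circ> jordan_const)" "simple_ring L"
proof -
  obtain \<Phi> where \<Phi>: "\<Phi> \<in> ring_hom L ring_of_type_algebra" "inj_on \<Phi> (carrier L)"
    "\<And>r. r \<in> carrier J \<Longrightarrow> \<Phi> (\<phi> r) = \<sigma> r"
    and \<Phi>_image: "\<Phi> ` carrier L = {\<tau>. \<exists>r\<in>carrier J. \<exists>s\<in>jordan_s_powers. \<tau> * \<sigma> s = \<sigma> r}"
    using ring_of_fractions_universal [OF ring_J frac s_powers_regular hom inj s_powers_units] by blast
  have L: "ring L" and \<phi>: "\<phi> \<in> ring_hom J L" by (rule ring_of_fractionsD [OF frac])+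
  interpret L: ring L by (rule L)
  note \<Phi>D = ring_hom_type_algebraD [OF \<Phi>(1)]
  have \<phi>_closed: "\<phi> r \<in> carrier L" if "r \<in> carrier J" for r using ring_hom_closed [OF \<phi> that] .
  have den: "\<exists>n. \<exists>N\<in>jordan_mats. \<Phi> q * frac_mat (scalar2 (weyl_t ^ n)) = frac_mat N"
    if "q \<in> carrier L" for q
  proof -
    have "\<Phi> q \<in> \<Phi> ` carrier L" using that by blast
    then obtain r s where r: "r \<in> carrier J" "s \<in> jordan_s_powers" "\<Phi> q * \<sigma> s = \<sigma> r"
      unfolding \<Phi>_image by blast
    obtain n where "\<sigma> s = frac_mat (scalar2 (weyl_t ^ n))" using r(2) by (rule s_powersE)
    then show ?thesis using r(3) \<sigma>_mem [OF r(1)] by metis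
  qed
  show "ring_center L = range (\<phi> \<circ> jordan_const)"
  proof (intro equalityI subsetI)
    fix z assume "z \<in> ring_center L"
    then have z: "z \<in> carrier L" and comm: "\<And>r. r \<in> carrier L \<Longrightarrow> z \<otimes>\<^bsub>L\<^esub> r = r \<otimes>\<^bsub>L\<^esub> z"
      unfolding ring_center_def by blast+
    obtain n N where N: "\<Phi> z * frac_mat (scalar2 (weyl_t ^ n)) = frac_mat N" using den z by blast
    have c: "\<Phi> z * \<sigma> r = \<sigma> r * \<Phi> z" if "r \<in> carrier J" for r
      using \<Phi>D(1) [OF z \<phi>_closed [OF that]] \<Phi>D(1) [OF \<phi>_closed [OF that] z]
        comm [OF \<phi>_closed [OF that]] \<Phi>(3) [OF that] by simp
    obtain c where "\<Phi> z = frac_mat (scalar2 (weyl_c c))"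
      using jordan_centralizer [OF N c [OF gens_closed(1), unfolded \<sigma>_x] c [OF gens_closed(2), unfolded \<sigma>_y]]
      by blast
    then have "z = \<phi> (jordan_const c)"
      by (intro inj_onD [OF \<Phi>(2)]) (simp_all add: z gens_closed \<sigma>_const \<Phi>(3) \<phi>_closed)
    then show "z \<in> range (\<phi> \<circ> jordan_const)" by simp
  next
    fix z assume "z \<in> range (\<phi> \<circ> jordan_const)"
    then obtain c where c: "z = \<phi> (jordan_const c)" by auto
    have z: "z \<in> carrier L" unfolding c by (rule \<phi>_closed [OF gens_closed(3)])
    have \<Phi>z: "\<Phi> z = frac_mat (scalar2 (weyl_c c))" unfolding c by (simp add: \<Phi>(3) gens_closed \<sigma>_const)
    have "z \<otimes>\<^bsub>L\<^esub> r = r \<otimes>\<^bsub>L\<^esub> z" if "r \<in> carrier L" for r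
      by (rule inj_onD [OF \<Phi>(2)]) (simp_all add: z that \<Phi>D \<Phi>z const_commutes)
    then show "z \<in> ring_center L" unfolding ring_center_def using z by blast
  qed
  show "simple_ring L"
  proof (rule simple_ringI_embedded [OF L \<Phi>(1,2)])
    fix I A assume I: "ideal I L" and A: "A \<in> \<Phi> ` I" "A \<noteq> 0"
    note closed = ideal_image_closed [OF L \<Phi>(1) I]
    define K where "K = {N \<in> jordan_mats. frac_mat N \<in> \<Phi> ` I}"
    have mats: "frac_mat N \<in> \<Phi> ` carrier L" if "N \<in> jordan_mats" for N
      using mem_\<sigma> [OF that] \<Phi>(3) \<phi>_closed by (metis imageI)
    have s: "frac_mat (scalar2 (weyl_t ^ n)) \<in> \<Phi> ` carrier L" for n
      by (rule mats [OF jordan_mats_t_power])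
    have "scalar2 (inverse (frac weyl_t)) * \<sigma> (jordan_s [^]\<^bsub>J\<^esub> (1::nat)) = \<sigma> \<one>\<^bsub>J\<^esub>"
      unfolding \<sigma>_s_power \<sigma>_simps(3) by (simp add: frac_mat_simps)
    then have t_inv: "scalar2 (inverse (frac weyl_t)) \<in> \<Phi> ` carrier L"
      unfolding \<Phi>_image using s_power_mem by blast
    obtain q where q: "q \<in> carrier L" "A = \<Phi> q" using A(1) ideal.Icarr [OF I] by blast
    obtain n N where N: "N \<in> jordan_mats" "A * frac_mat (scalar2 (weyl_t ^ n)) = frac_mat N"
      using den [OF q(1)] q(2) by blast
    have "1 \<in> K"
    proof (rule saturated_ideal_contains_1)
      show "N \<in> K" unfolding K_def using N(1) closed(3) [OF s A(1), of n] N(2) by simp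
      show "N \<noteq> 0"
      proof
        assume "N = 0"
        then have "A * frac_mat (scalar2 (weyl_t ^ n)) * scalar2 (inverse (frac (weyl_t ^ n))) = 0"
          using N(2) by (simp add: frac_mat_simps(2))
        then show False
          unfolding mult.assoc frac_mat_scalar_unit(1) [OF weyl_t_power_nonzero] using A(2) by simp
      qed
      fix B C :: "'k weyl mat2"
      show "B + C \<in> K" if "B \<in> K" "C \<in> K"
        using that jordan_mats_closed(2) [of B C] closed(1) [of "frac_mat B" "frac_mat C"]
        unfolding K_def by (simp add: frac_mat_simps(4))
      show "B * C \<in> K" if "B \<in> jordan_mats" "C \<in> K"
        using that jordan_mats_closed(4) [of B C] closed(2) [OF mats [OF that(1)], of "frac_mat C"]
        unfolding K_def by (simp add: frac_mat_simps(6))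
      show "C * B \<in> K" if "B \<in> jordan_mats" "C \<in> K"
        using that jordan_mats_closed(4) [of C B] closed(3) [OF mats [OF that(1)], of "frac_mat C"]
        unfolding K_def by (simp add: frac_mat_simps(6))
      show "B \<in> K" if "B \<in> jordan_mats" "scalar2 weyl_t * B \<in> K"
      proof -
        have "scalar2 (inverse (frac weyl_t)) * frac_mat (scalar2 weyl_t * B) \<in> \<Phi> ` I"
          using that(2) closed(2) [OF t_inv] unfolding K_def by blast
        moreover have "scalar2 (inverse (frac weyl_t)) * frac_mat (scalar2 weyl_t * B) = frac_mat B"
          unfolding frac_mat_simps(6) mult.assoc [symmetric]
          by (subst frac_mat_scalar_unit(2)) simp_all
        ultimately show ?thesis using that(1) unfolding K_def by simp
      qed
    qed
    then show "1 \<in> \<Phi> ` I" unfolding K_def by (simp add: frac_mat_simps(3))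
  qed
qed

lemma regular_units: "\<sigma> ` regular_elements J \<subseteq> Units ring_of_type_algebra"
proof
  fix x assume "x \<in> \<sigma> ` regular_elements J"
  then obtain c where c: "c \<in> regular_elements J" "x = \<sigma> c" by blast
  have cJ: "c \<in> carrier J" by (rule subsetD [OF regular_elements_carrier c(1)])
  have "B = 0" if B: "\<sigma> c * B = 0" for B
  proof -
    obtain b N where b: "b \<noteq> 0" "N \<in> jordan_mats" "B * frac_mat (scalar2 b) = frac_mat N"
      using jordan_fraction_right by blast
    obtain r where r: "r \<in> carrier J" "\<sigma> r = frac_mat N" using mem_\<sigma> b(2) by blast
    have "\<sigma> (c \<otimes>\<^bsub>J\<^esub> r) = \<sigma> c * B * frac_mat (scalar2 b)"
      by (simp only: \<sigma>_simps cJ r b(3) mult.assoc)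
    then have "\<sigma> (c \<otimes>\<^bsub>J\<^esub> r) = \<sigma> \<zero>\<^bsub>J\<^esub>" by (simp add: B \<sigma>_0)
    then have "c \<otimes>\<^bsub>J\<^esub> r = \<zero>\<^bsub>J\<^esub>" by (rule inj_onD [OF inj]) (simp_all add: cJ r)
    then have "r = \<zero>\<^bsub>J\<^esub>" by (rule regular_elementsD(1) [OF c(1) r(1)])
    then have "B * frac_mat (scalar2 b) * scalar2 (inverse (frac b)) = 0"
      using r(2) b(3) \<sigma>_0 by simp
    then show ?thesis unfolding mult.assoc frac_mat_scalar_unit(1) [OF b(1)] by simp
  qed
  then show "x \<in> Units ring_of_type_algebra"
    unfolding type_algebra_Units_iff c(2) using mat2_unit_or_zero_divisor [of "\<sigma> c"] by blast
qed

lemma regularI: "c \<in> carrier J \<Longrightarrow> \<sigma> c \<in> Units ring_of_type_algebra \<Longrightarrow> c \<in> regular_elements J"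
  by (rule unit_preimage_regular [OF ring_J hom inj])

lemma regular_denominators:
  "\<exists>r\<in>carrier J. \<exists>s\<in>regular_elements J. \<tau> * \<sigma> s = \<sigma> r"
  "\<exists>r\<in>carrier J. \<exists>s\<in>regular_elements J. \<sigma> s * \<tau> = \<sigma> r"
proof -
  obtain b N where b: "b \<noteq> 0" "scalar2 b \<in> jordan_mats" "N \<in> jordan_mats"
    "\<tau> * frac_mat (scalar2 b) = frac_mat N" using jordan_fraction_right by blast
  obtain r s where "r \<in> carrier J" "\<sigma> r = frac_mat N" "s \<in> carrier J" "\<sigma> s = frac_mat (scalar2 b)"
    using mem_\<sigma> b(2,3) by metis
  moreover from this have "s \<in> regular_elements J"
    using regularI frac_mat_scalar_Units [OF b(1)] by simp
  ultimately show "\<exists>r\<in>carrier J. \<exists>s\<in>regular_elements J. \<tau> * \<sigma> s = \<sigma> r"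
    using b(4) by (intro bexI [of _ r] bexI [of _ s]) simp_all
next
  obtain b N where b: "b \<noteq> 0" "scalar2 b \<in> jordan_mats" "N \<in> jordan_mats"
    "frac_mat (scalar2 b) * \<tau> = frac_mat N" using jordan_fraction_left by blast
  obtain r s where "r \<in> carrier J" "\<sigma> r = frac_mat N" "s \<in> carrier J" "\<sigma> s = frac_mat (scalar2 b)"
    using mem_\<sigma> b(2,3) by metis
  moreover from this have "s \<in> regular_elements J"
    using regularI frac_mat_scalar_Units [OF b(1)] by simp
  ultimately show "\<exists>r\<in>carrier J. \<exists>s\<in>regular_elements J. \<sigma> s * \<tau> = \<sigma> r"
    using b(4) by (intro bexI [of _ r] bexI [of _ s]) simp_all
qed

lemma regular_ore: "right_ore_set J (regular_elements J)" "left_ore_set J (regular_elements J)"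
  using ore_sets_of_units [OF ring_J hom inj regular_elements_carrier regular_units regular_denominators]
  by simp_all

lemma classical_quotient_ring_exists:
  "\<exists>(Q :: ('k jordan_elt \<times> 'k jordan_elt) set ring) \<theta>. classical_quotient_ring J Q \<theta>"
proof -
  have "\<exists>(Q :: ('k jordan_elt \<times> 'k jordan_elt) set ring) \<theta>. ring_of_fractions J (regular_elements J) Q \<theta>"
  proof (rule ring_of_fractions_exists [OF ring_J hom inj regular_elements_carrier _ _ regular_units regular_ore])
    show "\<one>\<^bsub>J\<^esub> \<in> regular_elements J"
      by (rule regularI) (auto simp: \<sigma>_simps type_algebra_Units_iff intro!: exI [of _ 1])
    show "s \<otimes>\<^bsub>J\<^esub> t \<in> regular_elements J" if st: "s \<in> regular_elements J" "t \<in> regular_elements J" for s t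
    proof (rule regularI)
      have J: "s \<in> carrier J" "t \<in> carrier J" by (rule subsetD [OF regular_elements_carrier st(1)], rule subsetD [OF regular_elements_carrier st(2)])
      then show "s \<otimes>\<^bsub>J\<^esub> t \<in> carrier J" by simp
      have "\<sigma> s \<in> Units ring_of_type_algebra" "\<sigma> t \<in> Units ring_of_type_algebra"
        using st regular_units by blast+
      then show "\<sigma> (s \<otimes>\<^bsub>J\<^esub> t) \<in> Units ring_of_type_algebra"
        using monoid.Units_m_closed [OF ring.is_monoid [OF ring_type_algebra]]
        by (metis \<sigma>_simps(1) J type_algebra_simps(2))
    qed
  qed
  then show ?thesis unfolding classical_quotient_ring_def using regular_ore by blast
qed

lemma classical_quotient_ring_iso:
  fixes Q :: "('q, 'm) ring_scheme"
  assumes "classical_quotient_ring J Q \<theta>"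
  obtains \<Phi> where "\<Phi> \<in> ring_hom Q ring_of_type_algebra" "bij_betw \<Phi> (carrier Q) UNIV"
    "\<And>r. r \<in> carrier J \<Longrightarrow> \<Phi> (\<theta> r) = \<sigma> r"
proof -
  have frac: "ring_of_fractions J (regular_elements J) Q \<theta>"
    using assms unfolding classical_quotient_ring_def by blast
  obtain \<Phi> where "\<Phi> \<in> ring_hom Q ring_of_type_algebra" "inj_on \<Phi> (carrier Q)"
    "\<And>r. r \<in> carrier J \<Longrightarrow> \<Phi> (\<theta> r) = \<sigma> r"
    "\<Phi> ` carrier Q = {\<tau>. \<exists>r\<in>carrier J. \<exists>s\<in>regular_elements J. \<tau> * \<sigma> s = \<sigma> r}"
    using ring_of_fractions_universal [OF ring_J frac subset_refl hom inj regular_units] by blast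
  then show thesis
    using regular_denominators(1) by (intro that [of \<Phi>]) (simp_all add: bij_betw_def)
qed

end

lemma jordan_fraction_embedding_exists:
  "\<exists>\<sigma> :: 'k::field_char_0 jordan_elt \<Rightarrow> 'k weyl fraction mat2. jordan_fraction_embedding \<sigma>"
proof -
  obtain \<rho> :: "'k jordan_elt \<Rightarrow> 'k weyl mat2" where
    \<rho>: "\<rho> \<in> ring_hom super_jordan ring_of_type_algebra" "inj_on \<rho> (carrier super_jordan)"
    "\<rho> jordan_x = Mat2 0 1 0 0" "\<rho> jordan_y = Mat2 0 (weyl_t * weyl_d) weyl_t 0"
    "\<And>c. \<rho> (jordan_const c) = scalar2 (weyl_c c)"
    "\<rho> ` carrier super_jordan = range jordan_eval"
    by (rule jordan_embedding) (rule that)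
  have "jordan_fraction_embedding (frac_mat \<circ> \<rho>)"
  proof
    show "frac_mat \<circ> \<rho> \<in> ring_hom super_jordan ring_of_type_algebra"
      using \<rho>(1) unfolding type_algebra_ring_hom_iff by (simp add: frac_mat_simps)
    show "inj_on (frac_mat \<circ> \<rho>) (carrier super_jordan)"
      using \<rho>(2) by (auto simp: inj_on_def frac_mat_eq_iff)
    show "(frac_mat \<circ> \<rho>) ` carrier super_jordan = frac_mat ` jordan_mats"
      using \<rho>(6) by (simp only: image_comp [symmetric])
  qed (simp_all add: \<rho>)
  then show ?thesis by blast
qed

section \<open>The skew field of fractions of the Weyl algebra\<close>

lemma ring_weyl_algebra: "ring weyl_algebra"
  unfolding weyl_algebra_def by (rule ring_presented_algebra)

lemma weyl_fraction_embedding: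
  obtains f :: "'k::field weyl_elt \<Rightarrow> 'k weyl fraction" where
    "f \<in> ring_hom weyl_algebra ring_of_type_algebra" "inj_on f (carrier weyl_algebra)"
    "f ` carrier weyl_algebra = range frac"
    "f ` (carrier weyl_algebra - {\<zero>\<^bsub>weyl_algebra\<^esub>}) = range frac - {0}"
    "\<And>c. f (weyl_const c) = frac (weyl_c c)"
proof -
  obtain g :: "'k weyl_elt \<Rightarrow> 'k weyl" where
    g: "g \<in> ring_hom weyl_algebra ring_of_type_algebra" "bij_betw g (carrier weyl_algebra) UNIV"
    "\<And>c. g (weyl_const c) = weyl_c c" by (rule weyl_algebra_iso) (rule that)
  have hom: "frac \<circ> g \<in> ring_hom weyl_algebra ring_of_type_algebra"
    using g(1) unfolding type_algebra_ring_hom_iff by (simp add: frac_add frac_mult)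
  have inj: "inj_on (frac \<circ> g) (carrier weyl_algebra)"
    using g(2) by (auto simp: bij_betw_def inj_on_def)
  have im: "(frac \<circ> g) ` carrier weyl_algebra = range frac"
    using g(2) unfolding bij_betw_def by (simp only: image_comp [symmetric])
  have "(frac \<circ> g) \<zero>\<^bsub>weyl_algebra\<^esub> = 0"
    by (rule ring_hom_type_algebra_0 [OF ring_weyl_algebra hom])
  moreover have "\<zero>\<^bsub>weyl_algebra\<^esub> \<in> carrier weyl_algebra" by (rule ring.ring_simprules(2) [OF ring_weyl_algebra])
  ultimately have "(frac \<circ> g) ` (carrier weyl_algebra - {\<zero>\<^bsub>weyl_algebra\<^esub>}) = range frac - {0}"
    using inj_on_image_set_diff [OF inj, of "carrier weyl_algebra" "{\<zero>\<^bsub>weyl_algebra\<^esub>}"] im by simp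
  then show thesis using that [OF hom inj im] g(3) by simp
qed

lemma weyl_nonzero_localization:
  fixes f :: "'k::field weyl_elt \<Rightarrow> 'k weyl fraction"
  assumes f: "f \<in> ring_hom weyl_algebra ring_of_type_algebra" "inj_on f (carrier weyl_algebra)"
    and im: "f ` carrier weyl_algebra = range frac"
    and im0: "f ` (carrier weyl_algebra - {\<zero>\<^bsub>weyl_algebra\<^esub>}) = range frac - {0}"
  defines "W \<equiv> weyl_algebra" and "S \<equiv> carrier weyl_algebra - {\<zero>\<^bsub>weyl_algebra\<^esub>}"
  shows "f ` S \<subseteq> Units ring_of_type_algebra"
    and "S \<subseteq> regular_elements W"
    and "\<exists>r\<in>carrier W. \<exists>s\<in>S. \<tau> * f s = f r"
    and "\<exists>r\<in>carrier W. \<exists>s\<in>S. f s * \<tau> = f r"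
proof -
  show unit: "f ` S \<subseteq> Units ring_of_type_algebra"
  proof
    fix x assume "x \<in> f ` S"
    then have "x \<noteq> 0" unfolding S_def im0 by blast
    then show "x \<in> Units ring_of_type_algebra"
      unfolding type_algebra_Units_iff by (intro exI [of _ "inverse x"]) simp
  qed
  show "S \<subseteq> regular_elements W"
  proof
    fix c assume c: "c \<in> S"
    then have "c \<in> carrier W" by (simp add: S_def W_def)
    then show "c \<in> regular_elements W"
      using unit_preimage_regular [OF ring_weyl_algebra f] unit c unfolding W_def by blast
  qed
  have num: "\<exists>r\<in>carrier W. f r = frac a" for a
  proof -
    have "frac a \<in> f ` carrier W" unfolding W_def im by simp
    then show ?thesis by auto
  qed
  have den: "\<exists>s\<in>S. f s = frac b" if "b \<noteq> 0" for b
  proof -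
    have "frac b \<in> f ` S" unfolding S_def im0 using that by simp
    then show ?thesis by auto
  qed
  obtain a b where "b \<noteq> 0" "\<tau> * frac b = frac a" using fraction_mult_denominator by blast
  then show "\<exists>r\<in>carrier W. \<exists>s\<in>S. \<tau> * f s = f r" using num den by metis
  obtain a b where "b \<noteq> 0" "frac b * \<tau> = frac a" using denominator_mult_fraction by blast
  then show "\<exists>r\<in>carrier W. \<exists>s\<in>S. f s * \<tau> = f r" using num den by metis
qed

lemma weyl_skewfield_iso:
  fixes D :: "('d, 'm) ring_scheme" and \<psi> :: "'k::field weyl_elt \<Rightarrow> 'd"
  assumes "ring_of_fractions weyl_algebra (carrier weyl_algebra - {\<zero>\<^bsub>weyl_algebra\<^esub>}) D \<psi>"
  obtains \<Phi> :: "'d \<Rightarrow> 'k weyl fraction" where "\<Phi> \<in> ring_hom D ring_of_type_algebra"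
    "bij_betw \<Phi> (carrier D) UNIV" "\<And>c. \<Phi> (\<psi> (weyl_const c)) = frac (weyl_c c)"
proof -
  obtain f :: "'k weyl_elt \<Rightarrow> 'k weyl fraction" where
    f: "f \<in> ring_hom weyl_algebra ring_of_type_algebra" "inj_on f (carrier weyl_algebra)"
    "f ` carrier weyl_algebra = range frac"
    "f ` (carrier weyl_algebra - {\<zero>\<^bsub>weyl_algebra\<^esub>}) = range frac - {0}"
    and c: "\<And>c. f (weyl_const c) = frac (weyl_c c)" by (rule weyl_fraction_embedding) (rule that)
  note loc = weyl_nonzero_localization [OF f]
  obtain \<Phi> where \<Phi>: "\<Phi> \<in> ring_hom D ring_of_type_algebra" "inj_on \<Phi> (carrier D)"
    "\<And>r. r \<in> carrier weyl_algebra \<Longrightarrow> \<Phi> (\<psi> r) = f r"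
    "\<Phi> ` carrier D = {\<tau>. \<exists>r\<in>carrier weyl_algebra. \<exists>s\<in>carrier weyl_algebra - {\<zero>\<^bsub>weyl_algebra\<^esub>}. \<tau> * f s = f r}"
    using ring_of_fractions_universal [OF ring_weyl_algebra assms loc(2) f(1,2) loc(1)] by blast
  have "weyl_const c \<in> carrier weyl_algebra" for c :: 'k
    by (simp add: weyl_const_def weyl_algebra_def carrier_presented_algebra)
  then show thesis using \<Phi> c loc(3) by (intro that [of \<Phi>]) (simp_all add: bij_betw_def)
qed

lemma weyl_skewfield_exists:
  "\<exists>(D :: ('k::field weyl_elt \<times> 'k weyl_elt) set ring) (\<psi> :: 'k weyl_elt \<Rightarrow> _). skewfield_of_fractions weyl_algebra D \<psi>"
proof -
  let ?S = "carrier weyl_algebra - {\<zero>\<^bsub>weyl_algebra\<^esub>} :: 'k weyl_elt set"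
  obtain f :: "'k weyl_elt \<Rightarrow> 'k weyl fraction" where
    f: "f \<in> ring_hom weyl_algebra ring_of_type_algebra" "inj_on f (carrier weyl_algebra)"
    "f ` carrier weyl_algebra = range frac"
    "f ` ?S = range frac - {0}" by (rule weyl_fraction_embedding) (rule that)
  note loc = weyl_nonzero_localization [OF f]
  interpret W: ring "weyl_algebra :: 'k weyl_elt ring" by (rule ring_weyl_algebra)
  note fD = ring_hom_type_algebraD [OF f(1)]
  have f0: "f \<zero>\<^bsub>weyl_algebra\<^esub> = 0" by (rule ring_hom_type_algebra_0 [OF ring_weyl_algebra f(1)])
  have nz: "f s \<noteq> 0" if "s \<in> ?S" for s using that f(4) by blast
  have "\<exists>(D :: ('k weyl_elt \<times> 'k weyl_elt) set ring) \<psi>. ring_of_fractions weyl_algebra ?S D \<psi>"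
  proof (rule ring_of_fractions_exists [OF ring_weyl_algebra f(1,2) _ _ _ loc(1)])
    show "\<one>\<^bsub>weyl_algebra\<^esub> \<in> ?S" using fD(3) f0 by auto
    show "s \<otimes>\<^bsub>weyl_algebra\<^esub> t \<in> ?S" if "s \<in> ?S" "t \<in> ?S" for s t
    proof -
      have st: "s \<in> carrier weyl_algebra" "t \<in> carrier weyl_algebra" using that by simp_all
      have "f (s \<otimes>\<^bsub>weyl_algebra\<^esub> t) \<noteq> f \<zero>\<^bsub>weyl_algebra\<^esub>"
        using nz [OF that(1)] nz [OF that(2)] by (simp add: fD(1) [OF st] f0)
      then show ?thesis using W.m_closed [OF st] by auto
    qed
    show "right_ore_set weyl_algebra ?S" "left_ore_set weyl_algebra ?S"
      using ore_sets_of_units [OF ring_weyl_algebra f(1,2) Diff_subset loc(1,3,4)] by simp_all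
  qed simp
  then obtain D :: "('k weyl_elt \<times> 'k weyl_elt) set ring" and \<psi> where
    D: "ring_of_fractions weyl_algebra ?S D \<psi>" by blast
  obtain \<Phi> :: "_ \<Rightarrow> 'k weyl fraction" where "\<Phi> \<in> ring_hom D ring_of_type_algebra"
    "bij_betw \<Phi> (carrier D) UNIV" by (rule weyl_skewfield_iso [OF D]) (rule that)
  then have "skewfield D" by (rule skewfieldI_division_ring [OF ring_of_fractionsD(1) [OF D]])
  then have "skewfield_of_fractions weyl_algebra D \<psi>" using D by (simp add: skewfield_of_fractions_def)
  then show ?thesis by blast
qed

lemma jordan_quotient_ring_matrices:
  fixes Q :: "'q ring" and D :: "'d ring"
    and \<theta> :: "'k::field_char_0 jordan_elt \<Rightarrow> 'q" and \<psi> :: "'k weyl_elt \<Rightarrow> 'd"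
  assumes Q: "classical_quotient_ring super_jordan Q \<theta>"
    and D: "skewfield_of_fractions weyl_algebra D \<psi>"
  shows "\<exists>h\<in>ring_iso Q (matrix_ring 2 D).
    (\<forall>c. h (\<theta> (jordan_const c)) = scalar_matrix 2 D (\<psi> (weyl_const c))) \<and>
    central_simple_over D Q (inv_into (carrier Q) h \<circ> scalar_matrix 2 D)"
proof -
  obtain \<sigma> :: "'k jordan_elt \<Rightarrow> 'k weyl fraction mat2" where "jordan_fraction_embedding \<sigma>"
    using jordan_fraction_embedding_exists by blast
  then interpret jordan_fraction_embedding \<sigma> .
  obtain \<Phi> where \<Phi>: "\<Phi> \<in> ring_hom Q ring_of_type_algebra" "bij_betw \<Phi> (carrier Q) UNIV"
    "\<And>r. r \<in> carrier J \<Longrightarrow> \<Phi> (\<theta> r) = \<sigma> r" by (rule classical_quotient_ring_iso [OF Q]) (rule that)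
  have Dfrac: "ring_of_fractions weyl_algebra (carrier weyl_algebra - {\<zero>\<^bsub>weyl_algebra\<^esub>}) D \<psi>"
    using D unfolding skewfield_of_fractions_def by blast
  obtain f :: "'d \<Rightarrow> 'k weyl fraction" where f: "f \<in> ring_hom D ring_of_type_algebra"
    "bij_betw f (carrier D) UNIV" "\<And>c. f (\<psi> (weyl_const c)) = frac (weyl_c c)"
    by (rule weyl_skewfield_iso [OF Dfrac]) (rule that)
  have ring_D: "ring D" and \<psi>: "\<psi> \<in> ring_hom weyl_algebra D" by (rule ring_of_fractionsD [OF Dfrac])+
  have Qfrac: "ring_of_fractions J (regular_elements J) Q \<theta>"
    using Q unfolding classical_quotient_ring_def by blast
  have ring_Q: "ring Q" and \<theta>: "\<theta> \<in> ring_hom J Q" by (rule ring_of_fractionsD [OF Qfrac])+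
  let ?M = "matrix_ring 2 D"
  define g where "g A = Mat2 (f (A (0, 0))) (f (A (0, 1))) (f (A (1, 0))) (f (A (1::nat, 1::nat)))" for A
  note M = matrix_ring_2_iso [OF ring_D f(1,2), folded g_def]
  obtain h where h: "h \<in> ring_iso Q ?M" "\<And>q. q \<in> carrier Q \<Longrightarrow> g (h q) = \<Phi> q"
    using ring_iso_through_type [OF ring_Q \<Phi>(1,2) M(1,2,3,4,5)] by blast
  have h_closed: "h q \<in> carrier ?M" if "q \<in> carrier Q" for q
    by (rule ring_iso_memE(1) [OF h(1) that])
  have g_inj: "inj_on g (carrier ?M)" using M(2) by (simp add: bij_betw_def)
  have h_bij: "bij_betw h (carrier Q) (carrier ?M)" using h(1) by (simp add: ring_iso_def)
  have "h (\<theta> (jordan_const c)) = scalar_matrix 2 D (\<psi> (weyl_const c))" for c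
  proof (rule inj_onD [OF g_inj])
    have \<theta>c: "\<theta> (jordan_const c) \<in> carrier Q" by (rule ring_hom_closed [OF \<theta> gens_closed(3)])
    have \<psi>c: "\<psi> (weyl_const c) \<in> carrier D"
      by (rule ring_hom_closed [OF \<psi>])
         (simp add: weyl_const_def weyl_algebra_def carrier_presented_algebra)
    show "h (\<theta> (jordan_const c)) \<in> carrier ?M" by (rule h_closed [OF \<theta>c])
    show "scalar_matrix 2 D (\<psi> (weyl_const c)) \<in> carrier ?M" by (rule M(6) [OF \<psi>c])
    show "g (h (\<theta> (jordan_const c))) = g (scalar_matrix 2 D (\<psi> (weyl_const c)))"
      by (simp add: h(2) [OF \<theta>c] M(7) [OF \<psi>c] \<Phi>(3) gens_closed \<sigma>_const f(3) frac_mat_simps)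
  qed
  moreover have "central_simple_over D Q (inv_into (carrier Q) h \<circ> scalar_matrix 2 D)"
  proof (rule central_simple_over_mat2 [OF ring_D f(1,2) ring_Q \<Phi>(1,2)])
    fix d assume d: "d \<in> carrier D"
    have im: "scalar_matrix 2 D d \<in> h ` carrier Q"
      using M(6) [OF d] h_bij by (simp add: bij_betw_def)
    show closed: "(inv_into (carrier Q) h \<circ> scalar_matrix 2 D) d \<in> carrier Q"
      using inv_into_into [OF im] by simp
    show "\<Phi> ((inv_into (carrier Q) h \<circ> scalar_matrix 2 D) d) = scalar2 (f d)"
      using h(2) [OF closed] f_inv_into_f [OF im] M(7) [OF d] by simp
  qed
  ultimately show ?thesis using h(1) by blast
qed

theorem proposition3p1:
  shows
    "(\<exists>(L :: ('k::field_char_0 jordan_elt \<times> 'k jordan_elt) set ring)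
        (\<phi> :: 'k jordan_elt \<Rightarrow> ('k jordan_elt \<times> 'k jordan_elt) set).
        ring_of_fractions super_jordan jordan_s_powers L \<phi>)
   \<and> ring_center (super_jordan :: 'k jordan_elt ring) = range jordan_const
   \<and> (\<forall>(L :: 'l ring) (\<phi> :: 'k jordan_elt \<Rightarrow> 'l).
        ring_of_fractions super_jordan jordan_s_powers L \<phi> \<longrightarrow>
          ring_center L = range (\<phi> \<circ> jordan_const) \<and> simple_ring L \<and> prime_ring L)
   \<and> (\<exists>(D :: ('k weyl_elt \<times> 'k weyl_elt) set ring)
        (\<psi> :: 'k weyl_elt \<Rightarrow> ('k weyl_elt \<times> 'k weyl_elt) set).
        skewfield_of_fractions weyl_algebra D \<psi>)
   \<and> (\<exists>(Q :: ('k jordan_elt \<times> 'k jordan_elt) set ring)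
        (\<theta> :: 'k jordan_elt \<Rightarrow> ('k jordan_elt \<times> 'k jordan_elt) set).
        classical_quotient_ring super_jordan Q \<theta>)
   \<and> (\<forall>(Q :: 'q ring) (\<theta> :: 'k jordan_elt \<Rightarrow> 'q) (D :: 'd ring) (\<psi> :: 'k weyl_elt \<Rightarrow> 'd).
        classical_quotient_ring super_jordan Q \<theta> \<and> skewfield_of_fractions weyl_algebra D \<psi> \<longrightarrow>
          (\<exists>h \<in> ring_iso Q (matrix_ring 2 D).
             (\<forall>c. h (\<theta> (jordan_const c)) = scalar_matrix 2 D (\<psi> (weyl_const c))) \<and>
             central_simple_over D Q (inv_into (carrier Q) h \<circ> scalar_matrix 2 D)))"
proof -
  obtain \<sigma> :: "'k jordan_elt \<Rightarrow> 'k weyl fraction mat2" where "jordan_fraction_embedding \<sigma>"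
    using jordan_fraction_embedding_exists by blast
  then interpret jordan_fraction_embedding \<sigma> .
  show ?thesis
    by (intro conjI allI impI localization_exists center_J weyl_skewfield_exists
        classical_quotient_ring_exists)
      (erule localization, erule localization,
        erule simple_ring_imp_prime_ring [OF localization(2)],
        elim conjE, rule jordan_quotient_ring_matrices, assumption+)
qed

end
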